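(* Let $M$ be a $3$-manifold, let $k\ge 3$ be a differentiability class, and let $f,f'\in \mathrm{Diff}^k(M)$ have hyperbolic fixed points $p$, $p'$ and homoclinic quadratic tangencies $q$, $q'$ positively associated with $p$, $p'$, respectively. Suppose that $f$ is linear on a neighborhood $U(p)$ of $p$ and $f'$ is linear on a neighborhood $U(p')$ of $p'$; that $Df(p)$ has non-real eigenvalues $re^{\pm\sqrt{-1}\theta}$ and a real eigenvalue $\lambda$ with $r>1$, $\theta\not\equiv 0\bmod\pi$, $0<\lambda<1$; that $Df'(p')$ has non-real eigenvalues $r'e^{\pm\sqrt{-1}\theta'}$ and a real eigenvalue $\lambda'$ with $r'>1$, $\theta'\not\equiv 0\bmod\pi$, $0<\lambda'<1$; and that $\theta/2\pi$ is irrational. Let $h:M\to M$ be a conjugacy homeomorphism between $f$ and $f'$ (that is, $f'=h\circ f\circ h^{-1}$) with $h(p)=p'$ and $h(q)=q'$. Let $\widehat z$ be the homoclinic transverse point of $W^u(p)$ and $W^s(p)$ near $q$ described in the context, let $n\in\mathbb{N}$ be sufficiently large and fixed so that $s=f^{-n}(\widehat z)\in D_a(p)$, and put $s'=h(s)$. If $h|_{W^u_{\mathrm{loc}}(p)}$ is orientation-preserving, then $\dfrac{z(s)}{z(q)}=\dfrac{z'(s')}{z'(q')}$. Otherwise, $\dfrac{z(s)}{z(q)}=\overline{\left(\dfrac{z'(s')}{z'(q')}\right)}$.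
   Context: Basic notions. "$f$ is linear on $U(p)$" means linear with respect to some local coordinate of $M$ centered at $p$. $W^u(p)$, $W^s(p)$ are the unstable (dimension 2) and stable (dimension 1) manifolds of $p$; $W^u_{\mathrm{loc}}(p)$ is the local unstable manifold in $U(p)$. A homoclinic quadratic tangency associated with $p$ is a point $q\in W^u(p)\cap W^s(p)$, $q\neq p$, at which the curve $W^s(p)$ is tangent to the surface $W^u(p)$ with contact exactly quadratic (when $W^u(p)$ is straightened near $q$ to $\{\tau=0\}$, then along a regular parametrization of $W^s(p)$ with $q$ at parameter $0$ the function $\tau$ vanishes at $0$ with its first but not its second derivative). It is positively associated with $p$ if both $f^n(q)$ and $f^{-n}(\alpha\setminus\{q\})$ lie in the same component of $U(p)\setminus W^u_{\mathrm{loc}}(p)$ for sufficiently large $n\in\mathbb{N}$ and any (sufficiently) small curve $\alpha$ in $W^s(p)$ containing $q$. The same notions are used for $f',p',q'$. Coordinates. Let $(z,t)=(x,y,t)$, $z=x+\sqrt{-1}y\in\mathbb{C}$, be a linearizing coordinate around $p$, in which $W^u_{\mathrm{loc}}(p)\subset\{t=0\}$, $W^s_{\mathrm{loc}}(p)\subset\{z=0\}$, and in which $f$ acts on $W^u_{\mathrm{loc}}(p)$ by $z\mapsto re^{\sqrt{-1}\theta}z$ (replacing $\theta$ by $-\theta$ if necessary). For a small $a>0$ put $D_a(p)=\{z\in\mathbb{C};|z|\le a\}$, identified with $D_a(p)\times\{0\}\subset W^u_{\mathrm{loc}}(p)$, and $U_a(p)=D_a(p)\times[0,a]$. It is assumed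 that $q$ is in the interior of $D_a(p)$ and that $\widehat q=f^N(q)=(0,t_0)$ is in the interior of $\{0\}\times[0,a]\subset W^s_{\mathrm{loc}}(p)$ for some $N\in\mathbb{N}$. $D_{b'}(p')$, $U_{b'}(p')$, etc. are defined in the same way from a linearizing coordinate $(z',t')$ of $f'$ at $p'$, with $0<a'<b'$ and $a$ chosen so that $U_{a'}(p')\subset h(U_a(p))\subset U_{b'}(p')$, where $U_{b'}(p')$ is contained in the linearizing chart. For $\boldsymbol{x}\in D_a(p)$, $z(\boldsymbol{x})\in\mathbb{C}$ is its complex linearizing coordinate; for $\boldsymbol{x}'\in D_{b'}(p')$, $z'(\boldsymbol{x}')\in\mathbb{C}$ is its complex linearizing coordinate (note $s',q'\in D_{b'}(p')$). "Orientation-preserving" for $h|_{W^u_{\mathrm{loc}}(p)}$ is with respect to the orientations of $W^u_{\mathrm{loc}}(p)$, $W^u_{\mathrm{loc}}(p')$ given by the complex coordinates $z$, $z'$. The point $\widehat z$. Let $V_{\widehat q}$ be a small neighborhood of $\widehat q$ in $U_a(p)$ and let $\widetilde H$ be the component of $W^u(p)\cap V_{\widehat q}$ containing $\widehat q$. After a suitable choice of the linearizing coordinate, $\widetilde H$ is the graph of a $C^k$-function $x=\varphi(y,t)$ with $\varphi(0,t_0)=0$, $\frac{\partial\varphi}{\partial t}(0,t_0)=0$, $\frac{\partial^2\varphi}{\partial t^2}(0,t_0)\ne0$. Let $t=\eta(y)$ be the $C^{k-1}$-function near $y=0$ with $\eta(0)=t_0$ and $\frac{\partial\varphi}{\partial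 t}(y,\eta(y))=0$; the curve $\widetilde\gamma=\{(\varphi(y,\eta(y)),y,\eta(y))\}$ divides $\widetilde H$ into an upper and a lower part, and $\widetilde H^-$ is the closure of the lower component of $\widetilde H\setminus\widetilde\gamma$. For a sufficiently large $n_0\in\mathbb{N}$, the component $\widetilde H_0$ of $f^{n_0}(\widetilde H)\cap U_a(p)$ containing $q_*=f^{n_0}(\widehat q)$ is a disk whose boundary is a simple closed curve in $\{(z,t);|z|=a,\,0\le t<a\}$; put $\widetilde H_0^-=f^{n_0}(\widetilde H^-)\cap\widetilde H_0$. For $u\in\mathbb{N}$ let $\widetilde H_{0;u}^-$ be the component of $f^u(\widetilde H_0^-)\cap U_a(p)$ containing $f^u(q_* )$. There is a (large) $u$ for which $\widetilde H_{0;u}^-$ meets $W^s(p)$ transversely at a point near $q$; fix such a $u$ and let $\widehat z$ be such a transverse intersection point. *)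

theory Defs
  imports "HOL-Complex_Analysis.Complex_Analysis" "HOL-Library.Extended_Nat"
begin

section \<open>Differentiability classes and 3-manifolds\<close>

primrec cn_on :: "nat \<Rightarrow> 'a::euclidean_space set \<Rightarrow> ('a \<Rightarrow> 'b::real_normed_vector) \<Rightarrow> bool"
where
  "cn_on 0 S g \<longleftrightarrow> continuous_on S g"
| "cn_on (Suc n) S g \<longleftrightarrow>
     g differentiable_on S \<and> (\<forall>b\<in>Basis. cn_on n S (\<lambda>x. frechet_derivative g (at x) b))"

text \<open>Only used on open sets. The class \<open>\<infinity>\<close> is allowed.\<close>

definition ck_on :: "enat \<Rightarrow> 'a::euclidean_space set \<Rightarrow> ('a \<Rightarrow> 'b::real_normed_vector) \<Rightarrow> bool"
  where "ck_on k S g \<longleftrightarrow> (\<forall>n. enat n \<le> k \<longrightarrow> cn_on n S g)"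

text \<open>The model space is \<open>\<complex> \<times> \<real>\<close>, of real dimension 3; a chart is a pair of its domain and its
  coordinate map, whose values outside the domain are irrelevant.\<close>

type_synonym 'm chart = "'m set \<times> ('m \<Rightarrow> complex \<times> real)"

definition is_chart :: "'m::topological_space chart \<Rightarrow> bool"
  where "is_chart C \<longleftrightarrow> open (fst C) \<and> open (snd C ` fst C) \<and>
    homeomorphism (fst C) (snd C ` fst C) (snd C) (inv_into (fst C) (snd C))"

definition ck_compatible :: "enat \<Rightarrow> 'm chart \<Rightarrow> 'm chart \<Rightarrow> bool"
  where "ck_compatible k C D \<longleftrightarrow>
    ck_on k (snd C ` (fst C \<inter> fst D)) (snd D \<circ> inv_into (fst C) (snd C)) \<and>
    ck_on k (snd D ` (fst C \<inter> fst D)) (snd C \<circ> inv_into (fst D) (snd D))"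

text \<open>Hausdorff and second countable are imposed by the type class.\<close>

definition ck_3_manifold ::
  "enat \<Rightarrow> 'm::{t2_space,second_countable_topology} chart set \<Rightarrow> bool"
  where "ck_3_manifold k A \<longleftrightarrow>
    (\<forall>C\<in>A. is_chart C) \<and> (\<Union>C\<in>A. fst C) = UNIV \<and> (\<forall>C\<in>A. \<forall>D\<in>A. ck_compatible k C D)"

text \<open>A local coordinate of the manifold: a member of the maximal atlas.\<close>

definition local_coordinate :: "enat \<Rightarrow> 'm::topological_space chart set \<Rightarrow> 'm chart \<Rightarrow> bool"
  where "local_coordinate k A C \<longleftrightarrow> is_chart C \<and> (\<forall>D\<in>A. ck_compatible k C D)"

definition ck_map :: "enat \<Rightarrow> 'm::topological_space chart set \<Rightarrow> ('m \<Rightarrow> 'm) \<Rightarrow> bool"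
  where "ck_map k A f \<longleftrightarrow> continuous_on UNIV f \<and>
    (\<forall>C\<in>A. \<forall>D\<in>A. ck_on k (snd C ` (fst C \<inter> f -` fst D))
                         (snd D \<circ> f \<circ> inv_into (fst C) (snd C)))"

definition Diff :: "enat \<Rightarrow> 'm::topological_space chart set \<Rightarrow> ('m \<Rightarrow> 'm) set"
  where "Diff k A = {f. bij f \<and> ck_map k A f \<and> ck_map k A (inv f)}"

section \<open>Hyperbolic fixed points and their invariant manifolds\<close>

text \<open>Eigenvalue of the complexification: \<open>L (v + \<i> w) = \<mu> (v + \<i> w)\<close>, split into real and
  imaginary part.\<close>

definition complex_eigenvalue :: "('a::real_vector \<Rightarrow> 'a) \<Rightarrow> complex \<Rightarrow> bool"
  where "complex_eigenvalue L \<mu> \<longleftrightarrow> (\<exists>v w. (v \<noteq> 0 \<or> w \<noteq> 0) \<and>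
    L v = Re \<mu> *\<^sub>R v - Im \<mu> *\<^sub>R w \<and> L w = Im \<mu> *\<^sub>R v + Re \<mu> *\<^sub>R w)"

text \<open>Eigenvalues of the derivative at a fixed point; they do not depend on the chart.\<close>

definition derivative_eigenvalue ::
  "'m chart set \<Rightarrow> ('m \<Rightarrow> 'm) \<Rightarrow> 'm \<Rightarrow> complex \<Rightarrow> bool"
  where "derivative_eigenvalue A f p \<mu> \<longleftrightarrow> (\<exists>C\<in>A. p \<in> fst C \<and>
    complex_eigenvalue
      (frechet_derivative (snd C \<circ> f \<circ> inv_into (fst C) (snd C)) (at (snd C p))) \<mu>)"

definition hyperbolic_fixed_point :: "'m chart set \<Rightarrow> ('m \<Rightarrow> 'm) \<Rightarrow> 'm \<Rightarrow> bool"
  where "hyperbolic_fixed_point A f p \<longleftrightarrow>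
    f p = p \<and> (\<forall>\<mu>. derivative_eigenvalue A f p \<mu> \<longrightarrow> cmod \<mu> \<noteq> 1)"

definition stable_manifold :: "('m::topological_space \<Rightarrow> 'm) \<Rightarrow> 'm \<Rightarrow> 'm set"
  where "stable_manifold f p = {x. (\<lambda>n. (f ^^ n) x) \<longlonglongrightarrow> p}"

definition unstable_manifold :: "('m::topological_space \<Rightarrow> 'm) \<Rightarrow> 'm \<Rightarrow> 'm set"
  where "unstable_manifold f p = {x. (\<lambda>n. (inv f ^^ n) x) \<longlonglongrightarrow> p}"

definition local_stable :: "('m::topological_space \<Rightarrow> 'm) \<Rightarrow> 'm \<Rightarrow> 'm set \<Rightarrow> 'm set"
  where "local_stable f p U = {x \<in> stable_manifold f p. \<forall>n. (f ^^ n) x \<in> U}"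

definition local_unstable :: "('m::topological_space \<Rightarrow> 'm) \<Rightarrow> 'm \<Rightarrow> 'm set \<Rightarrow> 'm set"
  where "local_unstable f p U = {x \<in> unstable_manifold f p. \<forall>n. (inv f ^^ n) x \<in> U}"

text \<open>The invariant manifolds are injectively immersed and usually accumulate on themselves, so
  components, neighbourhoods and curves in them refer to their own manifold topology and not to
  the one induced from \<open>M\<close>. It is the direct limit of the embedded pieces
  \<open>f\<^sup>n (W\<^sup>u\<^sub>l\<^sub>o\<^sub>c)\<close>, respectively \<open>f\<^sup>-\<^sup>n (W\<^sup>s\<^sub>l\<^sub>o\<^sub>c)\<close>.\<close>

definition limit_topology :: "(nat \<Rightarrow> 'm::topological_space set) \<Rightarrow> 'm topology"
  where "limit_topology W = topology (\<lambda>S. S \<subseteq> (\<Union>n. W n) \<and>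
    (\<forall>n. openin (top_of_set (W n)) (S \<inter> W n)))"

lemma openin_limit_topology:
  "openin (limit_topology W) S \<longleftrightarrow>
     S \<subseteq> (\<Union>n. W n) \<and> (\<forall>n. openin (top_of_set (W n)) (S \<inter> W n))"
proof -
  have "istopology (\<lambda>S. S \<subseteq> (\<Union>n. W n) \<and> (\<forall>n. openin (top_of_set (W n)) (S \<inter> W n)))"
    unfolding istopology_def
  proof (intro conjI allI impI)
    fix S T n
    assume S: "S \<subseteq> (\<Union>n. W n) \<and> (\<forall>n. openin (top_of_set (W n)) (S \<inter> W n))"
      and T: "T \<subseteq> (\<Union>n. W n) \<and> (\<forall>n. openin (top_of_set (W n)) (T \<inter> W n))"
    show "S \<inter> T \<subseteq> (\<Union>n. W n)" using S by blast
    have "(S \<inter> T) \<inter> W n = (S \<inter> W n) \<inter> (T \<inter> W n)" by blast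
    then show "openin (top_of_set (W n)) ((S \<inter> T) \<inter> W n)"
      using openin_Int[of "top_of_set (W n)" "S \<inter> W n" "T \<inter> W n"] S T by simp
  next
    fix K n
    assume K: "\<forall>S\<in>K. S \<subseteq> (\<Union>n. W n) \<and> (\<forall>n. openin (top_of_set (W n)) (S \<inter> W n))"
    show "\<Union>K \<subseteq> (\<Union>n. W n)" using K by blast
    have "\<Union>K \<inter> W n = \<Union>((\<lambda>S. S \<inter> W n) ` K)" by blast
    moreover have "openin (top_of_set (W n)) (\<Union>((\<lambda>S. S \<inter> W n) ` K))"
      by (rule openin_Union) (use K in blast)
    ultimately show "openin (top_of_set (W n)) (\<Union>K \<inter> W n)" by simp
  qed
  then show ?thesis unfolding limit_topology_def by simp
qed

definition stable_topology :: "('m::topological_space \<Rightarrow> 'm) \<Rightarrow> 'm \<Rightarrow> 'm set \<Rightarrow> 'm topology"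
  where "stable_topology f p U = limit_topology (\<lambda>n. (inv f ^^ n) ` local_stable f p U)"

definition unstable_topology :: "('m::topological_space \<Rightarrow> 'm) \<Rightarrow> 'm \<Rightarrow> 'm set \<Rightarrow> 'm topology"
  where "unstable_topology f p U = limit_topology (\<lambda>n. (f ^^ n) ` local_unstable f p U)"

section \<open>Contact of the stable and the unstable manifold\<close>

text \<open>\<open>\<tau> = snd \<circ> snd C\<close> straightens \<open>W\<^sup>u(p)\<close> near \<open>q\<close> to \<open>{\<tau> = 0}\<close>, and \<open>c\<close> is a regular
  parametrization of \<open>W\<^sup>s(p)\<close> on \<open>(- \<epsilon>, \<epsilon>)\<close> with \<open>c 0 = q\<close>.\<close>

definition straightened_at ::
  "enat \<Rightarrow> 'm::topological_space chart set \<Rightarrow> ('m \<Rightarrow> 'm) \<Rightarrow> 'm \<Rightarrow> 'm set \<Rightarrow> 'm \<Rightarrow>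
    'm chart \<Rightarrow> real \<Rightarrow> (real \<Rightarrow> 'm) \<Rightarrow> bool"
  where "straightened_at k A f p U q C \<epsilon> c \<longleftrightarrow>
    local_coordinate k A C \<and> q \<in> fst C \<and>
    connected_component_of_set (subtopology (unstable_topology f p U) (fst C)) q
      = {x \<in> fst C. snd (snd C x) = 0} \<and>
    0 < \<epsilon> \<and> c 0 = q \<and> inj_on c {-\<epsilon><..<\<epsilon>} \<and>
    continuous_map (top_of_set {-\<epsilon><..<\<epsilon>}) (subtopology (stable_topology f p U) (fst C)) c \<and>
    ck_on k {-\<epsilon><..<\<epsilon>} (snd C \<circ> c) \<and>
    (\<forall>s\<in>{-\<epsilon><..<\<epsilon>}. vector_derivative (snd C \<circ> c) (at s) \<noteq> 0)"

definition homoclinic_quadratic_tangency ::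
  "enat \<Rightarrow> 'm::topological_space chart set \<Rightarrow> ('m \<Rightarrow> 'm) \<Rightarrow> 'm \<Rightarrow> 'm set \<Rightarrow> 'm \<Rightarrow> bool"
  where "homoclinic_quadratic_tangency k A f p U q \<longleftrightarrow>
    q \<in> unstable_manifold f p \<inter> stable_manifold f p \<and> q \<noteq> p \<and>
    (\<exists>C \<epsilon> c. straightened_at k A f p U q C \<epsilon> c \<and>
      deriv (\<lambda>s. snd (snd C (c s))) 0 = 0 \<and>
      (deriv ^^ 2) (\<lambda>s. snd (snd C (c s))) 0 \<noteq> 0)"

definition transverse_homoclinic_point ::
  "enat \<Rightarrow> 'm::topological_space chart set \<Rightarrow> ('m \<Rightarrow> 'm) \<Rightarrow> 'm \<Rightarrow> 'm set \<Rightarrow> 'm \<Rightarrow> bool"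
  where "transverse_homoclinic_point k A f p U x \<longleftrightarrow>
    x \<in> unstable_manifold f p \<inter> stable_manifold f p \<and> x \<noteq> p \<and>
    (\<exists>C \<epsilon> c. straightened_at k A f p U x C \<epsilon> c \<and> deriv (\<lambda>s. snd (snd C (c s))) 0 \<noteq> 0)"

text \<open>Curves in \<open>W\<^sup>s(p)\<close> are the connected subsets of this 1-manifold. How small \<open>\<alpha>\<close> has to be
  depends on \<open>n\<close>, because \<open>f\<^sup>-\<^sup>n\<close> expands \<open>W\<^sup>s(p)\<close>.\<close>

definition positively_associated ::
  "('m::topological_space \<Rightarrow> 'm) \<Rightarrow> 'm \<Rightarrow> 'm set \<Rightarrow> 'm \<Rightarrow> bool"
  where "positively_associated f p U q \<longleftrightarrow>
    (\<forall>\<^sub>F n in sequentially. \<exists>N. openin (stable_topology f p U) N \<and> q \<in> N \<and>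
      (\<forall>\<alpha>\<subseteq>N. connectedin (stable_topology f p U) \<alpha> \<and> q \<in> \<alpha> \<longrightarrow>
        (\<exists>K \<in> components (U - local_unstable f p U).
          (f ^^ n) q \<in> K \<and> (inv f ^^ n) ` (\<alpha> - {q}) \<subseteq> K)))"

section \<open>Linearizing coordinates\<close>

abbreviation z_coord :: "'m chart \<Rightarrow> 'm \<Rightarrow> complex"
  where "z_coord C x \<equiv> fst (snd C x)"

abbreviation t_coord :: "'m chart \<Rightarrow> 'm \<Rightarrow> real"
  where "t_coord C x \<equiv> snd (snd C x)"

definition linear_on_nbhd ::
  "enat \<Rightarrow> 'm::topological_space chart set \<Rightarrow> ('m \<Rightarrow> 'm) \<Rightarrow> 'm \<Rightarrow> 'm set \<Rightarrow> 'm chart \<Rightarrow> bool"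
  where "linear_on_nbhd k A f p U C \<longleftrightarrow>
    local_coordinate k A C \<and> p \<in> fst C \<and> snd C p = 0 \<and>
    open U \<and> p \<in> U \<and> U \<subseteq> fst C \<and> f ` U \<subseteq> fst C \<and>
    (\<exists>L. linear L \<and> (\<forall>x\<in>U. snd C (f x) = L (snd C x)))"

text \<open>The clause \<open>t = 0 \<Longrightarrow> x \<in> W\<^sup>u\<^sub>l\<^sub>o\<^sub>c\<close> says that \<open>U\<close> is not so irregular that \<open>W\<^sup>u\<^sub>l\<^sub>o\<^sub>c\<close> fails to
  separate it; otherwise the components in \<open>positively_associated\<close> would not be the two sides
  of \<open>W\<^sup>u\<^sub>l\<^sub>o\<^sub>c\<close>.\<close>

definition linearizing_coordinate ::
  "enat \<Rightarrow> 'm::topological_space chart set \<Rightarrow> ('m \<Rightarrow> 'm) \<Rightarrow> 'm \<Rightarrow> 'm set \<Rightarrow>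
    real \<Rightarrow> real \<Rightarrow> 'm chart \<Rightarrow> bool"
  where "linearizing_coordinate k A f p U r \<theta> C \<longleftrightarrow>
    linear_on_nbhd k A f p U C \<and>
    (\<forall>x\<in>local_unstable f p U. t_coord C x = 0) \<and>
    (\<forall>x\<in>local_stable f p U. z_coord C x = 0) \<and>
    (\<forall>x\<in>U. t_coord C x = 0 \<longrightarrow> x \<in> local_unstable f p U) \<and>
    (\<forall>x\<in>local_unstable f p U. z_coord C (f x) = rcis r \<theta> * z_coord C x)"

text \<open>All standing hypotheses on one of the two diffeomorphisms. The eigenvalue condition is
  symmetric in the sign of \<open>\<theta>\<close>; the sign is fixed by the linearizing coordinate.\<close>

definition saddle_focus_with_tangency ::
  "enat \<Rightarrow> 'm::topological_space chart set \<Rightarrow> ('m \<Rightarrow> 'm) \<Rightarrow> 'm \<Rightarrow> 'm \<Rightarrow>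
    real \<Rightarrow> real \<Rightarrow> real \<Rightarrow> 'm set \<Rightarrow> 'm chart \<Rightarrow> bool"
  where "saddle_focus_with_tangency k A f p q r \<theta> l U C \<longleftrightarrow>
    f \<in> Diff k A \<and> hyperbolic_fixed_point A f p \<and>
    derivative_eigenvalue A f p (rcis r \<theta>) \<and> derivative_eigenvalue A f p (rcis r (- \<theta>)) \<and>
    derivative_eigenvalue A f p (of_real l) \<and>
    1 < r \<and> (\<forall>m::int. \<theta> \<noteq> of_int m * pi) \<and> 0 < l \<and> l < 1 \<and>
    linearizing_coordinate k A f p U r \<theta> C \<and>
    homoclinic_quadratic_tangency k A f p U q \<and> positively_associated f p U q"

text \<open>\<open>D\<^sub>a(p)\<close> and \<open>U\<^sub>a(p)\<close> as subsets of \<open>M\<close>; they are the full disk and the full cylinder only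
  if \<open>box_in_chart\<close> holds.\<close>

definition D_disk :: "'m set \<Rightarrow> 'm chart \<Rightarrow> real \<Rightarrow> 'm set"
  where "D_disk U C a = {x \<in> U. cmod (z_coord C x) \<le> a \<and> t_coord C x = 0}"

definition U_box :: "'m set \<Rightarrow> 'm chart \<Rightarrow> real \<Rightarrow> 'm set"
  where "U_box U C a = {x \<in> U. cmod (z_coord C x) \<le> a \<and> 0 \<le> t_coord C x \<and> t_coord C x \<le> a}"

definition box_in_chart :: "'m set \<Rightarrow> 'm chart \<Rightarrow> real \<Rightarrow> bool"
  where "box_in_chart U C a \<longleftrightarrow> 0 < a \<and> cball 0 a \<times> {0..a} \<subseteq> snd C ` U"

section \<open>The fold of the unstable manifold\<close>

text \<open>\<open>H\<close> is the graph of \<open>x = g (y, t)\<close> over \<open>E\<close>, with quadratic contact with the \<open>t\<close>-axis at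
  \<open>(0, t0)\<close>, and is divided by the curve \<open>t = \<eta> y\<close> into two components.\<close>

definition quadratic_fold_graph ::
  "enat \<Rightarrow> 'm::topological_space chart \<Rightarrow> real \<Rightarrow> 'm set \<Rightarrow> (real \<times> real) set \<Rightarrow>
    (real \<times> real \<Rightarrow> real) \<Rightarrow> real set \<Rightarrow> (real \<Rightarrow> real) \<Rightarrow> bool"
  where "quadratic_fold_graph k C t0 H E g J \<eta> \<longleftrightarrow>
    open E \<and> (0, t0) \<in> E \<and> ck_on k E g \<and>
    snd C ` H = {(Complex (g (y, t)) y, t) | y t. (y, t) \<in> E} \<and>
    g (0, t0) = 0 \<and> deriv (\<lambda>t. g (0, t)) t0 = 0 \<and> (deriv ^^ 2) (\<lambda>t. g (0, t)) t0 \<noteq> 0 \<and>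
    open J \<and> is_interval J \<and> 0 \<in> J \<and> E \<subseteq> J \<times> UNIV \<and>
    ck_on (k - 1) J \<eta> \<and> \<eta> 0 = t0 \<and>
    (\<forall>y\<in>J. (y, \<eta> y) \<in> E \<and> deriv (\<lambda>t. g (y, t)) (\<eta> y) = 0) \<and>
    components (H - {x \<in> H. t_coord C x = \<eta> (Im (z_coord C x))})
      = {{x \<in> H. t_coord C x > \<eta> (Im (z_coord C x))},
         {x \<in> H. t_coord C x < \<eta> (Im (z_coord C x))}}"

definition fold_lower_half ::
  "'m::topological_space chart \<Rightarrow> 'm set \<Rightarrow> (real \<Rightarrow> real) \<Rightarrow> 'm set"
  where "fold_lower_half C H \<eta> = closure {x \<in> H. t_coord C x < \<eta> (Im (z_coord C x))}"

text \<open>\<open>H\<^sub>0\<close>, \<open>H\<^sub>0\<^sup>-\<close> and \<open>H\<^sub>0\<^sub>;\<^sub>u\<^sup>-\<close>, where \<open>x\<close> is the point \<open>f\<^sup>N(q)\<close> of \<open>H\<close> and \<open>B\<close> is \<open>U\<^sub>a(p)\<close>.\<close>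

definition fold_disk ::
  "('m::topological_space \<Rightarrow> 'm) \<Rightarrow> 'm set \<Rightarrow> 'm set \<Rightarrow> 'm \<Rightarrow> nat \<Rightarrow> 'm set"
  where "fold_disk f B H x n0 = connected_component_set ((f ^^ n0) ` H \<inter> B) ((f ^^ n0) x)"

definition fold_half_disk ::
  "('m::topological_space \<Rightarrow> 'm) \<Rightarrow> 'm set \<Rightarrow> 'm chart \<Rightarrow> 'm set \<Rightarrow> (real \<Rightarrow> real) \<Rightarrow> 'm \<Rightarrow> nat \<Rightarrow> 'm set"
  where "fold_half_disk f B C H \<eta> x n0 =
    (f ^^ n0) ` fold_lower_half C H \<eta> \<inter> fold_disk f B H x n0"

definition fold_half_disk_iterate ::
  "('m::topological_space \<Rightarrow> 'm) \<Rightarrow> 'm set \<Rightarrow> 'm chart \<Rightarrow> 'm set \<Rightarrow> (real \<Rightarrow> real) \<Rightarrow> 'm \<Rightarrow> nat \<Rightarrow>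
    nat \<Rightarrow> 'm set"
  where "fold_half_disk_iterate f B C H \<eta> x n0 u =
    connected_component_set ((f ^^ u) ` fold_half_disk f B C H \<eta> x n0 \<inter> B)
      ((f ^^ u) ((f ^^ n0) x))"

definition spanning_disk :: "'m::topological_space set \<Rightarrow> 'm chart \<Rightarrow> real \<Rightarrow> 'm set \<Rightarrow> bool"
  where "spanning_disk U C a S \<longleftrightarrow>
    (\<exists>d d'. homeomorphism (cball (0::complex) 1) S d d' \<and>
      d ` sphere 0 1 \<subseteq> {x \<in> U. cmod (z_coord C x) = a \<and> 0 \<le> t_coord C x \<and> t_coord C x < a})"

section \<open>Orientation\<close>

text \<open>For an injective continuous map of a plane open set: local degree 1 at every point.\<close>

definition orientation_preserving_on :: "complex set \<Rightarrow> (complex \<Rightarrow> complex) \<Rightarrow> bool"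
  where "orientation_preserving_on S g \<longleftrightarrow>
    (\<forall>w \<rho>. 0 < \<rho> \<and> cball w \<rho> \<subseteq> S \<longrightarrow> winding_number (g \<circ> circlepath w \<rho>) (g w) = 1)"

text \<open>\<open>h\<close> restricted to \<open>W = W\<^sup>u\<^sub>l\<^sub>o\<^sub>c(p)\<close>, expressed in the coordinates \<open>z\<close> and \<open>z'\<close> where it takes
  values in \<open>W' = W\<^sup>u\<^sub>l\<^sub>o\<^sub>c(p')\<close>.\<close>

definition preserves_unstable_orientation ::
  "'m set \<Rightarrow> 'm chart \<Rightarrow> 'm set \<Rightarrow> 'm chart \<Rightarrow> ('m \<Rightarrow> 'm) \<Rightarrow> bool"
  where "preserves_unstable_orientation W C W' C' h \<longleftrightarrow>
    orientation_preserving_on (z_coord C ` (W \<inter> h -` W'))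
      (\<lambda>w. z_coord C' (h (inv_into W (z_coord C) w)))"

end

theory Submission
  imports Defs
begin

text \<open>The ratio is preserved because, in the coordinates \<open>z\<close> and \<open>z'\<close>, the conjugacy \<open>h\<close> acts on the
local unstable manifold as \<open>z \<mapsto> \<kappa> z\<close> or as \<open>z \<mapsto> \<kappa> cnj z\<close> for a constant \<open>\<kappa> \<noteq> 0\<close>. The constant
cancels in the ratio, and the winding number of the image of a circle tells the two cases apart.

The conformal form of \<open>h\<close> comes from a family of inequalities that have a topological meaning.
Consider an orbit segment that starts near a point \<open>(0, t0)\<close> of the forward orbit of the tangency,
follows the saddle for \<open>m\<close> steps, arrives near a point \<open>q\<close> of the backward orbit, is carried back
to \<open>(0, t0)\<close> in \<open>N\<close> steps, and after \<open>n\<close> further steps lands near a point \<open>x\<close> of the local unstable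
manifold. Such an excursion reaches \<open>q\<close> at height about \<open>l^m t0\<close>. Let \<open>\<tau>(w, T)\<close> be the height near
\<open>q\<close> of the point that the \<open>N\<close> steps carry to \<open>(w, T)\<close>. Positive association says \<open>\<tau>(0, T) > 0\<close> for
\<open>T \<noteq> t0\<close> near \<open>t0\<close>. So \<open>\<tau>(0, T)\<close> has a minimum at \<open>t0\<close>, the derivative of \<open>\<tau>\<close> at \<open>(0, t0)\<close> depends on
\<open>w\<close> only, and it has the form \<open>- Re (cnj \<mu> w)\<close> with \<open>\<mu> \<noteq> 0\<close>. Since
\<open>w = (r e^{i \<theta>})^{-n} z(x)\<close>, excursions with long \<open>n\<close> and \<open>m\<close> exist, up to an arbitrarily small
error, exactly if
\<open>- Re (cnj \<mu> e^{- i n \<theta>} z(x)) \<le> t0 r^n l^m\<close>: necessity (\<open>excursion_necessary\<close>) is the first-order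
expansion of \<open>\<tau>\<close>, and sufficiency (\<open>excursion_sufficient\<close>) is the intermediate value theorem in \<open>T\<close>.
A homeomorphism carries excursions to excursions, so the inequality for \<open>x\<close> and the one for \<open>h x\<close>
are equivalent up to small errors (\<open>excursion_inequality_transfer\<close>).

What remains is a problem in the plane, solved in the locale \<open>plane_conjugacy\<close>. Letting \<open>m\<close> tend to
infinity for fixed \<open>n\<close> shows that half-planes with boundary through \<open>0\<close> and normal in a limiting direction
of \<open>n \<theta>\<close> go to such half-planes with normal in the corresponding direction of \<open>n \<theta>'\<close>. As \<open>\<theta>\<close> is irrational, this correspondence
is a continuous homomorphism of the circle. It is \<open>u \<mapsto> u\<close> or \<open>u \<mapsto> cnj u\<close>, for otherwise the whole
image would lie in one half-plane. Hence rays go to rays (\<open>rays_preserved\<close>). Letting \<open>n\<close> and \<open>m\<close> tend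
to infinity together, with \<open>r^n l^m\<close> bounded away from \<open>0\<close> and infinity, shows that \<open>\<bar>h(x)\<bar> / \<bar>x\<bar>\<close> is
constant on certain lines at small positive distance from \<open>0\<close> (\<open>ratio_const_on_line\<close>). These lines
approach every line through \<open>0\<close>, and so the quotient is constant. Finally the dynamics carries the
resulting formula from a neighbourhood of \<open>p\<close> to the whole local unstable manifold.\<close>

section \<open>Limit directions of two rotations\<close>

text \<open>A continuous logarithm of \<open>X\<close> is additive up to multiples of \<open>2 pi\<close>; these cannot jump, so they
are constant. An additive continuous function is determined by its values on the rationals.\<close>

lemma continuous_circle_hom:
  fixes X :: "real \<Rightarrow> complex"
  assumes cont: "continuous_on UNIV X" and norm: "\<And>t. cmod (X t) = 1"
    and hom: "\<And>s t. X (s + t) = X s * X t"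
  obtains c where "\<And>t. X t = cis (c * t)"
proof -
  have nz: "X t \<noteq> 0" for t using norm[of t] by auto
  obtain g where g: "continuous_on UNIV g" "\<And>t. X t = exp (g t)"
    using continuous_logarithm_on_contractible[of UNIV X] cont nz convex_imp_contractible[OF convex_UNIV]
    by (metis UNIV_I)
  have "Re (g t) = 0" for t
    using norm[of t] g(2)[of t] by simp
  define a where "a t = Im (g t)" for t
  have X: "X t = cis (a t)" for t
    using g(2)[of t] \<open>Re (g t) = 0\<close> by (simp add: a_def exp_eq_polar)
  have ca: "continuous_on UNIV a" unfolding a_def by (intro continuous_intros g)
  have const: "a (s + t) - a s - a t = - a 0" for s t
  proof -
    have "(\<lambda>t. a (s + t) - a s - a t) constant_on UNIV"
    proof (rule continuous_discrete_range_constant)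
      show "continuous_on UNIV (\<lambda>t. a (s + t) - a s - a t)"
        by (intro continuous_intros continuous_on_compose2[OF ca]) auto
      show "\<exists>e>0. \<forall>y. y \<in> UNIV \<and> a (s + y) - a s - a y \<noteq> a (s + x) - a s - a x
          \<longrightarrow> e \<le> norm (a (s + y) - a s - a y - (a (s + x) - a s - a x))" for x
      proof (intro exI[of _ "2*pi"] conjI allI impI)
        fix y assume ne: "y \<in> UNIV \<and> a (s + y) - a s - a y \<noteq> a (s + x) - a s - a x"
        have *: "\<exists>n::int. a (s + z) - a s - a z = of_int (2*n) * pi" for z
        proof -
          have "cis (a (s + z) - a s - a z) = 1"
            using hom[of s z] nz[of s] nz[of z] by (simp add: X cis_divide[symmetric])
          then show ?thesis by (simp add: complex_eq_iff cos_one_2pi_int) (metis mult.commute mult.left_commute)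
        qed
        obtain m n :: int where mn: "a (s + y) - a s - a y = of_int (2*m) * pi"
           "a (s + x) - a s - a x = of_int (2*n) * pi" using * by metis
        have "m \<noteq> n" using ne mn by auto
        then have "1 \<le> \<bar>real_of_int (m - n)\<bar>" by linarith
        moreover have "norm (a (s + y) - a s - a y - (a (s + x) - a s - a x)) = 2 * pi * \<bar>real_of_int (m - n)\<bar>"
        proof -
          have "a (s + y) - a s - a y - (a (s + x) - a s - a x) = 2 * pi * real_of_int (m - n)"
            unfolding mn by (simp add: algebra_simps)
          then show ?thesis by (simp only: real_norm_def abs_mult) simp
        qed
        ultimately show "2*pi \<le> norm (a (s + y) - a s - a y - (a (s + x) - a s - a x))" 
          by simp
      qed auto
    qed auto
    then obtain k where k: "\<And>t. a (s + t) - a s - a t = k" unfolding constant_on_def by auto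
    show ?thesis using k[of t] k[of 0] by simp
  qed
  define b where "b t = a t - a 0" for t
  have add: "b (s + t) = b s + b t" for s t using const[of s t] by (simp add: b_def)
  have cb: "continuous_on UNIV b" unfolding b_def by (intro continuous_intros ca)
  have b0: "b 0 = 0" by (simp add: b_def)
  have bneg: "b (- t) = - b t" for t using add[of t "-t"] b0 by simp
  have bnat: "b (real n * t) = real n * b t" for n t
    by (induction n) (auto simp: b0 add algebra_simps)
  have bint: "b (of_int n * t) = of_int n * b t" for n t
  proof (cases "n \<ge> 0")
    case True
    then show ?thesis using bnat[of "nat n" t] by simp
  next
    case False
    then show ?thesis using bnat[of "nat (- n)" t] bneg[of "of_int n * t"] by simp
  qed
  have brat: "b q = q * b 1" if qr: "q \<in> \<rat>" for q
  proof -
    obtain m n where q: "n > 0" "q = of_int m / of_int n" using Rats_cases'[OF qr] by metis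
    have "of_int n * b q = b (of_int n * q)" by (simp add: bint)
    also have "\<dots> = b (of_int m * 1)" using q by simp
    also have "\<dots> = of_int m * b 1" by (rule bint)
    finally have *: "of_int n * b q = of_int m * b 1" .
    have "of_int n * (q * b 1) = of_int n * q * b 1" by (rule mult.assoc[symmetric])
    also have "of_int n * q = of_int m" using q by simp
    finally have "of_int n * b q = of_int n * (q * b 1)" using * by (rule trans[rotated, OF sym])
    then show ?thesis using q(1) by (simp only: mult_cancel_left of_int_eq_0_iff) simp
  qed
  have bt: "b t = t * b 1" for t
  proof -
    have "closed {t. b t = t * b 1}"
      by (intro closed_Collect_eq continuous_intros cb)
    moreover have "\<rat> \<subseteq> {t. b t = t * b 1}" using brat by blast
    ultimately have "closure \<rat> \<subseteq> {t. b t = t * b 1}" by (rule closure_minimal[rotated])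
    moreover have "t \<in> closure \<rat>" by (simp add: Rats_closure_real)
    ultimately show ?thesis by blast
  qed
  have "X t = cis (a 0 + b 1 * t)" for t
  proof -
    have "a t = a 0 + b 1 * t" using bt[of t] by (simp add: b_def mult.commute)
    then show ?thesis by (simp only: X)
  qed
  moreover have "cis (a 0) = 1"
    using hom[of 0 0] nz[of 0] by (simp add: X)
  ultimately have "X t = cis (b 1 * t)" for t by (simp add: cis_mult[symmetric])
  then show ?thesis by (rule that)
qed

text \<open>The pairs of unit vectors that the powers of the two rotations approach at the same times,
along arbitrarily large times; they form a closed set that is stable under
products.\<close>

definition direction_limit :: "real \<Rightarrow> real \<Rightarrow> complex \<Rightarrow> complex \<Rightarrow> bool"
  where "direction_limit \<theta> \<theta>' u v \<longleftrightarrow>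
    (\<forall>\<epsilon>>0. \<forall>M. \<exists>n\<ge>M. dist (cis (real n * \<theta>)) u < \<epsilon> \<and> dist (cis (real n * \<theta>')) v < \<epsilon>)"

lemma direction_limit_swap: "direction_limit \<theta> \<theta>' u v \<Longrightarrow> direction_limit \<theta>' \<theta> v u"
  unfolding direction_limit_def by blast

lemma direction_limit_norm:
  assumes "direction_limit \<theta> \<theta>' u v" shows "cmod u = 1" "cmod v = 1"
proof -
  have *: "cmod u = 1" if lim: "direction_limit \<theta> \<theta>' u v" for \<theta> \<theta>' u v
  proof (rule ccontr)
    assume "cmod u \<noteq> 1"
    then obtain n where "dist (cis (real n * \<theta>)) u < \<bar>cmod u - 1\<bar>"
      using lim[unfolded direction_limit_def, rule_format, of "\<bar>cmod u - 1\<bar>" 0] by auto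
    moreover have "\<bar>cmod u - cmod (cis (real n * \<theta>))\<bar> \<le> dist (cis (real n * \<theta>)) u"
      using norm_triangle_ineq3[of u "cis (real n * \<theta>)"] by (simp add: dist_norm norm_minus_commute)
    ultimately show False by simp
  qed
  show "cmod u = 1" "cmod v = 1" using * assms direction_limit_swap by blast+
qed

lemma direction_limit_mult:
  assumes "direction_limit \<theta> \<theta>' u v" "direction_limit \<theta> \<theta>' u' v'"
  shows "direction_limit \<theta> \<theta>' (u * u') (v * v')"
  unfolding direction_limit_def
proof (intro allI impI)
  fix \<epsilon> :: real and M :: nat assume "\<epsilon> > 0"
  obtain n where n: "n \<ge> M" "dist (cis (real n * \<theta>)) u < \<epsilon>/2" "dist (cis (real n * \<theta>')) v < \<epsilon>/2"
    using assms(1)[unfolded direction_limit_def, rule_format, of "\<epsilon>/2" M] \<open>\<epsilon> > 0\<close> by auto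
  obtain n' where n': "n' \<ge> M" "dist (cis (real n' * \<theta>)) u' < \<epsilon>/2" "dist (cis (real n' * \<theta>')) v' < \<epsilon>/2"
    using assms(2)[unfolded direction_limit_def, rule_format, of "\<epsilon>/2" M] \<open>\<epsilon> > 0\<close> by auto
  have *: "dist (cis (real (n + n') * t)) (w * w') < \<epsilon>"
    if "dist (cis (real n * t)) w < \<epsilon>/2" "dist (cis (real n' * t)) w' < \<epsilon>/2" "cmod w' = 1" for t w w'
  proof -
    have "cis (real (n + n') * t) - w * w' = cis (real n * t) * (cis (real n' * t) - w') + (cis (real n * t) - w) * w'"
      by (simp add: algebra_simps cis_mult)
    then have "cmod (cis (real (n + n') * t) - w * w') \<le> cmod (cis (real n' * t) - w') + cmod (cis (real n * t) - w)"
      using norm_triangle_ineq[of "cis (real n * t) * (cis (real n' * t) - w')" "(cis (real n * t) - w) * w'"]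
      by (simp add: norm_mult that(3))
    then show ?thesis using that by (simp add: dist_norm)
  qed
  show "\<exists>n\<ge>M. dist (cis (real n * \<theta>)) (u * u') < \<epsilon> \<and> dist (cis (real n * \<theta>')) (v * v') < \<epsilon>"
    using *[OF n(2) n'(2)] *[OF n(3) n'(3)] direction_limit_norm assms n(1)
    by (intro exI[of _ "n + n'"]) auto
qed

lemma direction_limit_closed:
  "closed {(u, v). direction_limit \<theta> \<theta>' u v}"
proof (subst closed_sequential_limits, intro allI impI, elim conjE)
  fix x :: "nat \<Rightarrow> complex \<times> complex" and L
  assume x: "\<forall>n. x n \<in> {(u, v). direction_limit \<theta> \<theta>' u v}" and L: "x \<longlonglongrightarrow> L"
  obtain u v where uv: "L = (u, v)" by (cases L)
  have "direction_limit \<theta> \<theta>' u v" unfolding direction_limit_def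
  proof (intro allI impI)
    fix \<epsilon> :: real and M :: nat assume "\<epsilon> > 0"
    then obtain i where i: "dist (x i) L < \<epsilon>/2"
      using L[unfolded lim_sequentially, rule_format, of "\<epsilon>/2"] by auto
    have i': "dist (fst (x i)) u < \<epsilon>/2" "dist (snd (x i)) v < \<epsilon>/2"
      using i dist_fst_le[of "x i" L] dist_snd_le[of "x i" L] by (auto simp: uv)
    have "direction_limit \<theta> \<theta>' (fst (x i)) (snd (x i))" using x by (auto simp: case_prod_unfold)
    from this[unfolded direction_limit_def, rule_format, of "\<epsilon>/2" M] \<open>\<epsilon> > 0\<close>
    obtain n where n: "n \<ge> M" "dist (cis (real n * \<theta>)) (fst (x i)) < \<epsilon>/2"
       "dist (cis (real n * \<theta>')) (snd (x i)) < \<epsilon>/2" by auto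
    have "dist (cis (real n * \<theta>)) u < \<epsilon>" "dist (cis (real n * \<theta>')) v < \<epsilon>"
      using n i' dist_triangle[of "cis (real n * \<theta>)" u "fst (x i)"]
         dist_triangle[of "cis (real n * \<theta>')" v "snd (x i)"] by linarith+
    then show "\<exists>n\<ge>M. dist (cis (real n * \<theta>)) u < \<epsilon> \<and> dist (cis (real n * \<theta>')) v < \<epsilon>"
      using n(1) by blast
  qed
  then show "L \<in> {(u, v). direction_limit \<theta> \<theta>' u v}" by (simp add: uv)
qed

text \<open>Kronecker's theorem yields some positive time only; it is applied to the multiple \<open>Suc M * \<theta>\<close>,
so that every time it yields is at least \<open>M\<close>.\<close>

lemma irrational_rotation_dense:
  assumes irr: "\<theta> / (2 * pi) \<notin> \<rat>" and u: "cmod u = 1" and "\<epsilon> > 0"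
  obtains n where "n \<ge> M" "dist (cis (real n * \<theta>)) u < \<epsilon>"
proof -
  obtain t where t: "0 \<le> t" "t < 2 * pi" "u = cis t"
  proof -
    have "u = cis (Arg2pi u)" using Arg2pi_eq[of u] u by (simp add: cis_conv_exp)
    then show ?thesis using that Arg2pi_ge_0 Arg2pi_lt_2pi by blast
  qed
  have "isCont cis t"
    using continuous_on_cis[OF continuous_on_id[of UNIV]] by (simp add: continuous_on_eq_continuous_at)
  then obtain d where d: "d > 0" "\<And>s. dist s t < d \<Longrightarrow> dist (cis s) (cis t) < \<epsilon>"
    unfolding continuous_at_eps_delta using \<open>\<epsilon> > 0\<close> by blast
  define \<phi> where "\<phi> = real (Suc M) * (\<theta> / (2 * pi))"
  have "\<phi> \<notin> \<rat>"
  proof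
    assume "\<phi> \<in> \<rat>"
    then have "\<phi> / real (Suc M) \<in> \<rat>" by (intro Rats_divide) auto
    then show False using irr unfolding \<phi>_def by simp
  qed
  moreover have "0 \<le> t / (2*pi)" "t / (2*pi) \<le> 1" "d / (2*pi) > 0" using t d by auto
  ultimately obtain k where k: "k > 0" "\<bar>frac (real k * \<phi>) - t / (2*pi)\<bar> < d / (2*pi)"
    by (rule Kronecker_approx_1_explicit)
  define n where "n = k * Suc M"
  have n: "real k * \<phi> = real n * \<theta> / (2 * pi)" by (simp add: n_def \<phi>_def algebra_simps)
  define s where "s = 2 * pi * frac (real k * \<phi>)"
  have "cis (real n * \<theta>) = cis s"
  proof -
    have "s = 2 * pi * (real k * \<phi>) - 2 * pi * of_int \<lfloor>real k * \<phi>\<rfloor>"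
      unfolding s_def frac_def by (rule right_diff_distrib)
    moreover have "2 * pi * (real k * \<phi>) = real n * \<theta>" unfolding n by simp
    ultimately have "real n * \<theta> = s + 2 * pi * of_int \<lfloor>real k * \<phi>\<rfloor>" by linarith
    then have "cis (real n * \<theta>) = cis s * cis (2 * pi * of_int \<lfloor>real k * \<phi>\<rfloor>)" by (simp only: cis_mult)
    then show ?thesis by (simp add: cis_multiple_2pi)
  qed
  moreover have "\<bar>s - t\<bar> < d"
  proof -
    have "\<bar>s - t\<bar> = 2 * pi * \<bar>frac (real k * \<phi>) - t / (2*pi)\<bar>"
    proof -
      have "s - t = 2 * pi * (frac (real k * \<phi>) - t / (2*pi))" by (simp add: s_def algebra_simps)
      then show ?thesis by (simp only: abs_mult) simp
    qed
    then show ?thesis using k(2) by (simp add: field_simps)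
  qed
  moreover have "n \<ge> M" using k(1) by (cases k) (auto simp: n_def)
  ultimately show ?thesis using d(2)[of s] t(3) that by (auto simp: dist_real_def)
qed

text \<open>Density of the first rotation gives the times, and compactness of the circle gives a limit of the
second rotation along a subsequence.\<close>

lemma direction_limit_total:
  assumes irr: "\<theta> / (2 * pi) \<notin> \<rat>" and u: "cmod u = 1"
  obtains v where "direction_limit \<theta> \<theta>' u v"
proof -
  have "\<exists>n\<ge>j. dist (cis (real n * \<theta>)) u < inverse (real (Suc j))" for j
    by (rule irrational_rotation_dense[OF irr u, of "inverse (real (Suc j))" j]) auto
  then obtain N where N: "\<And>j. N j \<ge> j" "\<And>j. dist (cis (real (N j) * \<theta>)) u < inverse (real (Suc j))"
    by metis
  have "compact (sphere (0::complex) 1)" by simp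
  then have "seq_compact (sphere (0::complex) 1)" by (simp add: compact_eq_seq_compact_metric)
  moreover have "\<forall>j. cis (real (N j) * \<theta>') \<in> sphere 0 1" by auto
  ultimately obtain v g where v: "strict_mono g" "((\<lambda>j. cis (real (N j) * \<theta>')) \<circ> g) \<longlonglongrightarrow> v"
    unfolding seq_compact_def by metis
  have "direction_limit \<theta> \<theta>' u v" unfolding direction_limit_def
  proof (intro allI impI)
    fix \<epsilon> :: real and M :: nat assume "\<epsilon> > 0"
    obtain a where a: "\<And>j. j \<ge> a \<Longrightarrow> dist (cis (real (N (g j)) * \<theta>')) v < \<epsilon>"
      using v(2) \<open>\<epsilon> > 0\<close> unfolding lim_sequentially by auto
    obtain b where b: "inverse (real (Suc b)) < \<epsilon>" using reals_Archimedean \<open>\<epsilon> > 0\<close> by blast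
    define j where "j = max a (max b M)"
    have j: "g j \<ge> j" using v(1) by (simp add: seq_suble)
    have "inverse (real (Suc (g j))) \<le> inverse (real (Suc b))"
      using j by (intro le_imp_inverse_le) (auto simp: j_def)
    then have "dist (cis (real (N (g j)) * \<theta>)) u < \<epsilon>" using N(2)[of "g j"] b by linarith
    moreover have "N (g j) \<ge> M" using N(1)[of "g j"] j by (simp add: j_def)
    moreover have "dist (cis (real (N (g j)) * \<theta>')) v < \<epsilon>" using a[of j] by (simp add: j_def)
    ultimately show "\<exists>n\<ge>M. dist (cis (real n * \<theta>)) u < \<epsilon> \<and> dist (cis (real n * \<theta>')) v < \<epsilon>"
      by blast
  qed
  then show ?thesis by (rule that)
qed

text \<open>A strict inequality in the limiting direction holds with a margin at the approximating times,
where the hypothesis applies, and the weak conclusion survives the limit.\<close>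

lemma half_plane_limit:
  assumes ev: "\<And>\<delta>. \<delta> > 0 \<Longrightarrow> \<exists>M. \<forall>n\<ge>M. \<delta> < Re (cnj (cis (real n * \<theta>)) * x)
      \<longrightarrow> - \<delta> \<le> Re (cnj (cis (real n * \<theta>')) * y)"
    and uv: "direction_limit \<theta> \<theta>' u v" and pos: "Re (cnj u * x) > 0"
  shows "Re (cnj v * y) \<ge> 0"
proof (rule ccontr)
  assume neg: "\<not> ?thesis"
  define \<delta> where "\<delta> = min (Re (cnj u * x)) (- Re (cnj v * y)) / 3"
  have \<delta>: "\<delta> > 0" using pos neg by (auto simp: \<delta>_def)
  obtain M where M: "\<And>n. n \<ge> M \<Longrightarrow> \<delta> < Re (cnj (cis (real n * \<theta>)) * x)
      \<Longrightarrow> - \<delta> \<le> Re (cnj (cis (real n * \<theta>')) * y)" using ev[OF \<delta>] by blast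
  define \<epsilon> where "\<epsilon> = \<delta> / (1 + cmod x + cmod y)"
  have den: "1 + cmod x + cmod y > 0" using norm_ge_zero[of x] norm_ge_zero[of y] by linarith
  have "\<epsilon> > 0" using \<delta> den by (simp add: \<epsilon>_def)
  then obtain n where n: "n \<ge> M" "dist (cis (real n * \<theta>)) u < \<epsilon>" "dist (cis (real n * \<theta>')) v < \<epsilon>"
    using uv unfolding direction_limit_def by blast
  have *: "\<bar>Re (cnj c * z) - Re (cnj w * z)\<bar> \<le> \<delta>" if "dist c w < \<epsilon>" "cmod z \<le> 1 + cmod x + cmod y" for c w z
  proof -
    have "\<bar>Re (cnj c * z) - Re (cnj w * z)\<bar> = \<bar>Re (cnj (c - w) * z)\<bar>" by (simp add: algebra_simps)
    also have "\<dots> \<le> cmod (cnj (c - w) * z)" by (rule abs_Re_le_cmod)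
    also have "\<dots> = dist c w * cmod z" by (simp add: norm_mult dist_norm flip: complex_cnj_diff)
    also have "\<dots> \<le> \<epsilon> * (1 + cmod x + cmod y)" using that \<open>\<epsilon> > 0\<close> by (intro mult_mono) auto
    also have "\<dots> = \<delta>" using den by (simp add: \<epsilon>_def)
    finally show ?thesis .
  qed
  have \<delta>3: "3 * \<delta> \<le> Re (cnj u * x)" "3 * \<delta> \<le> - Re (cnj v * y)"
    by (auto simp: \<delta>_def min_def)
  have "Re (cnj (cis (real n * \<theta>)) * x) > \<delta>"
    using *[OF n(2), of x] \<delta> \<delta>3 norm_ge_zero[of x] norm_ge_zero[of y] by linarith
  then have "- \<delta> \<le> Re (cnj (cis (real n * \<theta>')) * y)" using M n(1) by blast
  then show False 
    using *[OF n(3), of y] \<delta> \<delta>3 norm_ge_zero[of x] norm_ge_zero[of y] by linarith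
qed


section \<open>Rigidity of the plane map\<close>

text \<open>For fixed \<open>n\<close> the terms with \<open>l ^ m\<close> and \<open>l' ^ m\<close> vanish as \<open>m\<close> grows, and an implication between
the two comparisons becomes one between comparisons with constants.\<close>

lemma drop_vanishing_terms:
  fixes a b :: "nat \<Rightarrow> real"
  assumes l: "0 < l" "l < 1" "0 < l'" "l' < 1" and \<delta>: "\<delta> > 0"
    and M: "\<And>n m. M \<le> n \<Longrightarrow> M \<le> m \<Longrightarrow> a n \<le> (1 - \<delta>) * (c n * l ^ m) - \<delta> \<Longrightarrow> b n \<le> (1 + \<delta>) * (c' n * l' ^ m) + \<delta>"
    and n: "M \<le> n" "a n < - \<delta>"
  shows "b n \<le> \<delta>"
proof -
  have 1: "(\<lambda>m. (1 - \<delta>) * (c n * l ^ m) - \<delta>) \<longlonglongrightarrow> (1 - \<delta>) * (c n * 0) - \<delta>"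
    by (intro tendsto_intros LIMSEQ_power_zero) (use l in auto)
  have 2: "(\<lambda>m. (1 + \<delta>) * (c' n * l' ^ m) + \<delta>) \<longlonglongrightarrow> (1 + \<delta>) * (c' n * 0) + \<delta>"
    by (intro tendsto_intros LIMSEQ_power_zero) (use l in auto)
  have "\<forall>\<^sub>F m in sequentially. a n < (1 - \<delta>) * (c n * l ^ m) - \<delta>"
    by (rule order_tendstoD(1)[OF 1]) (use n in simp)
  then have "\<forall>\<^sub>F m in sequentially. b n \<le> (1 + \<delta>) * (c' n * l' ^ m) + \<delta>"
    using eventually_ge_at_top[of M] by eventually_elim (use M n in simp)
  then show ?thesis
    using tendsto_lowerbound[OF 2] by simp
qed

text \<open>As \<open>m\<close> tends to infinity for fixed \<open>n\<close>, the excursion inequalities become statements about half-planes.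
The limits \<open>u\<close> and \<open>v\<close> of their normals then satisfy the same implication.\<close>

lemma half_plane_correspondence:
  assumes l: "0 < l" "l < 1" "0 < l'" "l' < 1"
    and ineq: "\<And>\<delta>. 0 < \<delta> \<Longrightarrow> \<exists>M. \<forall>n\<ge>M. \<forall>m\<ge>M.
      - Re (cnj (cis (real n * \<theta>)) * x) \<le> (1 - \<delta>) * (K * r ^ n * l ^ m) - \<delta> \<longrightarrow>
      - Re (cnj (cis (real n * \<theta>')) * y) \<le> (1 + \<delta>) * (K' * r' ^ n * l' ^ m) + \<delta>"
    and uv: "direction_limit \<theta> \<theta>' u v" and pos: "0 < Re (cnj u * x)"
  shows "0 \<le> Re (cnj v * y)"
proof (rule half_plane_limit[OF _ uv pos])
  fix \<delta> :: real assume \<delta>: "0 < \<delta>"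
  obtain M where M: "\<And>n m. M \<le> n \<Longrightarrow> M \<le> m \<Longrightarrow>
      - Re (cnj (cis (real n * \<theta>)) * x) \<le> (1 - \<delta>) * (K * r ^ n * l ^ m) - \<delta> \<Longrightarrow>
      - Re (cnj (cis (real n * \<theta>')) * y) \<le> (1 + \<delta>) * (K' * r' ^ n * l' ^ m) + \<delta>"
    using ineq[OF \<delta>] by blast
  show "\<exists>M. \<forall>n\<ge>M. \<delta> < Re (cnj (cis (real n * \<theta>)) * x) \<longrightarrow> - \<delta> \<le> Re (cnj (cis (real n * \<theta>')) * y)"
    using drop_vanishing_terms[OF l \<delta> M] by (intro exI[of _ M]) fastforce
qed

lemma Re_cnj_scale: "Re (cnj u * (of_real s * x)) = s * Re (cnj u * x)"
  by (simp add: algebra_simps)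

lemma Re_cnj_unit [simp]: "cmod u = 1 \<Longrightarrow> Re (cnj u * (of_real s * u)) = s"
  by (simp add: cmod_def algebra_simps) (metis distrib_left mult.right_neutral power2_eq_square real_sqrt_eq_1_iff)

text \<open>The vector \<open>v - w\<close> separates the half-planes with inner normals \<open>v\<close> and \<open>w\<close>.\<close>

lemma Re_cnj_self_diff:
  assumes "cmod v = 1" "cmod w = 1" "v \<noteq> w"
  shows "0 < Re (cnj v * (v - w))" "Re (cnj w * (v - w)) < 0"
proof -
  have "(cmod (v - w))\<^sup>2 = (cmod v)\<^sup>2 + (cmod w)\<^sup>2 - 2 * (Re v * Re w + Im v * Im w)"
    unfolding cmod_power2 by (simp add: algebra_simps power2_eq_square)
  moreover have "(cmod (v - w))\<^sup>2 > 0" using assms(3) by simp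
  ultimately have *: "Re v * Re w + Im v * Im w < 1" using assms by simp
  have "(Re v)\<^sup>2 + (Im v)\<^sup>2 = 1" "(Re w)\<^sup>2 + (Im w)\<^sup>2 = 1"
    using assms(1,2) cmod_power2[of v] cmod_power2[of w] by auto
  then show "0 < Re (cnj v * (v - w))" "Re (cnj w * (v - w)) < 0"
    using * by (auto simp: algebra_simps power2_eq_square)
qed

text \<open>Here \<open>\<eta>\<close> is the conjugacy on the unstable plane, in coordinates scaled so that the covectors
\<open>\<mu>\<close> and \<open>\<mu>'\<close> of the two excursion inequalities become \<open>1\<close>. The assumptions \<open>fwd\<close> and \<open>bwd\<close> say
that \<open>x\<close> and \<open>\<eta> x\<close> satisfy the same inequalities up to small errors.\<close>

locale plane_conjugacy =
  fixes \<eta> :: "complex \<Rightarrow> complex" and R R' \<theta> \<theta>' r r' l l' K K' :: real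
  assumes R: "0 < R" "0 < R'"
    and cont: "continuous_on (ball 0 R) \<eta>"
    and zero: "\<eta> 0 = 0" and nonzero: "\<And>x. x \<in> ball 0 R \<Longrightarrow> x \<noteq> 0 \<Longrightarrow> \<eta> x \<noteq> 0"
    and surj: "ball 0 R' \<subseteq> \<eta> ` ball 0 R"
    and irrational: "\<theta> / (2 * pi) \<notin> \<rat>"
    and params: "1 < r" "1 < r'" "0 < l" "l < 1" "0 < l'" "l' < 1" "0 < K" "0 < K'"
    and fwd: "\<And>x \<delta>. x \<in> ball 0 R \<Longrightarrow> 0 < \<delta> \<Longrightarrow> \<exists>M. \<forall>n\<ge>M. \<forall>m\<ge>M.
      - Re (cnj (cis (real n * \<theta>)) * x) \<le> (1 - \<delta>) * (K * r ^ n * l ^ m) - \<delta> \<longrightarrow>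
      - Re (cnj (cis (real n * \<theta>')) * \<eta> x) \<le> (1 + \<delta>) * (K' * r' ^ n * l' ^ m) + \<delta>"
    and bwd: "\<And>x \<delta>. x \<in> ball 0 R \<Longrightarrow> 0 < \<delta> \<Longrightarrow> \<exists>M. \<forall>n\<ge>M. \<forall>m\<ge>M.
      - Re (cnj (cis (real n * \<theta>')) * \<eta> x) \<le> (1 - \<delta>) * (K' * r' ^ n * l' ^ m) - \<delta> \<longrightarrow>
      - Re (cnj (cis (real n * \<theta>)) * x) \<le> (1 + \<delta>) * (K * r ^ n * l ^ m) + \<delta>"
begin

lemma half_plane_image:
  assumes x: "x \<in> ball 0 R" and uv: "direction_limit \<theta> \<theta>' u v" and "0 < Re (cnj u * x)"
  shows "0 \<le> Re (cnj v * \<eta> x)"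
  using half_plane_correspondence[OF params(3-6) fwd[OF x] uv assms(3)] .

lemma half_plane_preimage:
  assumes x: "x \<in> ball 0 R" and uv: "direction_limit \<theta> \<theta>' u v" and "0 < Re (cnj v * \<eta> x)"
  shows "0 \<le> Re (cnj u * x)"
  using half_plane_correspondence[OF params(5,6,3,4) bwd[OF x] direction_limit_swap[OF uv] assms(3)] .

text \<open>A boundary point of the half-plane is a limit of interior points \<open>x + u / (j + 1)\<close>.\<close>

lemma half_plane_image_closed:
  assumes x: "x \<in> ball 0 R" and uv: "direction_limit \<theta> \<theta>' u v" and ge: "0 \<le> Re (cnj u * x)"
  shows "0 \<le> Re (cnj v * \<eta> x)"
proof -
  have u: "cmod u = 1" using direction_limit_norm[OF uv] by simp
  define X where "X j = x + of_real (inverse (real (Suc j))) * u" for j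
  have X: "X \<longlonglongrightarrow> x + of_real 0 * u"
    unfolding X_def by (intro tendsto_intros LIMSEQ_inverse_real_of_nat)
  then have X': "X \<longlonglongrightarrow> x" by simp
  have inb: "\<forall>\<^sub>F j in sequentially. X j \<in> ball 0 R"
    by (rule topological_tendstoD[OF X']) (use x in auto)
  have "isCont \<eta> x" using cont x by (simp add: continuous_on_eq_continuous_at)
  then have "(\<lambda>j. \<eta> (X j)) \<longlonglongrightarrow> \<eta> x" using X' by (rule isCont_tendsto_compose)
  then have lim: "(\<lambda>j. Re (cnj v * \<eta> (X j))) \<longlonglongrightarrow> Re (cnj v * \<eta> x)" by (intro tendsto_intros)
  have "\<forall>\<^sub>F j in sequentially. 0 \<le> Re (cnj v * \<eta> (X j))"
    using inb
  proof eventually_elim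
    case (elim j)
    have "Re (cnj u * X j) = Re (cnj u * x) + inverse (real (Suc j))"
      unfolding X_def distrib_left plus_complex.sel using Re_cnj_unit[OF u] by presburger
    moreover have "inverse (real (Suc j)) > 0" by simp
    ultimately have "Re (cnj u * X j) > 0" using ge by linarith
    then show ?case using half_plane_image[OF elim uv] by simp
  qed
  then show ?thesis using tendsto_lowerbound[OF lim] by simp
qed

text \<open>If two half-planes corresponded to the same one, a point in the interior of the first and outside
the second would be the image of a point in the closed half-plane of \<open>u\<close>, which maps into the
second.\<close>

lemma direction_limit_functional:
  assumes v: "direction_limit \<theta> \<theta>' u v" and w: "direction_limit \<theta> \<theta>' u w"
  shows "v = w"
proof (rule ccontr)
  assume ne: "v \<noteq> w"
  define c where "c = R' / (2 * cmod (v - w))"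
  define y where "y = of_real c * (v - w)"
  have c: "0 < c" using R ne by (simp add: c_def)
  have "cmod y = R' / 2" unfolding y_def norm_mult norm_of_real using c R ne by (simp add: c_def)
  then have "y \<in> ball 0 R'" using R by simp
  then obtain x where x: "x \<in> ball 0 R" "\<eta> x = y" using surj by auto
  have "0 < Re (cnj v * \<eta> x)" "Re (cnj w * \<eta> x) < 0"
    unfolding x(2) y_def Re_cnj_scale
    using Re_cnj_self_diff[OF direction_limit_norm(2)[OF v] direction_limit_norm(2)[OF w] ne] c
    by (auto simp only: zero_less_mult_iff mult_less_0_iff)
  then show False
    using half_plane_image_closed[OF x(1) w half_plane_preimage[OF x(1) v]] by simp
qed

lemma direction_limit_step:
  assumes "direction_limit \<theta> \<theta>' u v"
  shows "direction_limit \<theta> \<theta>' (u * cis \<theta>) (v * cis \<theta>')"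
  unfolding direction_limit_def
proof (intro allI impI)
  fix \<epsilon> :: real and M :: nat assume "\<epsilon> > 0"
  then obtain n where n: "n \<ge> M" "dist (cis (real n * \<theta>)) u < \<epsilon>" "dist (cis (real n * \<theta>')) v < \<epsilon>"
    using assms[unfolded direction_limit_def, rule_format, of \<epsilon> M] by auto
  have *: "dist (cis (real (Suc n) * t)) (w * cis t) = dist (cis (real n * t)) w" for t w
  proof -
    have "cis (real (Suc n) * t) - w * cis t = (cis (real n * t) - w) * cis t"
      by (simp add: algebra_simps cis_mult)
    then show ?thesis by (simp add: dist_norm norm_mult)
  qed
  show "\<exists>n\<ge>M. dist (cis (real n * \<theta>)) (u * cis \<theta>) < \<epsilon> \<and> dist (cis (real n * \<theta>')) (v * cis \<theta>') < \<epsilon>"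
    using n by (intro exI[of _ "Suc n"]) (simp only: *, simp)
qed

text \<open>The correspondence \<open>u \<mapsto> v\<close> is a function with closed graph in a compact space, hence continuous,
and multiplicative because times add up. A continuous endomorphism of the circle is a power.\<close>

lemma direction_hom:
  obtains c :: int where "\<And>t. direction_limit \<theta> \<theta>' (cis t) (cis (of_int c * t))"
proof -
  define X where "X t = (SOME v. direction_limit \<theta> \<theta>' (cis t) v)" for t
  have X: "direction_limit \<theta> \<theta>' (cis t) (X t)" for t
    unfolding X_def by (rule someI_ex) (rule direction_limit_total[OF irrational, of "cis t"], auto)
  have Xeq: "v = X t" if "direction_limit \<theta> \<theta>' (cis t) v" for v t
    using direction_limit_functional[OF that X] .
  have graph: "continuous_on UNIV X"
  proof (rule continuous_from_closed_graph[where T = "sphere 0 1"])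
    show "compact (sphere (0::complex) 1)" by simp
    show "X \<in> UNIV \<rightarrow> sphere (0::complex) 1" using direction_limit_norm(2)[OF X] by auto
    have "((\<lambda>t. Pair t (X t)) ` UNIV) = (\<lambda>p. (cis (fst p), snd p)) -` {(u, v). direction_limit \<theta> \<theta>' u v}"
      using X Xeq by (auto simp: image_iff)
    moreover have "closed \<dots>"
      by (intro closed_vimage direction_limit_closed) (intro continuous_intros)
    ultimately show "closed ((\<lambda>t. Pair t (X t)) ` UNIV)" by simp
  qed
  obtain c where c: "\<And>t. X t = cis (c * t)"
  proof (rule continuous_circle_hom[OF graph])
    show "cmod (X t) = 1" for t using direction_limit_norm(2)[OF X] .
    show "X (s + t) = X s * X t" for s t
      using Xeq[of "s + t"] direction_limit_mult[OF X X, of s t] by (simp add: cis_mult)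
  qed blast
  have "X (2 * pi) = X 0" using X[of "2*pi"] Xeq[of 0 "X (2*pi)"] by simp
  then have "cis (c * (2 * pi)) = 1" by (simp add: c)
  then obtain m :: int where "c * (2 * pi) = of_int m * (2 * pi)"
    by (simp add: complex_eq_iff cos_one_2pi_int) (metis mult.assoc mult.commute)
  then have "c = of_int m" by simp
  then show ?thesis using X c that[of m] by simp
qed

text \<open>For any other exponent the kernel of the power map consists of roots of unity, or is the whole
circle, and the half-planes with normals in the kernel cover the plane. All of them map into the
half-plane with normal \<open>1\<close>, which contradicts surjectivity near \<open>0\<close>.\<close>

lemma direction_hom_sign:
  obtains c :: real where "c = 1 \<or> c = - 1" "\<And>t. direction_limit \<theta> \<theta>' (cis t) (cis (c * t))"
proof -
  obtain c :: int where c: "\<And>t. direction_limit \<theta> \<theta>' (cis t) (cis (of_int c * t))"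
    using direction_hom by blast
  have "\<exists>u. direction_limit \<theta> \<theta>' u 1 \<and> 0 \<le> Re (cnj u * x)" if bad: "c \<noteq> 1" "c \<noteq> -1" for x
  proof (cases "c = 0")
    case True
    then show ?thesis using c[of 0] c[of pi]
      by (cases "0 \<le> Re x") (force intro: exI[of _ "1::complex"], force intro: exI[of _ "- 1::complex"])
  next
    case False
    define d where "d = nat \<bar>c\<bar>"
    have d: "d \<ge> 2" using bad False by (simp add: d_def)
    define \<zeta> where "\<zeta> = cis (2 * pi / real d)"
    have \<zeta>: "direction_limit \<theta> \<theta>' (\<zeta> ^ j) 1" for j
    proof -
      have "of_int c * (real j * (2 * pi / real d)) = (of_int (sgn c * int j)) * (2 * pi)"
        using False by (simp add: d_def abs_if sgn_if)
      then have "cis (of_int c * (real j * (2 * pi / real d))) = 1"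
        by (simp only: mult.commute[of _ "2*pi"]) (rule cis_multiple_2pi, simp)
      moreover have "\<zeta> ^ j = cis (real j * (2 * pi / real d))" unfolding \<zeta>_def by (rule Complex.DeMoivre)
      ultimately show ?thesis using c[of "real j * (2 * pi / real d)"] by simp
    qed
    have "\<zeta> \<noteq> 1"
    proof
      assume "\<zeta> = 1"
      then have "cos (2 * pi / real d) = 1" by (simp add: \<zeta>_def complex_eq_iff)
      moreover have "cos (2 * pi / real d) < cos 0" using d
        by (intro cos_monotone_0_pi) (auto simp: field_simps)
      ultimately show False by simp
    qed
    moreover have "\<zeta> ^ d = 1" using d by (simp add: \<zeta>_def Complex.DeMoivre)
    ultimately have "(\<Sum>j<d. \<zeta> ^ j) = 0" by (simp add: geometric_sum)
    then have "(\<Sum>j<d. Re (cnj (\<zeta> ^ j) * x)) = 0"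
      by (simp only: Re_sum[symmetric] sum_distrib_right[symmetric] cnj_sum[symmetric]) simp
    then have "\<exists>j<d. 0 \<le> Re (cnj (\<zeta> ^ j) * x)"
      using sum_strict_mono[of "{..<d}" "\<lambda>j. Re (cnj (\<zeta> ^ j) * x)" "\<lambda>_. 0"] d
      by (auto simp: not_le lessThan_empty_iff)  (metis lessThan_empty_iff lessThan_iff less_irrefl not_le not_numeral_le_zero)
    then show ?thesis using \<zeta> by blast
  qed
  moreover have "\<exists>x. \<forall>u. direction_limit \<theta> \<theta>' u 1 \<longrightarrow> Re (cnj u * x) < 0"
  proof -
    have "- of_real (R'/2) \<in> ball (0::complex) R'" using R by simp
    then obtain x where x: "x \<in> ball 0 R" "\<eta> x = - of_real (R'/2)" using surj by (metis imageE subsetD)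
    show ?thesis
      using half_plane_image_closed[OF x(1), of _ 1] x(2) R by (intro exI[of _ x]) fastforce
  qed
  ultimately have "c = 1 \<or> c = -1" by (meson not_le)
  then show ?thesis using c that[of "of_int c"] by auto
qed


text \<open>A ray is determined by its inner half-plane together with the two half-planes bounded by it, and
all three are mapped to the corresponding half-planes in the direction \<open>c * t\<close>.\<close>

lemma rays_preserved:
  obtains c :: real where "c = 1 \<or> c = - 1" "cis \<theta>' = cis (c * \<theta>)"
    "\<And>s t. 0 < s \<Longrightarrow> s < R \<Longrightarrow> \<eta> (of_real s * cis t) = of_real (cmod (\<eta> (of_real s * cis t))) * cis (c * t)"
proof -
  obtain c :: real where c: "c = 1 \<or> c = - 1" "\<And>t. direction_limit \<theta> \<theta>' (cis t) (cis (c * t))"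
    using direction_hom_sign by blast
  have "direction_limit \<theta> \<theta>' (cis \<theta>) (cis \<theta>')" using direction_limit_step[OF c(2)[of 0]] by simp
  then have "cis \<theta>' = cis (c * \<theta>)" using direction_limit_functional c(2) by blast
  moreover have "\<eta> (of_real s * cis t) = of_real (cmod (\<eta> (of_real s * cis t))) * cis (c * t)" if s: "0 < s" "s < R" for s t
  proof -
    \<comment> \<open>the image is rotated back to the positive real axis: \<open>w\<close> should be \<open>cmod (\<eta> x)\<close>\<close>
    define x where "x = of_real s * cis t"
    define w where "w = cnj (cis (c * t)) * \<eta> x"
    have xb: "x \<in> ball 0 R" using s by (simp add: x_def norm_mult)
    have Rex: "Re (cnj (cis a) * x) = s * cos (t - a)" for a
      by (simp add: x_def cos_diff algebra_simps)
    have w: "Re (cnj (cis (c * (t + a))) * \<eta> x) = Re (cnj (cis (c * a)) * w)" for a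
    proof -
      have "cis (c * (t + a)) = cis (c * t) * cis (c * a)" by (simp only: cis_mult distrib_left)
      then show ?thesis by (simp only: w_def complex_cnj_mult ac_simps)
    qed
    have ge: "0 \<le> Re (cnj (cis (c * a)) * w)" if "cos a \<ge> 0" for a
    proof -
      have "0 \<le> Re (cnj (cis (t + a)) * x)" unfolding Rex using s that by simp
      from half_plane_image_closed[OF xb c(2) this] show ?thesis unfolding w .
    qed
    have "0 \<le> Re w" using ge[of 0] by simp
    moreover have "Im w = 0" using ge[of "pi/2"] ge[of "-(pi/2)"] c(1) by auto
    ultimately have "w = of_real (cmod w)" by (simp add: complex_eq_iff cmod_def)
    moreover have "cmod w = cmod (\<eta> x)" by (simp add: w_def norm_mult)
    moreover have "\<eta> x = cis (c * t) * w" by (simp add: w_def cis_cnj cis_mult flip: mult.assoc)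
    ultimately show ?thesis unfolding x_def[symmetric] by (simp add: mult.commute)
  qed
  ultimately show ?thesis using c(1) that by blast
qed

definition ratio :: "complex \<Rightarrow> real" where "ratio x = cmod (\<eta> x) / cmod x"

lemma ratio_pos: "x \<in> ball 0 R \<Longrightarrow> x \<noteq> 0 \<Longrightarrow> 0 < ratio x"
  using nonzero by (simp add: ratio_def)

lemma ratio_isCont: "x \<in> ball 0 R \<Longrightarrow> x \<noteq> 0 \<Longrightarrow> isCont ratio x"
  unfolding ratio_def using cont by (intro continuous_intros) (auto simp: continuous_on_eq_continuous_at)

text \<open>Once rays go to rays, the two sides of the excursion inequalities for \<open>x\<close> and \<open>\<eta> x\<close> differ by the
positive factor \<open>ratio x\<close> only, in the conjugate case as well since the cosine is even.\<close>

lemma Re_image: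
  assumes x: "x \<in> ball 0 R" "x \<noteq> 0"
  shows "Re (cnj (cis (real n * \<theta>')) * \<eta> x) = ratio x * Re (cnj (cis (real n * \<theta>)) * x)"
proof -
  obtain c :: real where c: "c = 1 \<or> c = - 1" "cis \<theta>' = cis (c * \<theta>)"
    "\<And>s t. 0 < s \<Longrightarrow> s < R \<Longrightarrow> \<eta> (of_real s * cis t) = of_real (cmod (\<eta> (of_real s * cis t))) * cis (c * t)"
    using rays_preserved by blast
  define s t where "s = cmod x" and "t = Arg x"
  have xst: "x = of_real s * cis t" by (simp add: s_def t_def rcis_cmod_Arg[unfolded rcis_def])
  have s: "0 < s" "s < R" using x by (auto simp: s_def)
  have \<eta>: "\<eta> x = of_real (cmod (\<eta> x)) * cis (c * t)" using c(3)[OF s, of t] by (simp add: xst[symmetric])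
  have "cis (real n * \<theta>') = cis (c * (real n * \<theta>))"
  proof -
    have "cis (real n * \<theta>') = cis (c * \<theta>) ^ n" by (simp only: Complex.DeMoivre[symmetric] c(2))
    also have "\<dots> = cis (real n * (c * \<theta>))" by (rule Complex.DeMoivre)
    finally show ?thesis by (simp only: ac_simps)
  qed
  then have "Re (cnj (cis (real n * \<theta>')) * \<eta> x) = cmod (\<eta> x) * cos (c * t - c * (real n * \<theta>))"
    by (subst \<eta>) (simp add: cos_diff algebra_simps)
  also have "cos (c * t - c * (real n * \<theta>)) = cos (t - real n * \<theta>)"
    using c(1) by (auto simp: cos_diff)
  also have "Re (cnj (cis (real n * \<theta>)) * x) = s * cos (t - real n * \<theta>)"
    by (simp add: xst cos_diff algebra_simps)
  then have "cmod (\<eta> x) * cos (t - real n * \<theta>) = ratio x * Re (cnj (cis (real n * \<theta>)) * x)"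
    using s by (simp add: ratio_def s_def)
  finally show ?thesis .
qed

text \<open>For any large \<open>n\<close> one can choose \<open>m\<close> such that \<open>K r^n l^m\<close> lies in the interval \<open>[l e, e]\<close>, because
consecutive values differ by the factor \<open>l\<close>. As \<open>n\<close> grows, so does this \<open>m\<close>.\<close>

lemma bounded_offsets:
  assumes u: "cmod u = 1" and "0 < e" "0 < d"
  shows "\<exists>n\<ge>i. \<exists>m\<ge>i. dist (cis (real n * \<theta>)) u < d \<and> l * e \<le> K * r ^ n * l ^ m \<and> K * r ^ n * l ^ m \<le> e"
proof -
  obtain n0 where n0: "e / (K * l ^ i) < r ^ n0" using real_arch_pow params(1) by blast
  obtain n where n: "n \<ge> max i n0" "dist (cis (real n * \<theta>)) u < d"
    using irrational_rotation_dense[OF irrational u \<open>0 < d\<close>] by blast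
  have "r ^ n0 \<le> r ^ n" using params(1) n by (intro power_increasing) auto
  then have "K * l ^ i * r ^ n0 \<le> K * l ^ i * r ^ n" using params by (intro mult_left_mono) auto
  moreover have "e < K * l ^ i * r ^ n0" using n0 params by (simp add: field_simps)
  ultimately have big: "e < K * r ^ n * l ^ i" by (simp add: ac_simps)
  define m where "m = (LEAST m. K * r ^ n * l ^ m \<le> e)"
  have "(\<lambda>m. K * r ^ n * l ^ m) \<longlonglongrightarrow> K * r ^ n * 0"
    by (intro tendsto_intros LIMSEQ_power_zero) (use params in auto)
  then have "\<forall>\<^sub>F m in sequentially. K * r ^ n * l ^ m < e" by (rule order_tendstoD) (use \<open>0 < e\<close> in simp)
  from eventually_happens'[OF sequentially_bot this] obtain m1 where "K * r ^ n * l ^ m1 < e" by blast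
  then have "K * r ^ n * l ^ m1 \<le> e" by simp
  then have m: "K * r ^ n * l ^ m \<le> e" unfolding m_def by (rule LeastI)
  have "m > i"
  proof (rule ccontr)
    assume "\<not> m > i"
    then have "l ^ i \<le> l ^ m" using params by (intro power_decreasing) auto
    then have "K * r ^ n * l ^ i \<le> K * r ^ n * l ^ m" using params by (intro mult_left_mono) auto
    then show False using m big by simp
  qed
  then obtain m' where m': "m = Suc m'" by (cases m) auto
  have "\<not> K * r ^ n * l ^ m' \<le> e" using not_less_Least[of m' "\<lambda>m. K * r ^ n * l ^ m \<le> e"] m' by (simp add: m_def)
  then have "l * e \<le> l * (K * r ^ n * l ^ m')" using params by (intro mult_left_mono) auto
  then have "l * e \<le> K * r ^ n * l ^ m" by (simp add: m' ac_simps)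
  then show ?thesis using n m \<open>m > i\<close> by (intro exI[of _ n] exI[of _ m] conjI) auto
qed

text \<open>Along suitable \<open>(n, m)\<close> the excursion inequality for \<open>x\<close> becomes \<open>- Re (cnj u * x) \<le> \<kappa>\<close>, with some
\<open>\<kappa>\<close> in \<open>(0, \<epsilon>)\<close>. If \<open>x\<close> and \<open>y\<close> are on the boundary of this half-plane, then \<open>s x\<close> is strictly inside and
\<open>y / s\<close> is strictly outside for \<open>s < 1\<close>. Hence the image of \<open>s x\<close> is at most as far out as the image of
\<open>y / s\<close>, whatever the thresholds \<open>K' r'^n l'^m\<close> are, and \<open>s \<rightarrow> 1\<close> gives \<open>ratio x \<le> ratio y\<close>.\<close>

lemma ratio_const_on_line:
  assumes u: "cmod u = 1" and \<epsilon>: "0 < \<epsilon>"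
  obtains \<kappa> where "0 < \<kappa>" "\<kappa> < \<epsilon>"
    "\<And>x y. x \<in> ball 0 R \<Longrightarrow> y \<in> ball 0 R \<Longrightarrow> - Re (cnj u * x) = \<kappa> \<Longrightarrow> - Re (cnj u * y) = \<kappa> \<Longrightarrow> ratio x = ratio y"
proof -
  define e where "e = \<epsilon> / 2"
  have e: "0 < e" "e < \<epsilon>" using \<epsilon> by (auto simp: e_def)
  have "\<forall>i. \<exists>n m. n \<ge> i \<and> m \<ge> i \<and> dist (cis (real n * \<theta>)) u < inverse (real (Suc i)) \<and> 
      l * e \<le> K * r ^ n * l ^ m \<and> K * r ^ n * l ^ m \<le> e"
  proof
    fix i show "\<exists>n m. n \<ge> i \<and> m \<ge> i \<and> dist (cis (real n * \<theta>)) u < inverse (real (Suc i)) \<and> 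
      l * e \<le> K * r ^ n * l ^ m \<and> K * r ^ n * l ^ m \<le> e"
      using bounded_offsets[OF u e(1), of "inverse (real (Suc i))" i] by auto
  qed
  then obtain N m where Nm: "\<And>i. N i \<ge> i" "\<And>i. m i \<ge> i" "\<And>i. dist (cis (real (N i) * \<theta>)) u < inverse (real (Suc i))"
      "\<And>i. l * e \<le> K * r ^ N i * l ^ m i" "\<And>i. K * r ^ N i * l ^ m i \<le> e"
    by metis
  have sc: "seq_compact {l * e..e}" by (simp add: compact_imp_seq_compact)
  have "\<forall>i. K * r ^ N i * l ^ m i \<in> {l * e..e}" using Nm(4,5) by simp
  with sc obtain \<kappa> g where \<kappa>: "\<kappa> \<in> {l * e..e}" "strict_mono g" "((\<lambda>i. K * r ^ N i * l ^ m i) \<circ> g) \<longlonglongrightarrow> \<kappa>"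
    by (rule seq_compactE)
  have \<kappa>lim: "(\<lambda>i. K * r ^ N (g i) * l ^ m (g i)) \<longlonglongrightarrow> \<kappa>" using \<kappa>(3) by (simp add: o_def)
  have "0 < l * e" using params e by simp
  then have \<kappa>pos: "0 < \<kappa>" "\<kappa> < \<epsilon>" using \<kappa>(1) e unfolding atLeastAtMost_iff by linarith+
  have ulim: "(\<lambda>i. cis (real (N (g i)) * \<theta>)) \<longlonglongrightarrow> u"
  proof (rule tendsto_dist_iff[THEN iffD2], rule tendsto_sandwich[OF _ _ tendsto_const])
    show "(\<lambda>i. inverse (real (Suc i))) \<longlonglongrightarrow> 0" by (rule LIMSEQ_inverse_real_of_nat)
    show "\<forall>\<^sub>F i in sequentially. dist (cis (real (N (g i)) * \<theta>)) u \<le> inverse (real (Suc i))"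
    proof (intro always_eventually allI)
      fix i
      have "inverse (real (Suc (g i))) \<le> inverse (real (Suc i))"
        using seq_suble[OF \<kappa>(2), of i] by (intro le_imp_inverse_le) auto
      then show "dist (cis (real (N (g i)) * \<theta>)) u \<le> inverse (real (Suc i))"
        using Nm(3)[of "g i"] by linarith
    qed
  qed auto
  have large: "N (g i) \<ge> i" "m (g i) \<ge> i" for i
    using Nm(1,2)[of "g i"] seq_suble[OF \<kappa>(2), of i] by linarith+
  have le: "ratio x \<le> ratio y" if x: "x \<in> ball 0 R" and y: "y \<in> ball 0 R"
    and xk: "- Re (cnj u * x) = \<kappa>" and yk: "- Re (cnj u * y) = \<kappa>" for x y
  proof (rule ccontr)
    assume "\<not> ratio x \<le> ratio y"
    have nz: "x \<noteq> 0" "y \<noteq> 0" using xk yk \<kappa>pos by auto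
    define F where "F s = ratio (of_real s * x) * s - ratio (y / of_real s) / s" for s :: real
    have "isCont (\<lambda>s::real. of_real s * x) 1" "isCont (\<lambda>s::real. y / of_real s) 1"
      by (intro continuous_intros; simp)+
    moreover have "isCont ratio (of_real 1 * x)" "isCont ratio (y / of_real 1)"
      using ratio_isCont[OF x nz(1)] ratio_isCont[OF y nz(2)] by simp_all
    ultimately have "isCont (\<lambda>s::real. ratio (of_real s * x)) 1" "isCont (\<lambda>s::real. ratio (y / of_real s)) 1"
      using isCont_o2[of 1 "\<lambda>s::real. of_real s * x" ratio] isCont_o2[of 1 "\<lambda>s::real. y / of_real s" ratio]
      by blast+
    then have "isCont F 1" unfolding F_def by (intro continuous_intros; simp)
    then have "(F \<longlongrightarrow> F 1) (at_left 1)" by (simp add: isCont_def filterlim_at_split)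
    moreover have "0 < F 1" using \<open>\<not> ratio x \<le> ratio y\<close> by (simp add: F_def)
    ultimately have 1: "\<forall>\<^sub>F s in at_left 1. 0 < F s" by (rule order_tendstoD)
    have "((\<lambda>s::real. y / of_real s) \<longlongrightarrow> y / of_real 1) (at_left 1)" by (intro tendsto_intros) auto
    then have 2: "\<forall>\<^sub>F s in at_left 1. y / of_real s \<in> ball 0 R"
      by (rule topological_tendstoD) (use y in auto)
    have 3: "\<forall>\<^sub>F s in at_left 1. s \<in> {0<..<1::real}" by (rule eventually_at_left_real) simp
    have "\<exists>s. 0 < F s \<and> y / of_real s \<in> ball 0 R \<and> s \<in> {0<..<1}"
      by (rule eventually_happens'[OF trivial_limit_at_left_real eventually_conj[OF 1 eventually_conj[OF 2 3]]])
    then obtain s where s: "0 < F s" "y / of_real s \<in> ball 0 R" "0 < s" "s < 1" by auto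
    define x1 y1 where "x1 = of_real s * x" and "y1 = y / of_real s"
    have x1: "x1 \<in> ball 0 R" "x1 \<noteq> 0"
    proof -
      have "s * cmod x \<le> cmod x" using s by (simp add: mult_left_le_one_le)
      then have "s * cmod x < R" using x by simp
      then show "x1 \<in> ball 0 R" "x1 \<noteq> 0" using nz s by (auto simp: x1_def norm_mult)
    qed
    have y1: "y1 \<in> ball 0 R" "y1 \<noteq> 0" using s nz by (auto simp: y1_def)
    define P Q where "P = ratio x1 * (s * \<kappa>)" and "Q = ratio y1 * (\<kappa> / s)"
    have "P - Q = \<kappa> * F s" by (simp add: P_def Q_def F_def x1_def y1_def algebra_simps)
    moreover have "0 < \<kappa> * F s" using s(1) \<kappa>pos(1) by (rule mult_pos_pos[rotated])
    ultimately have PQ: "Q < P" by linarith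
    have a: "(\<lambda>i. - Re (cnj (cis (real (N (g i)) * \<theta>)) * x1)) \<longlonglongrightarrow> s * \<kappa>"
    proof -
      have "(\<lambda>i. - Re (cnj (cis (real (N (g i)) * \<theta>)) * x1)) \<longlonglongrightarrow> - Re (cnj u * x1)"
        by (intro tendsto_intros ulim)
      also have "- Re (cnj u * x1) = s * - Re (cnj u * x)" unfolding x1_def Re_cnj_scale by (rule minus_mult_right)
      finally show ?thesis by (simp only: xk)
    qed
    have b: "(\<lambda>i. - Re (cnj (cis (real (N (g i)) * \<theta>)) * y1)) \<longlonglongrightarrow> \<kappa> / s"
    proof -
      have "(\<lambda>i. - Re (cnj (cis (real (N (g i)) * \<theta>)) * y1)) \<longlonglongrightarrow> - Re (cnj u * y1)"
        by (intro tendsto_intros ulim)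
      also have "- Re (cnj u * y1) = - Re (cnj u * y) / s"
        by (simp only: y1_def times_divide_eq_right Re_divide_of_real minus_divide_left)
      finally show ?thesis by (simp only: yk)
    qed
    \<comment> \<open>The error \<open>d\<close> is chosen such that the comparisons of \<open>x1\<close> and \<open>y1\<close> with \<open>\<kappa>\<close> and the comparison
      of their images, after elimination of the thresholds \<open>k' i\<close>, all hold with a margin.\<close>
    have "((\<lambda>d. (1 - d) * P - ((1 + d) * (Q + d) + d * (1 - d))) \<longlongrightarrow> (1 - 0) * P - ((1 + 0) * (Q + 0) + 0 * (1 - 0))) (at_right 0)"
      by (intro tendsto_intros)
    then have d1: "\<forall>\<^sub>F d in at_right 0. 0 < (1 - d) * P - ((1 + d) * (Q + d) + d * (1 - d))"
      by (rule order_tendstoD) (use PQ in simp)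
    have "((\<lambda>d. ((1 - d) * \<kappa> - d) - s * \<kappa>) \<longlongrightarrow> ((1 - 0) * \<kappa> - 0) - s * \<kappa>) (at_right 0)"
      by (intro tendsto_intros)
    then have d2: "\<forall>\<^sub>F d in at_right 0. 0 < ((1 - d) * \<kappa> - d) - s * \<kappa>"
      by (rule order_tendstoD) (use s \<kappa>pos in simp)
    have "((\<lambda>d. \<kappa> / s - ((1 + d) * \<kappa> + d)) \<longlongrightarrow> \<kappa> / s - ((1 + 0) * \<kappa> + 0)) (at_right 0)"
      by (intro tendsto_intros)
    then have d3: "\<forall>\<^sub>F d in at_right 0. 0 < \<kappa> / s - ((1 + d) * \<kappa> + d)"
      by (rule order_tendstoD) (use s \<kappa>pos in \<open>simp add: field_simps\<close>)
    have d4: "\<forall>\<^sub>F d in at_right 0. d \<in> {0<..<1::real}" by (rule eventually_at_right_real) simp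
    have "\<exists>d. 0 < (1 - d) * P - ((1 + d) * (Q + d) + d * (1 - d)) \<and> 0 < ((1 - d) * \<kappa> - d) - s * \<kappa> \<and>
        0 < \<kappa> / s - ((1 + d) * \<kappa> + d) \<and> d \<in> {0<..<1}"
      by (rule eventually_happens'[OF trivial_limit_at_right_real
          eventually_conj[OF d1 eventually_conj[OF d2 eventually_conj[OF d3 d4]]]])
    then obtain d where d: "0 < (1 - d) * P - ((1 + d) * (Q + d) + d * (1 - d))" 
        "0 < ((1 - d) * \<kappa> - d) - s * \<kappa>" "0 < \<kappa> / s - ((1 + d) * \<kappa> + d)" "0 < d" "d < 1"
      by auto
    define A where "A i = - Re (cnj (cis (real (N (g i)) * \<theta>)) * x1)" for i
    define B where "B i = - Re (cnj (cis (real (N (g i)) * \<theta>)) * y1)" for i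
    define k where "k i = K * r ^ N (g i) * l ^ m (g i)" for i
    define k' where "k' i = K' * r' ^ N (g i) * l' ^ m (g i)" for i
    have lims: "A \<longlonglongrightarrow> s * \<kappa>" "B \<longlonglongrightarrow> \<kappa> / s" "k \<longlonglongrightarrow> \<kappa>"
      unfolding A_def[abs_def] B_def[abs_def] k_def[abs_def] using a b \<kappa>lim .
    obtain M1 where M1: "\<And>n m. M1 \<le> n \<Longrightarrow> M1 \<le> m \<Longrightarrow> 
       - Re (cnj (cis (real n * \<theta>)) * x1) \<le> (1 - d) * (K * r ^ n * l ^ m) - d \<Longrightarrow>
       - Re (cnj (cis (real n * \<theta>')) * \<eta> x1) \<le> (1 + d) * (K' * r' ^ n * l' ^ m) + d"
      using fwd[OF x1(1) d(4)] by blast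
    obtain M2 where M2: "\<And>n m. M2 \<le> n \<Longrightarrow> M2 \<le> m \<Longrightarrow> 
       - Re (cnj (cis (real n * \<theta>')) * \<eta> y1) \<le> (1 - d) * (K' * r' ^ n * l' ^ m) - d \<Longrightarrow>
       - Re (cnj (cis (real n * \<theta>)) * y1) \<le> (1 + d) * (K * r ^ n * l ^ m) + d"
      using bwd[OF y1(1) d(4)] by blast
    have imgA: "- Re (cnj (cis (real n * \<theta>')) * \<eta> x1) = ratio x1 * - Re (cnj (cis (real n * \<theta>)) * x1)" for n
      unfolding Re_image[OF x1] by (rule minus_mult_right)
    have imgB: "- Re (cnj (cis (real n * \<theta>')) * \<eta> y1) = ratio y1 * - Re (cnj (cis (real n * \<theta>)) * y1)" for n
      unfolding Re_image[OF y1] by (rule minus_mult_right)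
    have "(\<lambda>i. (1 - d) * k i - d - A i) \<longlonglongrightarrow> (1 - d) * \<kappa> - d - s * \<kappa>" by (intro tendsto_intros lims)
    then have e1: "\<forall>\<^sub>F i in sequentially. 0 < (1 - d) * k i - d - A i" by (rule order_tendstoD) (use d in simp)
    have "(\<lambda>i. B i - ((1 + d) * k i + d)) \<longlonglongrightarrow> \<kappa> / s - ((1 + d) * \<kappa> + d)" by (intro tendsto_intros lims)
    then have e2: "\<forall>\<^sub>F i in sequentially. 0 < B i - ((1 + d) * k i + d)" by (rule order_tendstoD) (use d in simp)
    have "(\<lambda>i. (1 - d) * (ratio x1 * A i) - ((1 + d) * (ratio y1 * B i + d) + d * (1 - d)))
        \<longlonglongrightarrow> (1 - d) * (ratio x1 * (s * \<kappa>)) - ((1 + d) * (ratio y1 * (\<kappa> / s) + d) + d * (1 - d))"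
      by (intro tendsto_intros lims)
    then have e3: "\<forall>\<^sub>F i in sequentially. 0 < (1 - d) * (ratio x1 * A i) - ((1 + d) * (ratio y1 * B i + d) + d * (1 - d))"
      by (rule order_tendstoD) (use d in \<open>simp add: P_def Q_def\<close>)
    have e4: "\<forall>\<^sub>F i in sequentially. i \<ge> max M1 M2" by (rule eventually_ge_at_top)
    have "\<forall>\<^sub>F i in sequentially. False"
      using e1 e2 e3 e4
    proof eventually_elim
      case (elim i)
      have i: "M1 \<le> N (g i)" "M1 \<le> m (g i)" "M2 \<le> N (g i)" "M2 \<le> m (g i)"
        using elim(4) large[of i] by auto
      have 1: "ratio x1 * A i \<le> (1 + d) * k' i + d"
        using M1[OF i(1,2)] elim(1) unfolding imgA A_def[symmetric] k_def[symmetric] k'_def[symmetric] by simp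
      have 2: "(1 - d) * k' i - d < ratio y1 * B i"
        using M2[OF i(3,4)] elim(2) unfolding imgB B_def[symmetric] k_def[symmetric] k'_def[symmetric] by linarith
      have "(1 - d) * (ratio x1 * A i) \<le> (1 - d) * ((1 + d) * k' i + d)"
        using 1 d by (intro mult_left_mono) auto
      also have "\<dots> = (1 + d) * ((1 - d) * k' i) + d * (1 - d)" by (simp add: algebra_simps)
      also have "\<dots> \<le> (1 + d) * (ratio y1 * B i + d) + d * (1 - d)"
        using 2 d by (intro add_right_mono mult_left_mono) auto
      finally show False using elim(3) by linarith
    qed
    then show False by simp
  qed
  show ?thesis by (rule that[OF \<kappa>pos]) (use le in \<open>blast intro: antisym\<close>)
qed

text \<open>The line through \<open>0\<close> orthogonal to \<open>u\<close> is a limit of the parallel lines on which the ratio is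
constant.\<close>

lemma ratio_const_through_origin:
  assumes u: "cmod u = 1" and x: "x \<in> ball 0 R" "x \<noteq> 0" "Re (cnj u * x) = 0"
    and y: "y \<in> ball 0 R" "y \<noteq> 0" "Re (cnj u * y) = 0"
  shows "ratio x = ratio y"
proof -
  have "\<forall>j. \<exists>\<kappa>. 0 < \<kappa> \<and> \<kappa> < inverse (real (Suc j)) \<and> (\<forall>x y. x \<in> ball 0 R \<longrightarrow> y \<in> ball 0 R \<longrightarrow>
      - Re (cnj u * x) = \<kappa> \<longrightarrow> - Re (cnj u * y) = \<kappa> \<longrightarrow> ratio x = ratio y)"
  proof
    fix j :: nat
    have "0 < inverse (real (Suc j))" by simp
    from ratio_const_on_line[OF u this] show "\<exists>\<kappa>. 0 < \<kappa> \<and> \<kappa> < inverse (real (Suc j)) \<and> (\<forall>x y. x \<in> ball 0 R \<longrightarrow> y \<in> ball 0 R \<longrightarrow>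
      - Re (cnj u * x) = \<kappa> \<longrightarrow> - Re (cnj u * y) = \<kappa> \<longrightarrow> ratio x = ratio y)" by metis
  qed
  then obtain \<kappa> where \<kappa>: "\<And>j. 0 < \<kappa> j" "\<And>j. \<kappa> j < inverse (real (Suc j))"
    "\<And>j x y. x \<in> ball 0 R \<Longrightarrow> y \<in> ball 0 R \<Longrightarrow>
      - Re (cnj u * x) = \<kappa> j \<Longrightarrow> - Re (cnj u * y) = \<kappa> j \<Longrightarrow> ratio x = ratio y" by metis
  have "\<kappa> \<longlonglongrightarrow> 0"
    by (rule tendsto_sandwich[OF _ _ tendsto_const LIMSEQ_inverse_real_of_nat])
       (use \<kappa>(1,2) in \<open>auto intro!: always_eventually less_imp_le\<close>)
  then have lim: "(\<lambda>j. w - of_real (\<kappa> j) * u) \<longlonglongrightarrow> w - of_real 0 * u" for w by (intro tendsto_intros)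
  then have lim: "(\<lambda>j. w - of_real (\<kappa> j) * u) \<longlonglongrightarrow> w" for w by simp
  have rlim: "(\<lambda>j. ratio (w - of_real (\<kappa> j) * u)) \<longlonglongrightarrow> ratio w" if "w \<in> ball 0 R" "w \<noteq> 0" for w
    by (rule isCont_tendsto_compose[OF ratio_isCont lim]) (use that in auto)
  have ev: "\<forall>\<^sub>F j in sequentially. w - of_real (\<kappa> j) * u \<in> ball 0 R" if "w \<in> ball 0 R" for w
    by (rule topological_tendstoD[OF lim]) (use that in auto)
  have off: "- Re (cnj u * (w - of_real (\<kappa> j) * u)) = \<kappa> j" if "Re (cnj u * w) = 0" for w j
    using Re_cnj_unit[OF u, of "\<kappa> j"] that by (simp only: right_diff_distrib minus_complex.sel) 
  have "\<forall>\<^sub>F j in sequentially. ratio (x - of_real (\<kappa> j) * u) = ratio (y - of_real (\<kappa> j) * u)"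
    using ev[OF x(1)] ev[OF y(1)] by eventually_elim (use \<kappa>(3) off x y in blast)
  then have "(\<lambda>j. ratio (x - of_real (\<kappa> j) * u)) \<longlonglongrightarrow> ratio y"
    using rlim[OF y(1,2)] by (simp cong: tendsto_cong)
  then show ?thesis using rlim[OF x(1,2)] LIMSEQ_unique by blast
qed

lemma ratio_const_on_ray:
  assumes x: "x \<in> ball 0 R" "x \<noteq> 0" and s: "s \<noteq> 0" "of_real s * x \<in> ball 0 R"
  shows "ratio (of_real s * x) = ratio x"
proof (rule ratio_const_through_origin[of "\<i> * sgn x"])
  show "x \<in> ball 0 R" "x \<noteq> 0" "of_real s * x \<in> ball 0 R" by fact+
  show "of_real s * x \<noteq> 0" using x s by simp
  show "cmod (\<i> * sgn x) = 1" using x by (simp add: norm_mult norm_sgn)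
  show "Re (cnj (\<i> * sgn x) * x) = 0" by (simp add: sgn_div_norm)
  show "Re (cnj (\<i> * sgn x) * (of_real s * x)) = 0" by (simp add: sgn_div_norm)
qed

text \<open>Points on opposite rays lie on a line through \<open>0\<close>. Two other rays both meet one line of constant
ratio, at points that can be taken in the ball because the line may be chosen close to \<open>0\<close>.\<close>

lemma ratio_const:
  assumes x: "x \<in> ball 0 R" "x \<noteq> 0" and y: "y \<in> ball 0 R" "y \<noteq> 0"
  shows "ratio x = ratio y"
proof (cases "sgn x + sgn y = 0")
  case True
  then have "sgn y = - sgn x" by (simp add: eq_neg_iff_add_eq_0 add.commute)
  moreover have "y = of_real (cmod y) * sgn y" using y by (simp add: sgn_div_norm scaleR_conv_of_real)
  ultimately have "y = of_real (cmod y) * - sgn x" by simp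
  also have "\<dots> = of_real (- cmod y / cmod x) * x"
    using x by (simp add: sgn_div_norm scaleR_conv_of_real divide_simps)
  finally have "y = of_real (- cmod y / cmod x) * x" .
  then show ?thesis using ratio_const_on_ray[OF x, of "- cmod y / cmod x"] x y by simp
next
  case False
  define w where "w = sgn x + sgn y"
  define u where "u = - sgn w"
  have w: "w \<noteq> 0" using False by (simp add: w_def)
  have u: "cmod u = 1" using w by (simp add: u_def norm_sgn)
  have pos: "0 < - Re (cnj u * z)" if "z \<noteq> 0" "w = sgn z + v" "cmod v = 1" for z v
  proof -
    have nz: "cmod (sgn z) = 1" using that by (simp add: norm_sgn)
    have "sgn z \<noteq> - v" using that w by auto
    then have "0 < Re (cnj (sgn z) * (sgn z - - v))" using Re_cnj_self_diff(1)[of "sgn z" "- v"] nz that by simp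
    moreover have "Re (cnj (sgn z) * w) = Re (cnj w * sgn z)" by (simp add: algebra_simps)
    ultimately have "0 < Re (cnj w * sgn z)" using that by simp
    moreover have "- Re (cnj u * z) = (cmod z / cmod w) * Re (cnj w * sgn z)"
      using that w by (simp add: u_def sgn_div_norm divide_simps algebra_simps)
    ultimately show ?thesis using that w by simp
  qed
  have px: "0 < - Re (cnj u * x)" using pos[of x "sgn y"] x y by (simp add: w_def norm_sgn)
  have py: "0 < - Re (cnj u * y)" using pos[of y "sgn x"] x y by (simp add: w_def norm_sgn add.commute)
  obtain \<kappa> where \<kappa>: "0 < \<kappa>" "\<kappa> < min (- Re (cnj u * x)) (- Re (cnj u * y))"
    "\<And>x y. x \<in> ball 0 R \<Longrightarrow> y \<in> ball 0 R \<Longrightarrow> - Re (cnj u * x) = \<kappa> \<Longrightarrow> - Re (cnj u * y) = \<kappa> \<Longrightarrow> ratio x = ratio y"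
    using ratio_const_on_line[OF u, of "min (- Re (cnj u * x)) (- Re (cnj u * y))"] px py by auto
  define s where "s z = \<kappa> / (- Re (cnj u * z))" for z
  have s: "s z \<noteq> 0" "of_real (s z) * z \<in> ball 0 R" "- Re (cnj u * (of_real (s z) * z)) = \<kappa>"
    if "z \<in> ball 0 R" "0 < - Re (cnj u * z)" "\<kappa> < - Re (cnj u * z)" for z
  proof -
    have sz: "0 < s z" "s z < 1" using that \<kappa> by (auto simp: s_def field_simps)
    then show "s z \<noteq> 0" by simp
    have "s z * cmod z \<le> cmod z" using sz by (simp add: mult_left_le_one_le)
    then show "of_real (s z) * z \<in> ball 0 R" using that sz by (simp add: norm_mult)
    have "- Re (cnj u * (of_real (s z) * z)) = s z * - Re (cnj u * z)" unfolding Re_cnj_scale by (rule minus_mult_right)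
    then show "- Re (cnj u * (of_real (s z) * z)) = \<kappa>" using that unfolding s_def by (metis less_irrefl nonzero_divide_eq_eq)
  qed
  have "ratio x = ratio (of_real (s x) * x)" using ratio_const_on_ray[OF x] s[OF x(1) px] \<kappa>(2) by simp
  also have "\<dots> = ratio (of_real (s y) * y)" by (rule \<kappa>(3)) (use s[OF x(1) px] s[OF y(1) py] \<kappa>(2) in auto)
  also have "\<dots> = ratio y" using ratio_const_on_ray[OF y] s[OF y(1) py] \<kappa>(2) by simp
  finally show ?thesis .
qed

lemma linear_conformal:
  obtains \<rho> where "0 < \<rho>" "(\<forall>x\<in>ball 0 R. \<eta> x = of_real \<rho> * x) \<or> (\<forall>x\<in>ball 0 R. \<eta> x = of_real \<rho> * cnj x)"
proof -
  define \<rho> where "\<rho> = ratio (of_real (R / 2))"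
  have x0: "of_real (R / 2) \<in> ball (0::complex) R" "of_real (R / 2) \<noteq> (0::complex)" using R by auto
  have "0 < \<rho>" unfolding \<rho>_def by (rule ratio_pos[OF x0])
  moreover have norm: "cmod (\<eta> x) = \<rho> * cmod x" if "x \<in> ball 0 R" for x
  proof (cases "x = 0")
    case False
    then have "ratio x = \<rho>" unfolding \<rho>_def using ratio_const[OF that _ x0] by blast
    then show ?thesis using False by (simp add: ratio_def field_simps)
  qed (simp add: zero)
  moreover obtain c :: real where c: "c = 1 \<or> c = - 1" "cis \<theta>' = cis (c * \<theta>)"
    "\<And>s t. 0 < s \<Longrightarrow> s < R \<Longrightarrow> \<eta> (of_real s * cis t) = of_real (cmod (\<eta> (of_real s * cis t))) * cis (c * t)"
    using rays_preserved by blast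
  have "\<eta> x = of_real \<rho> * (of_real (cmod x) * cis (c * Arg x))" if x: "x \<in> ball 0 R" for x
  proof (cases "x = 0")
    case True then show ?thesis by (simp add: zero)
  next
    case False
    have "x = of_real (cmod x) * cis (Arg x)" by (simp add: rcis_cmod_Arg[unfolded rcis_def])
    then show ?thesis using c(3)[of "cmod x" "Arg x"] False x norm[OF x] by simp
  qed
  moreover have "of_real (cmod x) * cis (Arg x) = x" "of_real (cmod x) * cis (- 1 * Arg x) = cnj x" for x
  proof -
    show 1: "of_real (cmod x) * cis (Arg x) = x" by (rule rcis_cmod_Arg[unfolded rcis_def])
    have "of_real (cmod x) * cis (- 1 * Arg x) = cnj (of_real (cmod x) * cis (Arg x))" by (simp add: cis_cnj)
    then show "of_real (cmod x) * cis (- 1 * Arg x) = cnj x" unfolding 1 .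
  qed
  ultimately show ?thesis using that[of \<rho>] c(1) by auto
qed

end


section \<open>Strict differentiability along charts\<close>

text \<open>Strong (or strict) differentiability at a point. It is what continuous differentiability
contributes to the estimates, it refers to one point only, and it is closed under composition.\<close>

definition strict_derivative ::
  "('a::real_normed_vector \<Rightarrow> 'b::real_normed_vector) \<Rightarrow> ('a \<Rightarrow> 'b) \<Rightarrow> 'a \<Rightarrow> bool"
  where "strict_derivative F F' x \<longleftrightarrow> bounded_linear F' \<and>
    (\<forall>e>0. \<exists>d>0. \<forall>u\<in>ball x d. \<forall>v\<in>ball x d. norm (F u - F v - F' (u - v)) \<le> e * norm (u - v))"

lemma strict_derivativeD:
  assumes "strict_derivative F F' x" "0 < e"
  obtains d where "0 < d" "\<And>u v. u \<in> ball x d \<Longrightarrow> v \<in> ball x d \<Longrightarrow> norm (F u - F v - F' (u - v)) \<le> e * norm (u - v)"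
  using assms unfolding strict_derivative_def by metis

lemma strict_derivative_imp_has_derivative:
  assumes "strict_derivative F F' x" shows "(F has_derivative F') (at x)"
  unfolding has_derivative_at_alt
proof (intro conjI allI impI)
  show "bounded_linear F'" using assms by (simp add: strict_derivative_def)
  fix e :: real assume "0 < e"
  with assms obtain d where d: "0 < d"
    "\<And>u v. u \<in> ball x d \<Longrightarrow> v \<in> ball x d \<Longrightarrow> norm (F u - F v - F' (u - v)) \<le> e * norm (u - v)"
    by (rule strict_derivativeD) blast
  show "\<exists>d>0. \<forall>y. norm (y - x) < d \<longrightarrow> norm (F y - F x - F' (y - x)) \<le> e * norm (y - x)"
    using d(1) d(2)[of _ x] by (intro exI[of _ d]) (auto simp: dist_norm norm_minus_commute)
qed

lemma strict_derivative_cong: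
  assumes "strict_derivative F F' x" "open S" "x \<in> S" "\<And>y. y \<in> S \<Longrightarrow> F y = G y"
  shows "strict_derivative G F' x"
  unfolding strict_derivative_def
proof (intro conjI allI impI)
  show "bounded_linear F'" using assms(1) by (simp add: strict_derivative_def)
  fix e :: real assume "0 < e"
  with assms(1) obtain d where d: "0 < d"
    "\<And>u v. u \<in> ball x d \<Longrightarrow> v \<in> ball x d \<Longrightarrow> norm (F u - F v - F' (u - v)) \<le> e * norm (u - v)"
    by (rule strict_derivativeD) blast
  obtain d' where d': "0 < d'" "ball x d' \<subseteq> S" using assms(2,3) openE by blast
  show "\<exists>d>0. \<forall>u\<in>ball x d. \<forall>v\<in>ball x d. norm (G u - G v - F' (u - v)) \<le> e * norm (u - v)"
  proof (intro exI[of _ "min d d'"] conjI ballI)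
    fix u v assume "u \<in> ball x (min d d')" "v \<in> ball x (min d d')"
    then have "u \<in> ball x d" "v \<in> ball x d" "u \<in> S" "v \<in> S" using d' by auto
    then show "norm (G u - G v - F' (u - v)) \<le> e * norm (u - v)" using d(2)[of u v] assms(4) by simp
  qed (use d(1) d'(1) in simp)
qed

lemma strict_derivative_compose:
  assumes F: "strict_derivative F F' x" and G: "strict_derivative G G' (F x)"
  shows "strict_derivative (G \<circ> F) (G' \<circ> F') x"
  unfolding strict_derivative_def
proof (intro conjI allI impI)
  have lF: "bounded_linear F'" and lG: "bounded_linear G'"
    using F G by (simp_all add: strict_derivative_def)
  then show "bounded_linear (G' \<circ> F')" unfolding o_def by (rule bounded_linear_compose[rotated])
  obtain KF where KF: "0 < KF" "\<And>v. norm (F' v) \<le> norm v * KF"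
    using bounded_linear.pos_bounded[OF lF] by blast
  obtain KG where KG: "0 < KG" "\<And>v. norm (G' v) \<le> norm v * KG"
    using bounded_linear.pos_bounded[OF lG] by blast
  fix e :: real assume e: "0 < e"
  define e1 where "e1 = min 1 (e / (2 * KG))"
  define e2 where "e2 = e / (2 * (KF + 1))"
  have e12: "0 < e1" "0 < e2" "e1 \<le> 1" "e1 * KG \<le> e / 2" "e2 * (KF + 1) = e / 2"
    using e KF KG by (auto simp: e1_def e2_def min_def field_simps)
  obtain d1 where d1: "0 < d1"
    "\<And>u v. u \<in> ball x d1 \<Longrightarrow> v \<in> ball x d1 \<Longrightarrow> norm (F u - F v - F' (u - v)) \<le> e1 * norm (u - v)"
    using strict_derivativeD[OF F e12(1)] by blast
  obtain d2 where d2: "0 < d2"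
    "\<And>u v. u \<in> ball (F x) d2 \<Longrightarrow> v \<in> ball (F x) d2 \<Longrightarrow> norm (G u - G v - G' (u - v)) \<le> e2 * norm (u - v)"
    using strict_derivativeD[OF G e12(2)] by blast
  define d where "d = min d1 (d2 / (KF + 1))"
  have d: "0 < d" using d1 d2 KF by (simp add: d_def)
  have lip: "norm (F u - F v) \<le> (KF + 1) * norm (u - v)" if "u \<in> ball x d" "v \<in> ball x d" for u v
  proof -
    have "norm (F u - F v) \<le> norm (F u - F v - F' (u - v)) + norm (F' (u - v))"
      using norm_triangle_ineq[of "F u - F v - F' (u - v)" "F' (u - v)"] by simp
    also have "\<dots> \<le> e1 * norm (u - v) + norm (u - v) * KF"
      using that by (intro add_mono d1(2) KF(2)) (auto simp: d_def)
    also have "\<dots> \<le> 1 * norm (u - v) + norm (u - v) * KF"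
      using e12(3) by (intro add_right_mono mult_right_mono) auto
    finally show ?thesis by (simp add: algebra_simps)
  qed
  show "\<exists>d>0. \<forall>u\<in>ball x d. \<forall>v\<in>ball x d. norm ((G \<circ> F) u - (G \<circ> F) v - (G' \<circ> F') (u - v)) \<le> e * norm (u - v)"
  proof (intro exI[of _ d] conjI ballI d)
    fix u v assume uv: "u \<in> ball x d" "v \<in> ball x d"
    have inF: "F w \<in> ball (F x) d2" if "w \<in> ball x d" for w
    proof -
      have "norm (F w - F x) \<le> (KF + 1) * norm (w - x)" using lip[of w x] that d by simp
      also have "\<dots> < (KF + 1) * (d2 / (KF + 1))"
        using that KF by (intro mult_strict_left_mono) (auto simp: d_def dist_norm norm_minus_commute)
      also have "\<dots> = d2" using KF by simp
      finally show ?thesis by (simp add: dist_norm norm_minus_commute)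
    qed
    have "norm (G (F u) - G (F v) - G' (F' (u - v)))
        \<le> norm (G (F u) - G (F v) - G' (F u - F v)) + norm (G' (F u - F v - F' (u - v)))"
      using norm_triangle_ineq[of "G (F u) - G (F v) - G' (F u - F v)" "G' (F u - F v - F' (u - v))"]
      by (simp add: bounded_linear.linear[OF lG] linear_diff)
    also have "\<dots> \<le> e2 * norm (F u - F v) + norm (F u - F v - F' (u - v)) * KG"
      by (intro add_mono d2(2) KG(2) inF uv)
    also have "\<dots> \<le> e2 * ((KF + 1) * norm (u - v)) + (e1 * norm (u - v)) * KG"
      using lip[OF uv] d1(2)[of u v] uv e12 KG by (intro add_mono mult_left_mono mult_right_mono) (auto simp: d_def)
    also have "\<dots> = (e2 * (KF + 1) + e1 * KG) * norm (u - v)" by (simp add: algebra_simps)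
    also have "\<dots> \<le> e * norm (u - v)" using e12 by (intro mult_right_mono) auto
    finally show "norm ((G \<circ> F) u - (G \<circ> F) v - (G' \<circ> F') (u - v)) \<le> e * norm (u - v)" by simp
  qed
qed

text \<open>The mean value inequality for \<open>g\<close> minus its derivative at \<open>x\<close>, whose own derivative is small near
\<open>x\<close> by continuity of the finitely many partial derivatives.\<close>

lemma C1_imp_strict_derivative:
  fixes g :: "'a::euclidean_space \<Rightarrow> 'b::real_normed_vector"
  assumes g: "cn_on (Suc 0) S g" and S: "open S" "x \<in> S"
  shows "\<exists>g'. strict_derivative g g' x"
proof -
  define g' where "g' y = frechet_derivative g (at y)" for y
  have der: "(g has_derivative g' y) (at y)" if "y \<in> S" for y
    using g that S unfolding g'_def
    by (metis cn_on.simps(2) differentiable_on_def at_within_open frechet_derivative_works)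
  have cont: "continuous_on S (\<lambda>y. g' y b)" if "b \<in> Basis" for b
    using g that unfolding g'_def by simp
  have lin: "bounded_linear (g' y)" if "y \<in> S" for y using der[OF that] by (rule has_derivative_bounded_linear)
  have "strict_derivative g (g' x) x" unfolding strict_derivative_def
  proof (intro conjI allI impI)
    show "bounded_linear (g' x)" using lin S by simp
    fix e :: real assume e: "0 < e"
    define e1 where "e1 = e / real DIM('a)"
    have e1: "0 < e1" using e by (simp add: e1_def)
    have "\<forall>b\<in>Basis. \<forall>\<^sub>F y in nhds x. dist (g' y b) (g' x b) < e1"
    proof
      fix b :: 'a assume "b \<in> Basis"
      then have "isCont (\<lambda>y. g' y b) x" using cont S by (simp add: continuous_on_eq_continuous_at)
      then have "((\<lambda>y. g' y b) \<longlongrightarrow> g' x b) (nhds x)" by (simp add: continuous_at tendsto_nhds_iff)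
      then show "\<forall>\<^sub>F y in nhds x. dist (g' y b) (g' x b) < e1" using e1 by (rule tendstoD)
    qed
    then have "\<forall>\<^sub>F y in nhds x. \<forall>b\<in>Basis. dist (g' y b) (g' x b) < e1"
      by (rule eventually_ball_finite[OF finite_Basis])
    moreover have "\<forall>\<^sub>F y in nhds x. y \<in> S" using S by (rule eventually_nhds_in_open)
    ultimately have "\<forall>\<^sub>F y in nhds x. y \<in> S \<and> (\<forall>b\<in>Basis. dist (g' y b) (g' x b) < e1)"
      by eventually_elim simp
    then obtain d where d: "0 < d" "\<And>y. dist y x < d \<Longrightarrow> y \<in> S \<and> (\<forall>b\<in>Basis. dist (g' y b) (g' x b) < e1)"
      unfolding eventually_nhds_metric by blast
    show "\<exists>d>0. \<forall>u\<in>ball x d. \<forall>v\<in>ball x d. norm (g u - g v - g' x (u - v)) \<le> e * norm (u - v)"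
    proof (intro exI[of _ d] conjI ballI d(1))
      fix u v assume uv: "u \<in> ball x d" "v \<in> ball x d"
      have "norm ((\<lambda>y. g y - g' x y) u - (\<lambda>y. g y - g' x y) v) \<le> e * norm (u - v)"
      proof (rule differentiable_bound[where S = "ball x d" and f' = "\<lambda>y h. g' y h - g' x h"])
        fix y assume "y \<in> ball x d"
        then have y: "y \<in> S" "\<And>b. b \<in> Basis \<Longrightarrow> norm (g' y b - g' x b) \<le> e1"
          using d(2)[of y] by (auto simp: dist_commute dist_norm norm_minus_commute less_imp_le)
        have "(g has_derivative g' y) (at y within ball x d)" using der[OF y(1)] by (rule has_derivative_at_withinI)
        moreover have "(g' x has_derivative g' x) (at y within ball x d)"
          using lin[OF S(2)] by (rule bounded_linear_imp_has_derivative)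
        ultimately show "((\<lambda>y. g y - g' x y) has_derivative (\<lambda>h. g' y h - g' x h)) (at y within ball x d)"
          by (rule has_derivative_diff)
        show "onorm (\<lambda>h. g' y h - g' x h) \<le> e"
        proof (rule onorm_le)
          fix h :: 'a
          have L: "linear (\<lambda>h. g' y h - g' x h)"
            using lin y(1) S(2) by (intro linear_compose_sub bounded_linear.linear) auto
          have "g' y h - g' x h = (\<Sum>b\<in>Basis. (h \<bullet> b) *\<^sub>R (g' y b - g' x b))"
            using linear_sum[OF L, of "\<lambda>b. (h \<bullet> b) *\<^sub>R b" Basis]
            by (simp only: euclidean_representation linear_scale[OF L])
          then have "norm (g' y h - g' x h) \<le> (\<Sum>b\<in>Basis. \<bar>h \<bullet> b\<bar> * norm (g' y b - g' x b))"
            using norm_sum[of "\<lambda>b. (h \<bullet> b) *\<^sub>R (g' y b - g' x b)" Basis] by simp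
          also have "\<dots> \<le> (\<Sum>b\<in>(Basis::'a set). norm h * e1)"
            using y(2) e1 by (intro sum_mono mult_mono Basis_le_norm) auto
          also have "\<dots> = e * norm h" by (simp add: e1_def)
          finally show "norm (g' y h - g' x h) \<le> e * norm h" .
        qed
      qed (use uv in auto)
      moreover have "(\<lambda>y. g y - g' x y) u - (\<lambda>y. g y - g' x y) v = g u - g v - g' x (u - v)"
        unfolding linear_diff[OF bounded_linear.linear[OF lin[OF S(2)]]] by simp
      ultimately show "norm (g u - g v - g' x (u - v)) \<le> e * norm (u - v)" by (simp only:)
    qed
  qed
  then show ?thesis by blast
qed

lemma ck_on_imp_C1: "1 \<le> k \<Longrightarrow> ck_on k S g \<Longrightarrow> cn_on (Suc 0) S g"
  unfolding ck_on_def by (metis One_nat_def one_enat_def)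

abbreviation chart_inv :: "'m chart \<Rightarrow> complex \<times> real \<Rightarrow> 'm"
  where "chart_inv C \<equiv> inv_into (fst C) (snd C)"

lemma chart_facts:
  assumes "is_chart C"
  shows "open (fst C)" "open (snd C ` fst C)" "continuous_on (fst C) (snd C)"
    "continuous_on (snd C ` fst C) (chart_inv C)" "inj_on (snd C) (fst C)"
    "\<And>x. x \<in> fst C \<Longrightarrow> chart_inv C (snd C x) = x"
    "\<And>v. v \<in> snd C ` fst C \<Longrightarrow> chart_inv C v \<in> fst C"
    "\<And>v. v \<in> snd C ` fst C \<Longrightarrow> snd C (chart_inv C v) = v"
  using assms unfolding is_chart_def homeomorphism_def
  by (auto simp: inv_into_into f_inv_into_f inj_on_def) metis

lemma open_chart_preimage:
  assumes "is_chart C" "open V" shows "open {x \<in> fst C. snd C x \<in> V}"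
proof -
  have "{x \<in> fst C. snd C x \<in> V} = fst C \<inter> snd C -` V" by auto
  then show ?thesis using continuous_open_preimage[OF chart_facts(3)[OF assms(1)] chart_facts(1)[OF assms(1)] assms(2)] by simp
qed

lemma open_chart_image:
  assumes C: "is_chart C" and "open S" shows "open (snd C ` (fst C \<inter> S))"
proof -
  have "snd C ` (fst C \<inter> S) = snd C ` fst C \<inter> chart_inv C -` S"
    using chart_facts(6-8)[OF C] by force
  then show ?thesis using continuous_open_preimage[OF chart_facts(4,2)[OF C] \<open>open S\<close>] by simp
qed

definition strictly_differentiable_at :: "'m chart \<Rightarrow> 'm chart \<Rightarrow> ('m \<Rightarrow> 'm) \<Rightarrow> 'm \<Rightarrow> bool"
  where "strictly_differentiable_at C D g x \<longleftrightarrow>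
    (\<exists>g'. strict_derivative (snd D \<circ> g \<circ> chart_inv C) g' (snd C x))"

lemma strictly_differentiable_at_compose:
  fixes g h :: "'m::topological_space \<Rightarrow> 'm"
  assumes g: "strictly_differentiable_at C E g x" and h: "strictly_differentiable_at E D h (g x)"
    and C: "is_chart C" and E: "is_chart E" and cont: "continuous_on UNIV g"
    and x: "x \<in> fst C" "g x \<in> fst E"
  shows "strictly_differentiable_at C D (h \<circ> g) x"
proof -
  obtain g' where g': "strict_derivative (snd E \<circ> g \<circ> chart_inv C) g' (snd C x)"
    using g unfolding strictly_differentiable_at_def by blast
  obtain h' where h': "strict_derivative (snd D \<circ> h \<circ> chart_inv E) h' (snd E (g x))"
    using h unfolding strictly_differentiable_at_def by blast
  have "(snd E \<circ> g \<circ> chart_inv C) (snd C x) = snd E (g x)" using chart_facts(6)[OF C x(1)] by simp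
  then have *: "strict_derivative ((snd D \<circ> h \<circ> chart_inv E) \<circ> (snd E \<circ> g \<circ> chart_inv C)) (h' \<circ> g') (snd C x)"
    using strict_derivative_compose[OF g'] h' by simp
  have "strict_derivative (snd D \<circ> (h \<circ> g) \<circ> chart_inv C) (h' \<circ> g') (snd C x)"
  proof (rule strict_derivative_cong[OF *])
    show "open (snd C ` (fst C \<inter> g -` fst E))"
      using open_chart_image[OF C] cont chart_facts(1)[OF E] by (simp add: continuous_on_open_vimage)
    show "snd C x \<in> snd C ` (fst C \<inter> g -` fst E)" using x by auto
    fix y assume "y \<in> snd C ` (fst C \<inter> g -` fst E)"
    then obtain z where "z \<in> fst C" "g z \<in> fst E" "y = snd C z" by auto
    then show "((snd D \<circ> h \<circ> chart_inv E) \<circ> (snd E \<circ> g \<circ> chart_inv C)) y = (snd D \<circ> (h \<circ> g) \<circ> chart_inv C) y"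
      using chart_facts(6)[OF C] chart_facts(6)[OF E] by simp
  qed
  then show ?thesis unfolding strictly_differentiable_at_def by blast
qed

lemma transition_strictly_differentiable:
  assumes "ck_compatible k C D" "is_chart C" "is_chart D" "1 \<le> k" "x \<in> fst C" "x \<in> fst D"
  shows "strictly_differentiable_at C D id x" "strictly_differentiable_at D C id x"
proof -
  have "cn_on (Suc 0) (snd C ` (fst C \<inter> fst D)) (snd D \<circ> chart_inv C)"
       "cn_on (Suc 0) (snd D ` (fst C \<inter> fst D)) (snd C \<circ> chart_inv D)"
    using assms ck_on_imp_C1 unfolding ck_compatible_def by blast+
  moreover have "open (snd C ` (fst C \<inter> fst D))" "open (snd D ` (fst C \<inter> fst D))"
    using open_chart_image[OF assms(2) chart_facts(1)[OF assms(3)]]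
      open_chart_image[OF assms(3) chart_facts(1)[OF assms(2)]] by (simp_all add: Int_commute)
  ultimately show "strictly_differentiable_at C D id x" "strictly_differentiable_at D C id x"
    unfolding strictly_differentiable_at_def using C1_imp_strict_derivative assms(5,6) by (simp_all, blast+)
qed

lemma ck_map_strictly_differentiable:
  assumes A: "ck_3_manifold k A" and k: "1 \<le> k" and f: "ck_map k A f"
    and C: "C \<in> A" "D \<in> A" "x \<in> fst C" "f x \<in> fst D"
  shows "strictly_differentiable_at C D f x"
proof -
  have ch: "is_chart C" "is_chart D" using A C unfolding ck_3_manifold_def by auto
  have "cn_on (Suc 0) (snd C ` (fst C \<inter> f -` fst D)) (snd D \<circ> f \<circ> chart_inv C)"
    using f C ck_on_imp_C1[OF k] unfolding ck_map_def by blast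
  moreover have "open (snd C ` (fst C \<inter> f -` fst D))"
    using open_chart_image[OF ch(1)] f chart_facts(1)[OF ch(2)] unfolding ck_map_def
    by (simp add: continuous_on_open_vimage)
  ultimately show ?thesis
    unfolding strictly_differentiable_at_def using C1_imp_strict_derivative C(3,4) by blast
qed

text \<open>The intermediate points of the orbit may leave the domains of \<open>P\<close> and \<open>Q\<close>, so the induction passes
through the charts of the atlas and changes to \<open>Q\<close> only at the end.\<close>

lemma iterate_strictly_differentiable:
  assumes A: "ck_3_manifold k A" and k: "1 \<le> k" and f: "ck_map k A f"
    and P: "local_coordinate k A P" and Q: "local_coordinate k A Q" and x: "x \<in> fst P" "(f ^^ n) x \<in> fst Q"
  shows "strictly_differentiable_at P Q (f ^^ n) x"
proof -
  have chP: "is_chart P" "is_chart Q" using P Q by (auto simp: local_coordinate_def)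
  have chA: "is_chart D" if "D \<in> A" for D using that A by (auto simp: ck_3_manifold_def)
  have cover: "\<exists>D\<in>A. y \<in> fst D" for y using A by (auto simp: ck_3_manifold_def)
  have cf: "continuous_on UNIV f" using f by (simp add: ck_map_def)
  have cfn: "continuous_on UNIV (f ^^ n)" for n
    by (induction n) (use cf continuous_on_compose2[OF cf] in \<open>auto simp: o_def continuous_on_id id_def\<close>)
  have inA: "strictly_differentiable_at P D (f ^^ n) x" if "D \<in> A" "(f ^^ n) x \<in> fst D" for n D
    using that
  proof (induction n arbitrary: D)
    case 0
    then show ?case using transition_strictly_differentiable[of k P D x] P k x chP chA[of D]
      by (simp add: local_coordinate_def id_def[symmetric])
  next
    case (Suc n)
    obtain E where E: "E \<in> A" "(f ^^ n) x \<in> fst E" using cover by blast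
    have "strictly_differentiable_at P D (f \<circ> f ^^ n) x"
      using Suc.IH[OF E] ck_map_strictly_differentiable[OF A k f E(1) Suc.prems(1) E(2)] Suc.prems(2)
      by (intro strictly_differentiable_at_compose[OF _ _ chP(1) chA[OF E(1)] cfn x(1) E(2)]) auto
    then show ?case by (simp add: o_def)
  qed
  obtain E where E: "E \<in> A" "(f ^^ n) x \<in> fst E" using cover by blast
  have "strictly_differentiable_at E Q id ((f ^^ n) x)"
    using transition_strictly_differentiable[of k Q E "(f ^^ n) x"] Q k x chP chA[OF E(1)] E
    by (simp add: local_coordinate_def)
  then have "strictly_differentiable_at P Q (id \<circ> f ^^ n) x"
    by (intro strictly_differentiable_at_compose[OF inA[OF E] _ chP(1) chA[OF E(1)] cfn x(1) E(2)])
  then show ?thesis by simp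
qed


section \<open>Excursions near a linearized saddle\<close>

text \<open>Starting in \<open>O1\<close>, the orbit stays in \<open>B\<close> for \<open>m\<close> steps until it is in \<open>O2\<close>; it reappears in \<open>B\<close> after
\<open>N\<close> steps and stays there for \<open>n\<close> more until it is in \<open>O3\<close>. Only \<open>f\<close>, open sets and \<open>B\<close> enter, so
excursions are respected by conjugacies. Staying in \<open>B\<close> ensures that the linear formula applies.\<close>

definition excursion ::
  "('m \<Rightarrow> 'm) \<Rightarrow> 'm set \<Rightarrow> nat \<Rightarrow> 'm set \<Rightarrow> 'm set \<Rightarrow> 'm set \<Rightarrow> nat \<Rightarrow> nat \<Rightarrow> bool"
  where "excursion f B N O1 O2 O3 n m \<longleftrightarrow>
    (\<exists>x\<in>O1. (\<forall>j\<le>m. (f ^^ j) x \<in> B) \<and> (f ^^ m) x \<in> O2 \<and>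
      (\<forall>j\<le>n. (f ^^ j) ((f ^^ N) ((f ^^ m) x)) \<in> B) \<and> (f ^^ n) ((f ^^ N) ((f ^^ m) x)) \<in> O3)"

lemma funpow_conjugate:
  assumes "bij h" "f' = h \<circ> f \<circ> inv h" shows "(f' ^^ n) (h x) = h ((f ^^ n) x)"
  by (induction n) (use assms in \<open>auto simp: bij_is_inj\<close>)

lemma excursion_conjugate:
  assumes "bij h" "f' = h \<circ> f \<circ> inv h" "h ` B \<subseteq> B'" "excursion f B N (h -` O1) (h -` O2) (h -` O3) n m"
  shows "excursion f' B' N O1 O2 O3 n m"
proof -
  obtain x where "x \<in> h -` O1" "\<forall>j\<le>m. (f ^^ j) x \<in> B" "(f ^^ m) x \<in> h -` O2"
      "\<forall>j\<le>n. (f ^^ j) ((f ^^ N) ((f ^^ m) x)) \<in> B" "(f ^^ n) ((f ^^ N) ((f ^^ m) x)) \<in> h -` O3"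
    using assms(4) unfolding excursion_def by blast
  then show ?thesis unfolding excursion_def
    using assms(3) by (intro bexI[of _ "h x"]) (auto simp: funpow_conjugate[OF assms(1,2)])
qed

lemma local_unstable_backward:
  assumes "x \<in> local_unstable f p U" shows "(inv f ^^ j) x \<in> local_unstable f p U"
proof -
  have lim: "(\<lambda>i. (inv f ^^ i) x) \<longlonglongrightarrow> p" and inU: "\<And>i. (inv f ^^ i) x \<in> U"
    using assms by (auto simp: local_unstable_def unstable_manifold_def)
  have *: "(inv f ^^ i) ((inv f ^^ j) x) = (inv f ^^ (i + j)) x" for i by (simp add: funpow_add)
  have "(\<lambda>i. (inv f ^^ (i + j)) x) \<longlonglongrightarrow> p" using LIMSEQ_ignore_initial_segment[OF lim] .
  then show ?thesis using inU by (simp add: local_unstable_def unstable_manifold_def *)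
qed

text \<open>The linear normal form \<open>(z, t) \<mapsto> (r e^{i \<theta>} z, l t)\<close> on \<open>U\<close>, with a full cylinder of size \<open>b\<close>
inside the chart.\<close>

locale saddle_chart =
  fixes f :: "'m::{t2_space,second_countable_topology} \<Rightarrow> 'm" and p :: 'm and U :: "'m set" and C :: "'m chart" and r \<theta> l b :: real
  assumes bij: "bij f" and cont: "continuous_on UNIV f" "continuous_on UNIV (inv f)"
    and fixed: "f p = p" and chart: "is_chart C"
    and U: "open U" "p \<in> U" "U \<subseteq> fst C" and origin: "snd C p = 0"
    and params: "1 < r" "0 < l" "l < 1" and box: "box_in_chart U C b"
    and linear: "\<And>x. x \<in> U \<Longrightarrow> f x \<in> fst C \<and> snd C (f x) = (rcis r \<theta> * z_coord C x, l * t_coord C x)"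
    and unstable: "\<And>x. x \<in> U \<Longrightarrow> t_coord C x = 0 \<longleftrightarrow> x \<in> local_unstable f p U"
    and stable: "\<And>x. x \<in> local_stable f p U \<Longrightarrow> z_coord C x = 0"
begin

lemma coord_inj: "x \<in> fst C \<Longrightarrow> y \<in> fst C \<Longrightarrow> snd C x = snd C y \<Longrightarrow> x = y"
  using chart_facts(5)[OF chart] by (auto dest: inj_onD)

lemma box_point:
  assumes "cmod z \<le> b" "0 \<le> t" "t \<le> b"
  shows "chart_inv C (z, t) \<in> U" "snd C (chart_inv C (z, t)) = (z, t)" "(z, t) \<in> snd C ` U" "(z, t) \<in> snd C ` fst C"
proof -
  have "(z, t) \<in> cball 0 b \<times> {0..b}" using assms by simp
  then obtain x where x: "x \<in> U" "snd C x = (z, t)" using box unfolding box_in_chart_def by (metis imageE subsetD)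
  then have "chart_inv C (z, t) = x" using chart_facts(6)[OF chart, of x] U by auto
  then show "chart_inv C (z, t) \<in> U" "snd C (chart_inv C (z, t)) = (z, t)" "(z, t) \<in> snd C ` U" "(z, t) \<in> snd C ` fst C"
    using x U(3) by (auto simp: image_iff intro: bexI[of _ x])
qed

lemma cont_iterate: "continuous_on UNIV (f ^^ n)" "continuous_on UNIV (inv f ^^ n)"
  using cont by (induction n) (auto simp: o_def id_def intro: continuous_on_compose2)

lemma inv_iterate [simp]: "(inv f ^^ n) ((f ^^ n) x) = x" "(f ^^ n) ((inv f ^^ n) x) = x"
proof -
  have "bij (f ^^ n)" using bij by (rule bij_betw_funpow)
  moreover have "inv (f ^^ n) = inv f ^^ n" using inv_fn[OF bij] .
  ultimately show "(inv f ^^ n) ((f ^^ n) x) = x" "(f ^^ n) ((inv f ^^ n) x) = x"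
    by (metis bij_is_inj inv_f_f, metis bij_is_surj surj_f_inv_f \<open>bij (f ^^ n)\<close>)
qed

lemma iterate_coord:
  assumes "x \<in> fst C" "\<And>j. j < n \<Longrightarrow> (f ^^ j) x \<in> U"
  shows "(f ^^ n) x \<in> fst C \<and> snd C ((f ^^ n) x) = (rcis r \<theta> ^ n * z_coord C x, l ^ n * t_coord C x)"
  using assms(2)
proof (induction n)
  case 0 then show ?case using assms(1) by simp
next
  case (Suc n)
  then have IH: "snd C ((f ^^ n) x) = (rcis r \<theta> ^ n * z_coord C x, l ^ n * t_coord C x)" by simp
  have "(f ^^ n) x \<in> U" using Suc.prems by simp
  from linear[OF this] IH show ?case by (simp add: mult.assoc)
qed

lemma norm_multiplier [simp]: "cmod (rcis r \<theta> ^ n) = r ^ n"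
  using params by (simp add: norm_power)

lemma l_power_le: "0 \<le> t \<Longrightarrow> l ^ j * t \<le> t"
  using params by (simp add: mult_left_le_one_le power_le_one)

text \<open>The linear formula needs \<open>f\<close> to stay in \<open>U\<close>. It does, since the point of the cylinder with the
expected coordinates lies in \<open>U\<close> and the chart is injective.\<close>

lemma iterate_box:
  assumes "cmod (rcis r \<theta> ^ n * z) \<le> c" "0 \<le> t" "t \<le> c" "c \<le> b" "j \<le> n"
  shows "(f ^^ j) (chart_inv C (z, t)) = chart_inv C (rcis r \<theta> ^ j * z, l ^ j * t)"
    "(f ^^ j) (chart_inv C (z, t)) \<in> U_box U C c"
proof -
  have in_box: "cmod (rcis r \<theta> ^ j * z) \<le> c" "0 \<le> l ^ j * t" "l ^ j * t \<le> c" if "j \<le> n" for j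
  proof -
    have "r ^ j * cmod z \<le> r ^ n * cmod z" using that params by (intro mult_right_mono power_increasing) auto
    then show "cmod (rcis r \<theta> ^ j * z) \<le> c" using assms(1) params(1) by (simp add: norm_mult norm_power)
    show "0 \<le> l ^ j * t" "l ^ j * t \<le> c" using params assms l_power_le[of t j] by auto
  qed
  have *: "(f ^^ j) (chart_inv C (z, t)) = chart_inv C (rcis r \<theta> ^ j * z, l ^ j * t)" if "j \<le> n" for j
    using that
  proof (induction j)
    case 0 then show ?case by simp
  next
    case (Suc j)
    let ?x = "chart_inv C (rcis r \<theta> ^ j * z, l ^ j * t)"
    have x: "?x \<in> U" "snd C ?x = (rcis r \<theta> ^ j * z, l ^ j * t)"
      using box_point in_box[of j] Suc.prems assms(4) by auto
    have y: "chart_inv C (rcis r \<theta> ^ Suc j * z, l ^ Suc j * t) \<in> U"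
      "snd C (chart_inv C (rcis r \<theta> ^ Suc j * z, l ^ Suc j * t)) = (rcis r \<theta> ^ Suc j * z, l ^ Suc j * t)"
      using box_point in_box[of "Suc j"] Suc.prems assms(4) by force+
    have "f ?x = chart_inv C (rcis r \<theta> ^ Suc j * z, l ^ Suc j * t)"
    proof (rule coord_inj)
      show "f ?x \<in> fst C" using linear[OF x(1)] by simp
      show "chart_inv C (rcis r \<theta> ^ Suc j * z, l ^ Suc j * t) \<in> fst C" using y(1) U(3) by blast
      show "snd C (f ?x) = snd C (chart_inv C (rcis r \<theta> ^ Suc j * z, l ^ Suc j * t))"
        using linear[OF x(1)] x(2) unfolding y(2) by (simp add: mult.assoc)
    qed
    then show ?case using Suc by simp
  qed
  then show "(f ^^ j) (chart_inv C (z, t)) = chart_inv C (rcis r \<theta> ^ j * z, l ^ j * t)" using assms(5) .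
  show "(f ^^ j) (chart_inv C (z, t)) \<in> U_box U C c"
    unfolding *[OF assms(5)] U_box_def
    using box_point[of "rcis r \<theta> ^ j * z" "l ^ j * t"] in_box[OF assms(5)] assms(4) by simp
qed

lemma backward_disk:
  assumes "x \<in> D_disk U C c"
  shows "(inv f ^^ n) x \<in> D_disk U C c" "z_coord C x = rcis r \<theta> ^ n * z_coord C ((inv f ^^ n) x)"
proof -
  have Wu: "x \<in> local_unstable f p U" and x: "x \<in> U" "t_coord C x = 0" "cmod (z_coord C x) \<le> c"
    using assms unstable by (auto simp: D_disk_def)
  have inW: "(inv f ^^ j) x \<in> local_unstable f p U" for j
    using Wu by (rule local_unstable_backward)
  have inU: "(inv f ^^ j) x \<in> U" for j using inW[of j] by (auto simp: local_unstable_def dest: spec[of _ 0])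
  have fwd: "(f ^^ j) ((inv f ^^ n) x) = (inv f ^^ (n - j)) x" if "j \<le> n" for j
  proof -
    have "(inv f ^^ n) x = (inv f ^^ j) ((inv f ^^ (n - j)) x)" using that by (metis funpow_add le_add_diff_inverse o_apply)
    then show ?thesis by simp
  qed
  have "snd C ((f ^^ n) ((inv f ^^ n) x)) = (rcis r \<theta> ^ n * z_coord C ((inv f ^^ n) x), l ^ n * t_coord C ((inv f ^^ n) x))"
    using iterate_coord[of "(inv f ^^ n) x" n] inU U(3) fwd by auto
  then show z: "z_coord C x = rcis r \<theta> ^ n * z_coord C ((inv f ^^ n) x)" by simp
  have "cmod (z_coord C ((inv f ^^ n) x)) \<le> r ^ n * cmod (z_coord C ((inv f ^^ n) x))"
    using params by (simp add: mult_le_cancel_right1)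
  also have "\<dots> = cmod (z_coord C x)" by (simp add: z norm_mult norm_power) (use params in simp)
  finally have "cmod (z_coord C ((inv f ^^ n) x)) \<le> c" using x by simp
  moreover have "t_coord C ((inv f ^^ n) x) = 0" using unstable[OF inU] inW by blast
  ultimately show "(inv f ^^ n) x \<in> D_disk U C c" using inU by (simp add: D_disk_def)
qed

text \<open>The height from which \<open>f ^^ N\<close> reaches the point with coordinates \<open>v\<close>.\<close>

definition return_height :: "nat \<Rightarrow> complex \<times> real \<Rightarrow> real"
  where "return_height N v = t_coord C ((inv f ^^ N) (chart_inv C v))"

text \<open>The transition \<open>f ^^ N\<close> from \<open>q\<close> to the stable axis is expressed through its inverse: the first-order
behaviour of \<open>return_height\<close> in \<open>w\<close>, uniformly in \<open>T\<close>, and its positivity on the axis away from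
\<open>t0\<close>, which says that the stable manifold touches the unstable plane at \<open>q\<close> from above.\<close>

definition tangential_transit :: "'m \<Rightarrow> nat \<Rightarrow> real \<Rightarrow> complex \<Rightarrow> bool"
  where "tangential_transit q N t0 \<mu> \<longleftrightarrow>
    q \<in> U \<and> t_coord C q = 0 \<and> (f ^^ N) q = chart_inv C (0, t0) \<and> 0 < t0 \<and> t0 \<le> b \<and> \<mu> \<noteq> 0 \<and>
    (\<forall>\<delta>>0. \<exists>d>0. \<forall>w T. cmod w < d \<and> \<bar>T - t0\<bar> < d \<longrightarrow>
       \<bar>return_height N (w, T) - return_height N (0, T) + Re (cnj \<mu> * w)\<bar> \<le> \<delta> * cmod w) \<and>
    (\<exists>d>0. \<forall>T. 0 < \<bar>T - t0\<bar> \<and> \<bar>T - t0\<bar> < d \<longrightarrow> 0 < return_height N (0, T))"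

lemma tangential_transit_estimate:
  assumes tr: "tangential_transit q N t0 \<mu>" and \<delta>: "0 < \<delta>"
  obtains d where "0 < d" "\<And>w T. cmod w < d \<Longrightarrow> \<bar>T - t0\<bar> < d \<Longrightarrow>
       \<bar>return_height N (w, T) - return_height N (0, T) + Re (cnj \<mu> * w)\<bar> \<le> \<delta> * cmod w"
proof -
  have "\<exists>d>0. \<forall>w T. cmod w < d \<and> \<bar>T - t0\<bar> < d \<longrightarrow>
       \<bar>return_height N (w, T) - return_height N (0, T) + Re (cnj \<mu> * w)\<bar> \<le> \<delta> * cmod w"
    using tr[unfolded tangential_transit_def] \<delta> by (elim conjE) (erule allE, erule (1) mp)
  then obtain d where "0 < d" "\<forall>w T. cmod w < d \<and> \<bar>T - t0\<bar> < d \<longrightarrow>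
       \<bar>return_height N (w, T) - return_height N (0, T) + Re (cnj \<mu> * w)\<bar> \<le> \<delta> * cmod w" by (elim exE conjE)
  then show ?thesis by (intro that[of d]) simp_all
qed

lemma tangential_transit_positive:
  assumes tr: "tangential_transit q N t0 \<mu>"
  obtains d where "0 < d" "\<And>T. 0 < \<bar>T - t0\<bar> \<Longrightarrow> \<bar>T - t0\<bar> < d \<Longrightarrow> 0 < return_height N (0, T)"
proof -
  have "\<exists>d>0. \<forall>T. 0 < \<bar>T - t0\<bar> \<and> \<bar>T - t0\<bar> < d \<longrightarrow> 0 < return_height N (0, T)"
    using tr[unfolded tangential_transit_def] by (elim conjE)
  then obtain d where "0 < d" "\<forall>T. 0 < \<bar>T - t0\<bar> \<and> \<bar>T - t0\<bar> < d \<longrightarrow> 0 < return_height N (0, T)"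
    by (elim exE conjE)
  then show ?thesis by (intro that[of d]) simp_all
qed

lemma return_height_base:
  assumes "tangential_transit q N t0 \<mu>"
  shows "return_height N (0, t0) = 0" "(inv f ^^ N) (chart_inv C (0, t0)) = q"
proof -
  have "(f ^^ N) q = chart_inv C (0, t0)" "t_coord C q = 0" using assms by (auto simp: tangential_transit_def)
  then show "(inv f ^^ N) (chart_inv C (0, t0)) = q" "return_height N (0, t0) = 0"
    unfolding return_height_def by (metis inv_iterate(1))+
qed

text \<open>Multiplying by \<open>r ^ n\<close> undoes the expansion but not the rotation of \<open>f ^^ n\<close>.\<close>

lemma multiplier_cancel: "of_real (r ^ n) * w = cnj (cis (real n * \<theta>)) * (rcis r \<theta> ^ n * w)"
proof -
  have "rcis r \<theta> ^ n = of_real (r ^ n) * cis (real n * \<theta>)"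
    by (simp add: rcis_def power_mult_distrib Complex.DeMoivre)
  moreover have "cnj (cis (real n * \<theta>)) * cis (real n * \<theta>) = 1" by (simp add: cis_cnj cis_mult)
  ultimately show ?thesis by (metis mult.assoc mult.commute mult.left_neutral)
qed

text \<open>If an excursion passes \<open>(w, T)\<close>, the height \<open>l ^ m * t\<close> with \<open>t \<approx> t0\<close> at which it left \<open>q\<close> equals
\<open>return_height (w, T) \<ge> - Re (cnj \<mu> * w) - \<delta> \<bar>w\<bar>\<close>. Multiplication by \<open>r ^ n\<close> turns \<open>w\<close> into the
rotated endpoint.\<close>

lemma excursion_necessary:
  assumes tr: "tangential_transit q N t0 \<mu>" and x: "x \<in> D_disk U C b" and \<delta>: "0 < \<delta>"
  shows "\<exists>O1 O2 O3. open O1 \<and> open O2 \<and> open O3 \<and> (f ^^ N) q \<in> O1 \<and> q \<in> O2 \<and> x \<in> O3 \<and>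
    (\<forall>n m. excursion f (U_box U C b) N O1 O2 O3 n m \<longrightarrow>
      - Re (cnj \<mu> * (cnj (cis (real n * \<theta>)) * z_coord C x)) \<le> (1 + \<delta>) * (t0 * r ^ n * l ^ m) + \<delta>)"
proof -
  have q: "q \<in> U" "t_coord C q = 0" and fq: "(f ^^ N) q = chart_inv C (0, t0)" and t0: "0 < t0" "t0 \<le> b"
    using tr by (auto simp: tangential_transit_def)
  have b: "0 < b" using t0 by simp
  have xU: "x \<in> U" using x by (simp add: D_disk_def)
  define \<delta>1 where "\<delta>1 = \<delta> / (2 * (cmod (z_coord C x) + 1))"
  have zx: "0 < cmod (z_coord C x) + 1" by (smt (verit) norm_ge_zero)
  have \<delta>1: "0 < \<delta>1" "\<delta>1 * (cmod (z_coord C x) + 1) = \<delta> / 2" using \<delta> zx by (auto simp: \<delta>1_def field_simps)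
  \<comment> \<open>The error \<open>\<delta>\<close> is split between the expansion of the return height and the endpoint.\<close>
  define d3 where "d3 = min 1 (\<delta> / (2 * (cmod \<mu> + 1)))"
  have zm: "0 < cmod \<mu> + 1" by (smt (verit) norm_ge_zero)
  have d3: "0 < d3" "d3 \<le> 1" using \<delta> zm by (auto simp: d3_def)
  have "(cmod \<mu> + 1) * d3 \<le> (cmod \<mu> + 1) * (\<delta> / (2 * (cmod \<mu> + 1)))"
    using zm by (intro mult_left_mono) (auto simp: d3_def)
  also have "\<dots> = \<delta> / 2" using zm by (simp add: field_simps)
  finally have d3_le: "(cmod \<mu> + 1) * d3 \<le> \<delta> / 2" .
  obtain d1 where d1: "0 < d1" "\<And>w T. cmod w < d1 \<Longrightarrow> \<bar>T - t0\<bar> < d1 \<Longrightarrow>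
       \<bar>return_height N (w, T) - return_height N (0, T) + Re (cnj \<mu> * w)\<bar> \<le> \<delta>1 * cmod w"
    using tangential_transit_estimate[OF tr \<delta>1(1)] by metis
  obtain d2 where d2: "0 < d2" "\<And>T. 0 < \<bar>T - t0\<bar> \<Longrightarrow> \<bar>T - t0\<bar> < d2 \<Longrightarrow> 0 < return_height N (0, T)"
    using tangential_transit_positive[OF tr] by metis
  have pos: "0 \<le> return_height N (0, T)" if "\<bar>T - t0\<bar> < d2" for T
    using d2(2)[of T] that return_height_base(1)[OF tr] by (cases "T = t0") auto
  define O1 where "O1 = {y \<in> fst C. snd C y \<in> UNIV \<times> {..<(1 + \<delta>) * t0}}"
  define Q where "Q = {y \<in> fst C. snd C y \<in> ball 0 d1 \<times> {t0 - min d1 d2<..<t0 + min d1 d2}}"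
  define O2 where "O2 = (f ^^ N) -` Q"
  define O3 where "O3 = {y \<in> fst C. snd C y \<in> ball (z_coord C x) d3 \<times> UNIV}"
  have p0: "chart_inv C (0, t0) \<in> U" "snd C (chart_inv C (0, t0)) = (0, t0)"
    using box_point[of 0 t0] t0 by auto
  have "open O1" "open Q" "open O3"
    unfolding O1_def Q_def O3_def by (intro open_chart_preimage[OF chart] open_Times open_UNIV open_ball open_lessThan open_greaterThanLessThan)+
  moreover have "open O2"
    unfolding O2_def using cont_iterate(1)[of N] \<open>open Q\<close> by (simp add: continuous_on_open_vimage)
  moreover have "(f ^^ N) q \<in> O1" unfolding fq O1_def using p0 U(3) \<delta> t0 by auto
  moreover have "q \<in> O2" unfolding O2_def vimage_def mem_Collect_eq fq Q_def using p0 U(3) d1(1) d2(1) by auto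
  moreover have "x \<in> O3" unfolding O3_def using xU U(3) d3 by (auto simp: mem_Times_iff)
  moreover have "- Re (cnj \<mu> * (cnj (cis (real n * \<theta>)) * z_coord C x)) \<le> (1 + \<delta>) * (t0 * r ^ n * l ^ m) + \<delta>"
    if exc: "excursion f (U_box U C b) N O1 O2 O3 n m" for n m
  proof -
    obtain a where a: "a \<in> O1" "\<And>j. j \<le> m \<Longrightarrow> (f ^^ j) a \<in> U_box U C b" "(f ^^ m) a \<in> O2"
      "\<And>j. j \<le> n \<Longrightarrow> (f ^^ j) ((f ^^ N) ((f ^^ m) a)) \<in> U_box U C b" "(f ^^ n) ((f ^^ N) ((f ^^ m) a)) \<in> O3"
      using exc unfolding excursion_def by blast
    define y where "y = (f ^^ N) ((f ^^ m) a)"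
    define w T where "w = z_coord C y" and "T = t_coord C y"
    have inU: "\<And>j. j \<le> m \<Longrightarrow> (f ^^ j) a \<in> U" "\<And>j. j \<le> n \<Longrightarrow> (f ^^ j) y \<in> U"
      using a(2,4) by (auto simp: U_box_def y_def)
    have ta: "t_coord C ((f ^^ m) a) = l ^ m * t_coord C a"
      using iterate_coord[of a m] inU(1)[of 0] inU(1) U(3) by auto
    have zn: "z_coord C ((f ^^ n) y) = rcis r \<theta> ^ n * w"
      using iterate_coord[of y n] inU(2)[of 0] inU(2) U(3) by (auto simp: w_def)
    have yQ: "y \<in> fst C" "cmod w < d1" "\<bar>T - t0\<bar> < d1" "\<bar>T - t0\<bar> < d2"
      using a(3) unfolding O2_def Q_def y_def[symmetric] w_def T_def by (auto simp: y_def mem_Times_iff)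
    have "chart_inv C (w, T) = y" using chart_facts(6)[OF chart yQ(1)] by (simp add: w_def T_def)
    then have "return_height N (w, T) = t_coord C ((f ^^ m) a)"
      by (simp add: return_height_def y_def)
    then have "- Re (cnj \<mu> * w) \<le> l ^ m * t_coord C a + \<delta>1 * cmod w"
      using d1(2)[OF yQ(2,3)] pos[OF yQ(4)] ta by linarith
    then have "r ^ n * - Re (cnj \<mu> * w) \<le> r ^ n * (l ^ m * t_coord C a + \<delta>1 * cmod w)"
      using params(1) by (intro mult_left_mono) auto
    also have "r ^ n * - Re (cnj \<mu> * w) = - Re (cnj \<mu> * (of_real (r ^ n) * w))"
      unfolding Re_cnj_scale by (rule mult_minus_right)
    finally have 1: "- Re (cnj \<mu> * (cnj (cis (real n * \<theta>)) * (rcis r \<theta> ^ n * w))) \<le> r ^ n * l ^ m * t_coord C a + \<delta>1 * (r ^ n * cmod w)"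
      unfolding multiplier_cancel by (simp add: algebra_simps)
    define X where "X = rcis r \<theta> ^ n * w"
    have X: "dist (z_coord C x) X < d3" using a(5) unfolding O3_def y_def[symmetric] X_def by (auto simp: mem_Times_iff zn)
    have "r ^ n * cmod w = cmod X" by (simp add: X_def norm_mult norm_power) (use params in simp)
    moreover have "cmod X \<le> cmod (z_coord C x) + 1"
      using X d3 norm_triangle_ineq2[of X "z_coord C x"] by (simp add: dist_norm norm_minus_commute)
    ultimately have 2: "\<delta>1 * (r ^ n * cmod w) \<le> \<delta> / 2" using \<delta>1 by (metis mult_left_mono less_imp_le)
    have "\<bar>Re (cnj \<mu> * (cnj (cis (real n * \<theta>)) * (z_coord C x - X)))\<bar> \<le> cmod (cnj \<mu> * (cnj (cis (real n * \<theta>)) * (z_coord C x - X)))"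
      by (rule abs_Re_le_cmod)
    also have "\<dots> = cmod \<mu> * dist (z_coord C x) X" by (simp add: norm_mult dist_norm)
    also have "\<dots> \<le> (cmod \<mu> + 1) * d3" using X by (intro mult_mono) auto
    finally have 3: "\<bar>Re (cnj \<mu> * (cnj (cis (real n * \<theta>)) * (z_coord C x - X)))\<bar> \<le> \<delta> / 2" using d3_le by simp
    have 4: "Re (cnj \<mu> * (cnj (cis (real n * \<theta>)) * (z_coord C x - X))) = 
       Re (cnj \<mu> * (cnj (cis (real n * \<theta>)) * z_coord C x)) - Re (cnj \<mu> * (cnj (cis (real n * \<theta>)) * X))"
      by (simp only: right_diff_distrib minus_complex.sel)
    have "t_coord C a \<le> (1 + \<delta>) * t0" using a(1) by (auto simp: O1_def mem_Times_iff)
    then have "r ^ n * l ^ m * t_coord C a \<le> r ^ n * l ^ m * ((1 + \<delta>) * t0)"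
      using params by (intro mult_left_mono) auto
    also have "\<dots> = (1 + \<delta>) * (t0 * r ^ n * l ^ m)" by (simp add: algebra_simps)
    finally show ?thesis using 1 2 3 4 unfolding X_def[symmetric] by linarith
  qed
  ultimately show ?thesis by blast
qed

text \<open>With \<open>w\<close> prescribed by the endpoint \<open>x\<close>, the return height is at most \<open>l ^ m * t0\<close> for \<open>T = t0\<close> by
the inequality, and larger for a fixed \<open>t1 > t0\<close>, so it equals \<open>l ^ m * t0\<close> for some \<open>T\<close> in between.
The excursion through \<open>(w, T)\<close> is then obtained by going back to height \<open>t0\<close> with the linear map.\<close>

lemma excursion_sufficient:
  assumes tr: "tangential_transit q N t0 \<mu>" and c: "cmod (z_coord C q) < c" "t0 < c" "c \<le> b"
    and x: "x \<in> D_disk U C c" and \<delta>: "0 < \<delta>"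
    and O1: "open O1" "(f ^^ N) q \<in> O1" and O2: "open O2" "q \<in> O2" and O3: "open O3" "x \<in> O3"
  shows "\<exists>M. \<forall>n\<ge>M. \<forall>m\<ge>M.
      - Re (cnj \<mu> * (cnj (cis (real n * \<theta>)) * z_coord C x)) \<le> (1 - \<delta>) * (t0 * r ^ n * l ^ m) - \<delta> \<longrightarrow>
      excursion f (U_box U C c) N O1 O2 O3 n m"
proof -
  have q: "q \<in> U" "t_coord C q = 0" and fq: "(f ^^ N) q = chart_inv C (0, t0)" and t0: "0 < t0" "t0 \<le> b"
    using tr by (auto simp: tangential_transit_def)
  have c0: "0 < c" using c t0 by simp
  have xx: "x \<in> U" "t_coord C x = 0" "cmod (z_coord C x) \<le> c" using x by (auto simp: D_disk_def)
  define \<psi> where "\<psi> = chart_inv C"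
  have op: "open (snd C ` fst C)" and c\<psi>: "continuous_on (snd C ` fst C) \<psi>"
    using chart_facts[OF chart] by (auto simp: \<psi>_def)
  define Y where "Y v = (inv f ^^ N) (\<psi> v)" for v
  have cY: "continuous_on (snd C ` fst C) Y"
    unfolding Y_def by (rule continuous_on_compose2[OF cont_iterate(2) c\<psi>]) auto
  define S where "S = O2 \<inter> U \<inter> {y \<in> fst C. snd C y \<in> ball 0 c \<times> UNIV}"
  have "open S" unfolding S_def by (intro open_Int O2 U open_chart_preimage[OF chart] open_Times open_ball open_UNIV)
  then have "open (snd C ` fst C \<inter> Y -` S)" by (rule continuous_open_preimage[OF cY op])
  moreover have base: "(0, t0) \<in> snd C ` fst C" using box_point(4)[of 0 t0] t0 by simp
  moreover have Y0: "Y (0, t0) = q" using return_height_base(2)[OF tr] by (simp add: Y_def \<psi>_def)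
  moreover have "q \<in> S" using q O2 U(3) c by (auto simp: S_def mem_Times_iff)
  ultimately obtain d0 where d0: "0 < d0" "ball (0, t0) d0 \<subseteq> snd C ` fst C \<inter> Y -` S"
    by (metis IntI openE vimageI)
  have inW: "(w, T) \<in> snd C ` fst C" "Y (w, T) \<in> S" if "cmod w < d0 / 2" "\<bar>T - t0\<bar> < d0 / 2" for w T
  proof -
    have "dist (0, t0) (w, T) \<le> cmod w + \<bar>T - t0\<bar>"
      using norm_Pair_le[of "- w" "t0 - T"] by (simp add: dist_norm abs_minus_commute)
    then have "(w, T) \<in> ball (0, t0) d0" using that by simp
    then show "(w, T) \<in> snd C ` fst C" "Y (w, T) \<in> S" using d0 by blast+
  qed
  define \<delta>1 where "\<delta>1 = \<delta> / (cmod (z_coord C x) + 1)"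
  have zx: "0 < cmod (z_coord C x) + 1" by (smt (verit) norm_ge_zero)
  have \<delta>1: "0 < \<delta>1" "\<delta>1 * cmod (z_coord C x) \<le> \<delta>" using \<delta> zx by (auto simp: \<delta>1_def field_simps)
  obtain d1 where d1: "0 < d1" "\<And>w T. cmod w < d1 \<Longrightarrow> \<bar>T - t0\<bar> < d1 \<Longrightarrow>
       \<bar>return_height N (w, T) - return_height N (0, T) + Re (cnj \<mu> * w)\<bar> \<le> \<delta>1 * cmod w"
    using tangential_transit_estimate[OF tr \<delta>1(1)] by metis
  obtain d2 where d2: "0 < d2" "\<And>T. 0 < \<bar>T - t0\<bar> \<Longrightarrow> \<bar>T - t0\<bar> < d2 \<Longrightarrow> 0 < return_height N (0, T)"
    using tangential_transit_positive[OF tr] by metis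
  define e where "e = min (min (d0 / 2) d1) (min d2 (c - t0)) / 2"
  have e: "0 < e" "e < d0 / 2" "e < d1" "e < d2" "t0 + e \<le> c"
  proof -
    have "0 < min (min (d0 / 2) d1) (min d2 (c - t0))" using d0(1) d1(1) d2(1) c(2) by simp
    moreover have "2 * e = min (min (d0 / 2) d1) (min d2 (c - t0))" by (simp add: e_def)
    ultimately have "0 < 2 * e" "2 * e \<le> d0 / 2" "2 * e \<le> d1" "2 * e \<le> d2" "2 * e \<le> c - t0" by linarith+
    then show "0 < e" "e < d0 / 2" "e < d1" "e < d2" "t0 + e \<le> c" by linarith+
  qed
  \<comment> \<open>the upper end for the intermediate value theorem, where the return height is positive\<close>
  define t1 where "t1 = t0 + e"
  have h1: "0 < return_height N (0, t1)" using d2(2)[of t1] e by (simp add: t1_def)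
  define lam where "lam = rcis r \<theta>"
  define w where "w n = z_coord C x / lam ^ n" for n
  have lam: "lam ^ n \<noteq> 0" for n using params by (simp add: lam_def)
  have lamw: "lam ^ n * w n = z_coord C x" for n using lam by (simp add: w_def)
  have rinv: "(\<lambda>n. K * inverse r ^ n) \<longlonglongrightarrow> K * 0" for K
    by (intro tendsto_intros LIMSEQ_power_zero) (use params in \<open>auto simp: field_simps\<close>)
  have norm_div: "cmod (z / lam ^ n) = cmod z * inverse r ^ n" for z n
    using params by (simp add: lam_def norm_divide norm_power field_simps power_inverse)
  have ll: "(\<lambda>n. K * l ^ n) \<longlonglongrightarrow> K * 0" for K
    by (intro tendsto_intros LIMSEQ_power_zero) (use params in auto)
  have ev_w: "\<forall>\<^sub>F n in sequentially. cmod (w n) < s" if "0 < s" for s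
    unfolding w_def norm_div using order_tendstoD(2)[OF rinv, of "cmod (z_coord C x)" s] that by simp
  have ev_l: "\<forall>\<^sub>F n in sequentially. K * l ^ n < s" if "0 < s" for K s
    using order_tendstoD(2)[OF ll, of K s] that by simp
  have "\<exists>d>0. \<forall>v. dist v (0, t0) < d \<longrightarrow> \<psi> v \<in> O1"
  proof -
    have "open (snd C ` fst C \<inter> \<psi> -` O1)" by (rule continuous_open_preimage[OF c\<psi> op O1(1)])
    moreover have "(0, t0) \<in> snd C ` fst C \<inter> \<psi> -` O1" using base O1(2) fq by (simp add: \<psi>_def)
    ultimately show ?thesis unfolding open_dist by blast
  qed
  then obtain s1 where s1: "0 < s1" "\<And>v. dist v (0, t0) < s1 \<Longrightarrow> \<psi> v \<in> O1" by blast
  have "\<exists>d>0. \<forall>v. dist v (z_coord C x, 0) < d \<longrightarrow> \<psi> v \<in> O3"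
  proof -
    have "open (snd C ` fst C \<inter> \<psi> -` O3)" by (rule continuous_open_preimage[OF c\<psi> op O3(1)])
    moreover have "snd C x = (z_coord C x, 0)" using xx by (simp add: prod_eq_iff)
    then have "(z_coord C x, 0) \<in> snd C ` fst C \<inter> \<psi> -` O3"
      using O3(2) chart_facts(6)[OF chart, of x] xx U(3) by (auto simp: \<psi>_def image_iff intro: bexI[of _ x])
    ultimately show ?thesis unfolding open_dist by blast
  qed
  then obtain s3 where s3: "0 < s3" "\<And>v. dist v (z_coord C x, 0) < s3 \<Longrightarrow> \<psi> v \<in> O3" by blast
  have "\<forall>\<^sub>F n in sequentially. cmod (w n) < e \<and> cmod (w n) < return_height N (0, t1) / (2 * (cmod \<mu> + \<delta>1 + 1)) \<and>
      c * inverse r ^ n < s1 \<and> c * l ^ n < s3 \<and> t0 * l ^ n < return_height N (0, t1) / 2"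
  proof (intro eventually_conj ev_w ev_l e(1))
    show "0 < return_height N (0, t1) / (2 * (cmod \<mu> + \<delta>1 + 1))"
    proof (rule divide_pos_pos[OF h1])
      show "0 < 2 * (cmod \<mu> + \<delta>1 + 1)" using \<delta>1(1) norm_ge_zero[of \<mu>] by argo
    qed
    show "\<forall>\<^sub>F n in sequentially. c * inverse r ^ n < s1"
      using order_tendstoD(2)[OF rinv, of c s1] s1(1) by simp
  qed (use s3 h1 in auto)
  then obtain M where M: "\<And>n. n \<ge> M \<Longrightarrow> cmod (w n) < e" 
      "\<And>n. n \<ge> M \<Longrightarrow> cmod (w n) < return_height N (0, t1) / (2 * (cmod \<mu> + \<delta>1 + 1))"
      "\<And>n. n \<ge> M \<Longrightarrow> c * inverse r ^ n < s1" "\<And>n. n \<ge> M \<Longrightarrow> c * l ^ n < s3" 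
      "\<And>n. n \<ge> M \<Longrightarrow> t0 * l ^ n < return_height N (0, t1) / 2"
    unfolding eventually_sequentially by blast
  have "excursion f (U_box U C c) N O1 O2 O3 n m"
    if nm: "M \<le> n" "M \<le> m" and le: "- Re (cnj \<mu> * (cnj (cis (real n * \<theta>)) * z_coord C x)) \<le> (1 - \<delta>) * (t0 * r ^ n * l ^ m) - \<delta>" for n m
  proof -
    have we: "cmod (w n) < d0 / 2" "cmod (w n) < d1" using M(1)[OF nm(1)] e by auto
    have rn: "0 < r ^ n" using params by simp
    have rw: "r ^ n * cmod (w n) = cmod (z_coord C x)"
      using arg_cong[OF lamw[of n], of cmod] by (simp add: norm_mult lam_def)
    have up: "return_height N (w n, t0) \<le> l ^ m * t0"
    proof -
      have "r ^ n * - Re (cnj \<mu> * w n) = - Re (cnj \<mu> * (of_real (r ^ n) * w n))"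
        unfolding Re_cnj_scale by (rule mult_minus_right)
      also have "\<dots> = - Re (cnj \<mu> * (cnj (cis (real n * \<theta>)) * z_coord C x))"
        unfolding multiplier_cancel lam_def[symmetric] lamw ..
      also have "\<dots> \<le> (1 - \<delta>) * (t0 * r ^ n * l ^ m) - \<delta>" by (rule le)
      also have "\<dots> \<le> 1 * (t0 * r ^ n * l ^ m) - \<delta>1 * cmod (z_coord C x)"
        using \<delta> \<delta>1(2) t0 params by (intro diff_mono mult_right_mono) auto
      also have "\<dots> = r ^ n * (l ^ m * t0 - \<delta>1 * cmod (w n))" by (simp add: rw[symmetric] algebra_simps)
      finally have "- Re (cnj \<mu> * w n) \<le> l ^ m * t0 - \<delta>1 * cmod (w n)"
        using rn by (simp only: mult_le_cancel_left_pos)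
      then show ?thesis using d1(2)[OF we(2), of t0] d1(1) return_height_base(1)[OF tr] by simp
    qed
    have down: "l ^ m * t0 \<le> return_height N (w n, t1)"
    proof -
      have "\<bar>t1 - t0\<bar> < d1" using e by (simp add: t1_def)
      from d1(2)[OF we(2) this] have "return_height N (0, t1) - Re (cnj \<mu> * w n) - \<delta>1 * cmod (w n) \<le> return_height N (w n, t1)"
        by linarith
      moreover have "Re (cnj \<mu> * w n) \<le> cmod \<mu> * cmod (w n)" using complex_Re_le_cmod[of "cnj \<mu> * w n"] by (simp add: norm_mult)
      moreover have "(cmod \<mu> + \<delta>1) * cmod (w n) \<le> return_height N (0, t1) / 2"
      proof -
        have k: "0 < cmod \<mu> + \<delta>1 + 1" using \<delta>1(1) norm_ge_zero[of \<mu>] by linarith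
        have "(cmod \<mu> + \<delta>1) * cmod (w n) \<le> (cmod \<mu> + \<delta>1 + 1) * cmod (w n)" by (intro mult_right_mono) auto
        also have "\<dots> \<le> return_height N (0, t1) / 2" using M(2)[OF nm(1)] k by (simp add: field_simps)
        finally show ?thesis .
      qed
      moreover have "(cmod \<mu> + \<delta>1) * cmod (w n) = cmod \<mu> * cmod (w n) + \<delta>1 * cmod (w n)" by (rule distrib_right)
      moreover have "l ^ m * t0 \<le> return_height N (0, t1) / 2" using M(5)[OF nm(2)] by (simp add: mult.commute)
      ultimately show ?thesis by linarith
    qed
    have "continuous_on {t0..t1} (\<lambda>T. return_height N (w n, T))"
    proof -
      have "continuous_on {t0..t1} (\<lambda>T. Y (w n, T))"
        by (rule continuous_on_compose2[OF cY]) (use inW(1) we(1) e in \<open>auto intro!: continuous_intros simp: t1_def\<close>)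
      moreover have "(\<lambda>T. Y (w n, T)) ` {t0..t1} \<subseteq> fst C"
        using inW(2) we(1) e by (fastforce simp: t1_def S_def)
      ultimately have "continuous_on {t0..t1} (\<lambda>T. snd C (Y (w n, T)))"
        by (intro continuous_on_compose2[OF chart_facts(3)[OF chart]])
      then show ?thesis unfolding return_height_def Y_def \<psi>_def by (intro continuous_intros)
    qed
    with up down have "\<exists>T. t0 \<le> T \<and> T \<le> t1 \<and> return_height N (w n, T) = l ^ m * t0"
      using e(1) by (intro IVT') (auto simp: t1_def)
    then obtain T where T: "t0 \<le> T" "T \<le> t1" "return_height N (w n, T) = l ^ m * t0" by blast
    define y where "y = Y (w n, T)"
    have yS: "y \<in> S" "(w n, T) \<in> snd C ` fst C" using inW[OF we(1), of T] T e by (auto simp: y_def t1_def)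
    then have y: "y \<in> O2" "y \<in> U" "cmod (z_coord C y) < c" by (auto simp: S_def mem_Times_iff)
    have ty: "t_coord C y = l ^ m * t0" using T(3) by (simp add: return_height_def y_def Y_def \<psi>_def)
    have fy: "(f ^^ N) y = \<psi> (w n, T)" by (simp add: y_def Y_def)
    define a where "a = chart_inv C (z_coord C y / lam ^ m, t0)"
    have la: "lam ^ m * (z_coord C y / lam ^ m) = z_coord C y" using lam by simp
    have a_box: "(f ^^ j) a = chart_inv C (lam ^ j * (z_coord C y / lam ^ m), l ^ j * t0)" 
       "(f ^^ j) a \<in> U_box U C c" if "j \<le> m" for j
      using iterate_box[of m "z_coord C y / lam ^ m" c t0 j] y(3) t0 c that la unfolding a_def lam_def by auto
    have fa: "(f ^^ m) a = y"
    proof -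
      have "(f ^^ m) a = chart_inv C (z_coord C y, l ^ m * t0)" using a_box(1)[of m] la by simp
      also have "\<dots> = chart_inv C (snd C y)" by (simp add: ty[symmetric])
      also have "\<dots> = y" using chart_facts(6)[OF chart] y(2) U(3) by blast
      finally show ?thesis .
    qed
    have aO1: "a \<in> O1"
    proof -
      have "cmod (z_coord C y / lam ^ m) \<le> c * inverse r ^ m"
        unfolding norm_div using y(3) params by (intro mult_right_mono) auto
      also have "\<dots> < s1" by (rule M(3)[OF nm(2)])
      finally show ?thesis unfolding a_def \<psi>_def[symmetric] by (intro s1(2)) (simp add: dist_Pair_Pair dist_norm)
    qed
    have Tc: "0 \<le> T" "T \<le> c" using T t0 e by (auto simp: t1_def)
    have b_box: "(f ^^ j) (\<psi> (w n, T)) = chart_inv C (lam ^ j * w n, l ^ j * T)"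
       "(f ^^ j) (\<psi> (w n, T)) \<in> U_box U C c" if "j \<le> n" for j
      using iterate_box[of n "w n" c T j] Tc c that xx(3) lamw[of n] unfolding lam_def \<psi>_def by auto
    have "(f ^^ n) (\<psi> (w n, T)) \<in> O3"
    proof -
      have "l ^ n * T \<le> c * l ^ n" using Tc params by (simp add: mult.commute mult_left_mono)
      also have "\<dots> < s3" by (rule M(4)[OF nm(1)])
      finally have "\<bar>l ^ n * T\<bar> < s3" using Tc params by simp
      then have "\<psi> (z_coord C x, l ^ n * T) \<in> O3" by (intro s3(2)) (simp add: dist_Pair_Pair dist_norm)
      then show ?thesis using b_box(1)[of n] lamw[of n] by (simp add: \<psi>_def)
    qed
    then show ?thesis unfolding excursion_def
      using aO1 a_box(2) y(1) b_box(2) by (intro bexI[of _ a]) (auto simp: fa fy)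
  qed
  then show ?thesis by blast
qed

end


section \<open>Linearization and positive association\<close>

text \<open>The rotation formula gives the coordinate \<open>z\<close> of the image of an unstable point. That the image
stays in the plane \<open>t = 0\<close> is known for the preimages of a small disk; linearity extends both facts
to the whole plane.\<close>

lemma unstable_linear_part:
  fixes f :: "'m::{t2_space,second_countable_topology} \<Rightarrow> 'm"
  assumes f: "bij f" and L: "linear L" and r: "1 < r" and box: "box_in_chart U C b"
    and LU: "\<And>x. x \<in> U \<Longrightarrow> snd C (f x) = L (snd C x)"
    and Wu: "\<And>x. x \<in> U \<Longrightarrow> t_coord C x = 0 \<longleftrightarrow> x \<in> local_unstable f p U"
    and rot: "\<And>x. x \<in> local_unstable f p U \<Longrightarrow> z_coord C (f x) = rcis r \<theta> * z_coord C x"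
  shows "L (z, 0) = (rcis r \<theta> * z, 0)"
proof -
  define lam where "lam = rcis r \<theta>"
  have lam: "lam \<noteq> 0" "cmod lam = r" using r by (auto simp: lam_def)
  have b: "0 < b" using box by (simp add: box_in_chart_def)
  have small: "L (w, 0) = (lam * w, 0)" if w: "cmod (lam * w) \<le> b" for w
  proof -
    have "(lam * w, 0) \<in> cball 0 b \<times> {0..b}" using w b by simp
    then obtain x where x: "x \<in> U" "snd C x = (lam * w, 0)" using box unfolding box_in_chart_def by (metis imageE subsetD)
    then have "x \<in> local_unstable f p U" using Wu[OF x(1)] by simp
    then have y: "inv f x \<in> local_unstable f p U" using local_unstable_backward[of x f p U 1] by simp
    have yU: "inv f x \<in> U" using y by (auto simp: local_unstable_def dest: spec[of _ 0])
    have fy: "f (inv f x) = x" using f by (simp add: bij_is_surj surj_f_inv_f)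
    have "lam * w = lam * z_coord C (inv f x)" using rot[OF y] x(2) fy by (simp add: lam_def)
    then have "z_coord C (inv f x) = w" using lam by simp
    moreover have "t_coord C (inv f x) = 0" using Wu[OF yU] y by simp
    ultimately have "snd C (inv f x) = (w, 0)" by (simp add: prod_eq_iff)
    then show ?thesis using LU[OF yU] fy x(2) by simp
  qed
  define D where "D = r * (cmod z + 1)"
  define s where "s = b / D"
  have den: "0 < D" unfolding D_def using r norm_ge_zero[of z] by (intro mult_pos_pos) linarith+
  have s: "0 < s" using b den by (simp add: s_def)
  have "cmod (lam * (of_real s * z)) = s * (r * cmod z)" using s lam by (simp add: norm_mult)
  also have "\<dots> \<le> s * (r * (cmod z + 1))" using s r by (intro mult_left_mono) auto
  also have "\<dots> = b" unfolding D_def[symmetric] using den by (simp add: s_def)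
  finally have "L (of_real s * z, 0) = (lam * (of_real s * z), 0)" by (rule small)
  moreover have "L (of_real s * z, 0) = s *\<^sub>R L (z, 0)"
    using linear_scale[OF L, of s "(z, 0)"] by (simp add: scaleR_conv_of_real)
  ultimately have "s *\<^sub>R L (z, 0) = s *\<^sub>R (lam * z, 0)" by (simp add: scaleR_conv_of_real)
  then have "L (z, 0) = (lam * z, 0)" using s unfolding scaleR_cancel_left by auto
  then show ?thesis by (simp only: lam_def)
qed

text \<open>The eigenvalue condition refers to some chart of the atlas. Since \<open>f\<close> fixes \<open>p\<close>, the derivative of
the change of coordinates conjugates the derivative of \<open>f\<close> in that chart to \<open>L\<close>.\<close>

lemma eigenvector_in_coordinate:
  fixes A :: "'m::{t2_space,second_countable_topology} chart set"
  assumes A: "ck_3_manifold k A" and k: "1 \<le> k" and f: "ck_map k A f" and fp: "f p = p"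
    and C: "local_coordinate k A C" and U: "open U" "p \<in> U" "U \<subseteq> fst C" and fU: "f ` U \<subseteq> fst C"
    and L: "linear L" "\<And>x. x \<in> U \<Longrightarrow> snd C (f x) = L (snd C x)"
    and ev: "derivative_eigenvalue A f p (of_real l)"
  obtains u where "u \<noteq> 0" "L u = l *\<^sub>R u"
proof -
  obtain C0 where C0: "C0 \<in> A" "p \<in> fst C0"
    and ce: "complex_eigenvalue (frechet_derivative (snd C0 \<circ> f \<circ> chart_inv C0) (at (snd C0 p))) (of_real l)"
    using ev unfolding derivative_eigenvalue_def by (elim bexE conjE)
  from ce obtain v w where "v \<noteq> 0 \<or> w \<noteq> 0"
    "frechet_derivative (snd C0 \<circ> f \<circ> chart_inv C0) (at (snd C0 p)) v = Re (of_real l) *\<^sub>R v - Im (of_real l) *\<^sub>R w"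
    "frechet_derivative (snd C0 \<circ> f \<circ> chart_inv C0) (at (snd C0 p)) w = Im (of_real l) *\<^sub>R v + Re (of_real l) *\<^sub>R w"
    unfolding complex_eigenvalue_def by (elim exE conjE)
  then have vw: "v \<noteq> 0 \<or> w \<noteq> 0"
    "frechet_derivative (snd C0 \<circ> f \<circ> chart_inv C0) (at (snd C0 p)) v = l *\<^sub>R v"
    "frechet_derivative (snd C0 \<circ> f \<circ> chart_inv C0) (at (snd C0 p)) w = l *\<^sub>R w"
    by simp_all
  have ch: "is_chart C" "is_chart C0" using C C0 A by (auto simp: local_coordinate_def ck_3_manifold_def)
  have cf: "continuous_on UNIV f" using f by (simp add: ck_map_def)
  define F where "F = snd C0 \<circ> f \<circ> chart_inv C0"
  obtain F' where F': "strict_derivative F F' (snd C0 p)"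
    using ck_map_strictly_differentiable[OF A k f C0(1) C0(1) C0(2)] C0(2) fp
    unfolding strictly_differentiable_at_def F_def by auto
  have hF: "(F has_derivative F') (at (snd C0 p))" using F' by (rule strict_derivative_imp_has_derivative)
  have "ck_compatible k C C0" using C C0 by (auto simp: local_coordinate_def)
  from transition_strictly_differentiable[OF this ch k, of p] U C0
  obtain K K' where K: "strict_derivative (snd C0 \<circ> id \<circ> chart_inv C) K (snd C p)"
    and K': "strict_derivative (snd C \<circ> id \<circ> chart_inv C0) K' (snd C0 p)"
    unfolding strictly_differentiable_at_def by auto
  have hK: "((snd C0 \<circ> id \<circ> chart_inv C) has_derivative K) (at (snd C p))"
    and hK': "((snd C \<circ> id \<circ> chart_inv C0) has_derivative K') (at (snd C0 p))"
    using K K' by (auto intro: strict_derivative_imp_has_derivative)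
  have returns: "(snd C \<circ> id \<circ> chart_inv C0) (snd C0 p) = snd C p" "F (snd C0 p) = snd C0 p"
    using chart_facts(6)[OF ch(2) C0(2)] fp by (auto simp: F_def)
  define S where "S = snd C0 ` (fst C0 \<inter> (U \<inter> f -` fst C0))"
  have "open (U \<inter> f -` fst C0)"
    using U(1) cf chart_facts(1)[OF ch(2)] by (intro open_Int) (auto simp: continuous_on_open_vimage)
  then have S: "open S" "snd C0 p \<in> S"
    using open_chart_image[OF ch(2)] C0 U fp by (auto simp: S_def)
  have Sx: "\<exists>x. x \<in> fst C0 \<and> x \<in> U \<and> f x \<in> fst C0 \<and> y = snd C0 x" if "y \<in> S" for y using that by (auto simp: S_def)
  have "((snd C \<circ> id \<circ> chart_inv C0) \<circ> F has_derivative K' \<circ> F') (at (snd C0 p))"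
    using diff_chain_at[OF hF] hK' returns by simp
  moreover have "(L \<circ> (snd C \<circ> id \<circ> chart_inv C0) has_derivative L \<circ> K') (at (snd C0 p))"
    by (rule diff_chain_at[OF hK']) (rule linear_imp_has_derivative[OF L(1)])
  then have "((snd C \<circ> id \<circ> chart_inv C0) \<circ> F has_derivative L \<circ> K') (at (snd C0 p))"
  proof (rule has_derivative_transform_within_open[OF _ S])
    fix y assume "y \<in> S"
    then obtain x where x: "x \<in> fst C0" "x \<in> U" "f x \<in> fst C0" "y = snd C0 x" using Sx by blast
    then show "(L \<circ> (snd C \<circ> id \<circ> chart_inv C0)) y = ((snd C \<circ> id \<circ> chart_inv C0) \<circ> F) y"
      using chart_facts(6)[OF ch(2)] L(2)[OF x(2)] by (simp add: F_def)
  qed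
  ultimately have comm: "K' \<circ> F' = L \<circ> K'" by (rule has_derivative_unique)
  have "((snd C0 \<circ> id \<circ> chart_inv C) \<circ> (snd C \<circ> id \<circ> chart_inv C0) has_derivative K \<circ> K') (at (snd C0 p))"
    using diff_chain_at[OF hK'] hK returns by simp
  then have "((\<lambda>y. y) has_derivative K \<circ> K') (at (snd C0 p))"
  proof (rule has_derivative_transform_within_open[OF _ S])
    fix y assume "y \<in> S"
    then obtain x where x: "x \<in> fst C0" "x \<in> U" "f x \<in> fst C0" "y = snd C0 x" using Sx by blast
    then show "((snd C0 \<circ> id \<circ> chart_inv C) \<circ> (snd C \<circ> id \<circ> chart_inv C0)) y = y"
      using chart_facts(6)[OF ch(2)] chart_facts(6)[OF ch(1), of x] U(3) by auto
  qed
  then have KK: "K \<circ> K' = (\<lambda>h. h)" by (rule has_derivative_unique) (rule has_derivative_ident)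
  have lK: "linear K" "linear K'" using hK hK' by (auto dest: has_derivative_linear)
  have F'eq: "frechet_derivative (snd C0 \<circ> f \<circ> chart_inv C0) (at (snd C0 p)) = F'"
    using frechet_derivative_at[OF hF] by (simp add: F_def)
  have "\<exists>u. u \<noteq> 0 \<and> L u = l *\<^sub>R u" if "h \<noteq> 0" "F' h = l *\<^sub>R h" for h
  proof (intro exI[of _ "K' h"] conjI)
    show "K' h \<noteq> 0"
    proof
      assume "K' h = 0"
      then have "K (K' h) = 0" using linear_0[OF lK(1)] by simp
      then show False using fun_cong[OF KK, of h] that by simp
    qed
    show "L (K' h) = l *\<^sub>R K' h" using fun_cong[OF comm, of h] that linear_scale[OF lK(2)] by simp
  qed
  then show ?thesis using vw that unfolding F'eq by blast
qed

text \<open>The linear map is known on the plane \<open>t = 0\<close>. An eigenvector for \<open>l\<close> cannot lie in this plane, so \<open>L\<close>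
maps \<open>(0, 1)\<close> to some \<open>(w0, l)\<close>. The orbit of the tangency enters the local stable manifold,
which is part of the axis, at a point other than \<open>p\<close>; hence the axis is invariant and \<open>w0 = 0\<close>.\<close>

lemma saddle_chart_of_tangency:
  fixes A :: "'m::{t2_space,second_countable_topology} chart set"
  assumes k: "3 \<le> k" and A: "ck_3_manifold k A"
    and sf: "saddle_focus_with_tangency k A f p q r \<theta> l U C" and box: "box_in_chart U C b"
  shows "saddle_chart f p U C r \<theta> l b"
proof -
  have k1: "1 \<le> k" using k by (rule order_trans[rotated]) (simp add: one_enat_def numeral_eq_enat)
  have Diff: "f \<in> Diff k A" and fp: "f p = p" and ev: "derivative_eigenvalue A f p (of_real l)"
    and par: "1 < r" "0 < l" "l < 1" and lin: "linearizing_coordinate k A f p U r \<theta> C"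
    and q: "q \<in> stable_manifold f p" "q \<noteq> p"
    using sf by (auto simp: saddle_focus_with_tangency_def hyperbolic_fixed_point_def homoclinic_quadratic_tangency_def)
  have bij: "bij f" and ck: "ck_map k A f" and cont: "continuous_on UNIV f" "continuous_on UNIV (inv f)"
    using Diff by (auto simp: Diff_def ck_map_def)
  obtain L where C: "local_coordinate k A C" and origin: "snd C p = 0"
    and U: "open U" "p \<in> U" "U \<subseteq> fst C" and fU: "f ` U \<subseteq> fst C"
    and L: "linear L" "\<And>x. x \<in> U \<Longrightarrow> snd C (f x) = L (snd C x)"
    using lin unfolding linearizing_coordinate_def linear_on_nbhd_def by blast
  have Wu: "t_coord C x = 0 \<longleftrightarrow> x \<in> local_unstable f p U" if "x \<in> U" for x
    using lin that unfolding linearizing_coordinate_def by blast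
  have Ws: "z_coord C x = 0" if "x \<in> local_stable f p U" for x
    using lin that unfolding linearizing_coordinate_def by blast
  have rot: "z_coord C (f x) = rcis r \<theta> * z_coord C x" if "x \<in> local_unstable f p U" for x
    using lin that unfolding linearizing_coordinate_def by blast
  have ch: "is_chart C" using C by (simp add: local_coordinate_def)
  have Lz: "L (z, 0) = (rcis r \<theta> * z, 0)" for z
    by (rule unstable_linear_part[OF bij L(1) par(1) box L(2) Wu rot])
  obtain u where u: "u \<noteq> 0" "L u = l *\<^sub>R u"
    using eigenvector_in_coordinate[OF A k1 ck fp C U fU L ev] by blast
  define w0 where "w0 = fst (L (0, 1))"
  define be where "be = snd (L (0, 1))"
  have Lzt: "L (z, t) = (rcis r \<theta> * z + of_real t * w0, t * be)" for z t
  proof -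
    have "L (z, t) = L ((z, 0) + t *\<^sub>R (0, 1))" by simp
    also have "\<dots> = L (z, 0) + t *\<^sub>R L (0, 1)" by (simp only: linear_add[OF L(1)] linear_scale[OF L(1)])
    finally show ?thesis by (simp add: Lz w0_def be_def prod_eq_iff scaleR_conv_of_real)
  qed
  obtain zu tu where uz: "u = (zu, tu)" by (cases u)
  have tu: "tu \<noteq> 0"
  proof
    assume "tu = 0"
    then have "rcis r \<theta> * zu = of_real l * zu" using u(2) by (simp add: uz Lz scaleR_conv_of_real)
    then have "cmod (rcis r \<theta>) * cmod zu = cmod (of_real l) * cmod zu" by (metis norm_mult)
    then have "r * cmod zu = l * cmod zu" using par by simp
    then have "zu = 0" using par by simp
    then show False using u(1) uz \<open>tu = 0\<close> by (simp add: zero_prod_def)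
  qed
  have be: "be = l" using u(2) tu by (simp add: uz Lzt)
  have w0: "w0 = 0"
  proof -
    have lim: "(\<lambda>n. (f ^^ n) q) \<longlonglongrightarrow> p" using q by (simp add: stable_manifold_def)
    then have "\<forall>\<^sub>F n in sequentially. (f ^^ n) q \<in> U" using U(1,2) by (rule topological_tendstoD)
    then obtain n0 where n0: "\<And>n. n \<ge> n0 \<Longrightarrow> (f ^^ n) q \<in> U" unfolding eventually_sequentially by blast
    have inWs: "(f ^^ n) q \<in> local_stable f p U" if "n \<ge> n0" for n
    proof -
      have *: "(f ^^ i) ((f ^^ n) q) = (f ^^ (i + n)) q" for i by (simp add: funpow_add)
      show ?thesis unfolding local_stable_def stable_manifold_def mem_Collect_eq *
        using LIMSEQ_ignore_initial_segment[OF lim, of n] n0 that by simp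
    qed
    define x where "x = (f ^^ n0) q"
    have x: "x \<in> U" "z_coord C x = 0" "z_coord C (f x) = 0"
      using n0[of n0] Ws[OF inWs[of n0]] Ws[OF inWs[of "Suc n0"]] by (auto simp: x_def)
    have "x \<noteq> p"
    proof
      assume "x = p"
      moreover have "(f ^^ n0) p = p" by (induction n0) (use fp in auto)
      ultimately have "(f ^^ n0) q = (f ^^ n0) p" by (simp add: x_def)
      moreover have "inj (f ^^ n0)" by (rule bij_is_inj[OF bij_betw_funpow[OF bij]])
      ultimately show False using q(2) by (simp add: inj_eq)
    qed
    then have "snd C x \<noteq> snd C p" using chart_facts(5)[OF ch] x(1) U by (auto dest: inj_onD)
    then have "t_coord C x \<noteq> 0" using x(2) origin by (auto simp: prod_eq_iff)
    moreover have "snd C x = (0, t_coord C x)" using x(2) by (simp add: prod_eq_iff)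
    then have "z_coord C (f x) = of_real (t_coord C x) * w0" using L(2)[OF x(1)] Lzt[of 0 "t_coord C x"] by simp
    ultimately show ?thesis using x(3) by simp
  qed
  show ?thesis
  proof unfold_locales
    show "f x \<in> fst C \<and> snd C (f x) = (rcis r \<theta> * z_coord C x, l * t_coord C x)" if "x \<in> U" for x
      using that fU L(2)[OF that] Lzt[of "z_coord C x" "t_coord C x"] by (auto simp: be w0)
  qed (use bij cont fp ch U origin par box Wu Ws in auto)
qed

text \<open>The condition on a single iterate in \<open>positively_associated\<close>.\<close>

definition positively_associated_at ::
  "('m::topological_space \<Rightarrow> 'm) \<Rightarrow> 'm \<Rightarrow> 'm set \<Rightarrow> 'm \<Rightarrow> nat \<Rightarrow> bool"
  where "positively_associated_at f p U q n \<longleftrightarrow> (\<exists>N. openin (stable_topology f p U) N \<and> q \<in> N \<and>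
      (\<forall>\<alpha>\<subseteq>N. connectedin (stable_topology f p U) \<alpha> \<and> q \<in> \<alpha> \<longrightarrow>
        (\<exists>K \<in> components (U - local_unstable f p U).
          (f ^^ n) q \<in> K \<and> (inv f ^^ n) ` (\<alpha> - {q}) \<subseteq> K)))"

context saddle_chart
begin

lemma chart_inv_origin: "chart_inv C (0, 0) = p"
  using chart_facts(6)[OF chart, of p] U origin by (auto simp: zero_prod_def)

lemma b_pos: "0 < b" using box by (simp add: box_in_chart_def)

lemma box_domain: "cball 0 b \<times> {0..b} \<subseteq> snd C ` fst C" 
  using box image_mono[OF U(3), of "snd C"] unfolding box_in_chart_def by (meson subset_trans)

lemma axis_in_local_stable:
  assumes "0 \<le> t" "t \<le> b" shows "chart_inv C (0, t) \<in> local_stable f p U"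
proof -
  have it: "(f ^^ j) (chart_inv C (0, t)) = chart_inv C (0, l ^ j * t)" "(f ^^ j) (chart_inv C (0, t)) \<in> U" for j
    using iterate_box[of j 0 b t j] assms b_pos by (auto simp: U_box_def)
  have "(\<lambda>j. (0::complex, l ^ j * t)) \<longlonglongrightarrow> (0, 0 * t)"
    by (intro tendsto_intros LIMSEQ_power_zero) (use params in auto)
  then have lim: "(\<lambda>j. (0::complex, l ^ j * t)) \<longlonglongrightarrow> (0, 0)" by simp
  have "(0, 0) \<in> snd C ` fst C" using b_pos by (intro subsetD[OF box_domain]) simp
  then have "isCont (chart_inv C) (0, 0)"
    using chart_facts(4)[OF chart] unfolding continuous_on_eq_continuous_at[OF chart_facts(2)[OF chart]] by blast
  from isCont_tendsto_compose[OF this lim] have "(\<lambda>j. (f ^^ j) (chart_inv C (0, t))) \<longlonglongrightarrow> p"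
    unfolding it(1) chart_inv_origin .
  then show ?thesis using it(2) by (simp add: local_stable_def stable_manifold_def)
qed

text \<open>The topology of the stable manifold is finer than the induced one, but each embedded piece maps
continuously into it, and the axis lies in the local stable manifold.\<close>

lemma axis_curve_continuous:
  assumes "I \<subseteq> {0<..<b}"
  shows "continuous_map (top_of_set I) (stable_topology f p U) (\<lambda>t. (inv f ^^ N) (chart_inv C (0, t)))"
proof -
  define P where "P t = (inv f ^^ N) (chart_inv C (0, t))" for t
  define W where "W n = (inv f ^^ n) ` local_stable f p U" for n
  have PW: "P \<in> I \<rightarrow> W N" using axis_in_local_stable assms by (force simp: P_def W_def)
  have cP: "continuous_on I P"
  proof -
    have "continuous_on I (\<lambda>t. chart_inv C (0, t))"
      by (rule continuous_on_compose2[OF chart_facts(4)[OF chart]])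
        (use box_domain assms in \<open>auto intro!: continuous_intros subsetD[OF box_domain]\<close>)
    then show ?thesis unfolding P_def by (intro continuous_on_compose2[OF cont_iterate(2)]) auto
  qed
  have "continuous_map (top_of_set I) (limit_topology W) P"
    unfolding continuous_map
  proof (intro conjI allI impI)
    have "topspace (limit_topology W) = (\<Union>n. W n)"
      unfolding topspace_def openin_limit_topology
      by (auto intro!: exI[of _ "\<Union>n. W n"] simp: Int_absorb1 UN_upper openin_subtopology_self)
    then show "P ` topspace (top_of_set I) \<subseteq> topspace (limit_topology W)" using PW by auto
    fix S assume "openin (limit_topology W) S"
    then have "openin (top_of_set (W N)) (S \<inter> W N)" by (simp add: openin_limit_topology)
    then have "openin (top_of_set I) (I \<inter> P -` (S \<inter> W N))" by (rule continuous_openin_preimage[OF cP PW])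
    moreover have "I \<inter> P -` (S \<inter> W N) = {x \<in> topspace (top_of_set I). P x \<in> S}" using PW by auto
    ultimately show "openin (top_of_set I) {x \<in> topspace (top_of_set I). P x \<in> S}" by simp
  qed
  then show ?thesis by (simp add: stable_topology_def W_def[abs_def] P_def[abs_def])
qed

text \<open>The axis near \<open>t0\<close> is pulled back to a small curve in the stable manifold through \<open>q\<close>. By positive
association the further preimages of this curve lie, apart from the one of \<open>q\<close>, in the same
component as \<open>f ^^ n\<close> of \<open>q\<close>. This component does not meet \<open>t = 0\<close>, and it contains a point of
positive height.\<close>

lemma return_height_positive:
  assumes pa: "positively_associated_at f p U q n" and fq: "(f ^^ N) q = chart_inv C (0, t0)"
    and t0: "0 < t0" "t0 < b" and Nn: "N \<le> n"
  shows "\<exists>d>0. \<forall>T. 0 < \<bar>T - t0\<bar> \<and> \<bar>T - t0\<bar> < d \<longrightarrow> 0 < return_height (n + N) (0, T)"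
proof -
  define P where "P t = (inv f ^^ N) (chart_inv C (0, t))" for t
  obtain Q where Q: "openin (stable_topology f p U) Q" "q \<in> Q"
    and \<alpha>: "\<And>\<alpha>. \<alpha> \<subseteq> Q \<Longrightarrow> connectedin (stable_topology f p U) \<alpha> \<Longrightarrow> q \<in> \<alpha> \<Longrightarrow>
        \<exists>K \<in> components (U - local_unstable f p U). (f ^^ n) q \<in> K \<and> (inv f ^^ n) ` (\<alpha> - {q}) \<subseteq> K"
    using pa unfolding positively_associated_at_def by metis
  have Pq: "P t0 = q" unfolding P_def fq[symmetric] by simp
  have "continuous_map (top_of_set {0<..<b}) (stable_topology f p U) P"
    unfolding P_def[abs_def] by (rule axis_curve_continuous) simp
  from openin_continuous_map_preimage[OF this Q(1)]
  have "open {x \<in> {0<..<b}. P x \<in> Q}" by (simp add: openin_open_eq)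
  moreover have "t0 \<in> {x \<in> {0<..<b}. P x \<in> Q}" using t0 Pq Q(2) by simp
  ultimately obtain d where d: "0 < d" "ball t0 d \<subseteq> {x \<in> {0<..<b}. P x \<in> Q}" by (meson openE)
  have "continuous_map (top_of_set (ball t0 d)) (stable_topology f p U) P"
    unfolding P_def[abs_def] by (rule axis_curve_continuous) (use d in blast)
  then have con: "connectedin (stable_topology f p U) (P ` ball t0 d)"
    by (rule connectedin_continuous_map_image) (simp add: connectedin_subtopology)
  have "P ` ball t0 d \<subseteq> Q" "q \<in> P ` ball t0 d" using d Pq by (auto intro: rev_image_eqI[of t0])
  from \<alpha>[OF this(1) con this(2)]
  obtain K where K: "K \<in> components (U - local_unstable f p U)" "(f ^^ n) q \<in> K" "(inv f ^^ n) ` (P ` ball t0 d - {q}) \<subseteq> K"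
    by blast
  have KU: "K \<subseteq> U - local_unstable f p U" using K(1) by (rule in_components_subset)
  have "connected (t_coord C ` K)"
  proof (rule connected_continuous_image)
    show "connected K" using K(1) by (rule in_components_connected)
    have "continuous_on K (snd C)"
      by (rule continuous_on_subset[OF chart_facts(3)[OF chart]]) (use KU U(3) in blast)
    then show "continuous_on K (t_coord C)" by (intro continuous_intros)
  qed
  then have iv: "is_interval (t_coord C ` K)" by (simp add: is_interval_connected_1)
  have nz: "0 \<notin> t_coord C ` K" using KU unstable by force
  have posn: "0 < t_coord C ((f ^^ n) q)"
  proof -
    have "(f ^^ n) q = (f ^^ (n - N)) (chart_inv C (0, t0))"
      unfolding fq[symmetric] using Nn by (metis funpow_add le_add_diff_inverse2 o_apply)
    also have "\<dots> = chart_inv C (0, l ^ (n - N) * t0)"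
      using iterate_box(1)[of "n - N" 0 b t0 "n - N"] t0 b_pos by simp
    finally have eq: "(f ^^ n) q = chart_inv C (0, l ^ (n - N) * t0)" .
    have "l ^ (n - N) * t0 \<le> b" by (rule order_trans[OF l_power_le]) (use t0 in auto)
    then have "t_coord C ((f ^^ n) q) = l ^ (n - N) * t0"
      unfolding eq using box_point(2)[of 0 "l ^ (n - N) * t0"] t0 params b_pos by simp
    then show ?thesis using t0 params by simp
  qed
  have posK: "0 < t_coord C x" if "x \<in> K" for x
  proof (rule ccontr)
    assume "\<not> 0 < t_coord C x"
    moreover have "t_coord C x \<in> t_coord C ` K" "t_coord C ((f ^^ n) q) \<in> t_coord C ` K" using that K(2) by auto
    ultimately have "0 \<in> t_coord C ` K"
      using iv[unfolded is_interval_1] posn by (meson less_imp_le not_less)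
    then show False using nz by simp
  qed
  show ?thesis
  proof (intro exI[of _ d] conjI allI impI d(1))
    fix T assume T: "0 < \<bar>T - t0\<bar> \<and> \<bar>T - t0\<bar> < d"
    then have Tb: "T \<in> ball t0 d" by (simp add: dist_real_def abs_minus_commute)
    then have T0: "0 < T" "T < b" using d(2) by auto
    have "P T \<noteq> q"
    proof
      assume "P T = q"
      then have "(f ^^ N) (P T) = (f ^^ N) q" by simp
      then have "chart_inv C (0, T) = chart_inv C (0, t0)" by (simp add: P_def fq)
      moreover have "snd C (chart_inv C (0, T)) = (0, T)" by (rule box_point(2)) (use T0 b_pos in auto)
      moreover have "snd C (chart_inv C (0, t0)) = (0, t0)" by (rule box_point(2)) (use t0 b_pos in auto)
      ultimately have "(0::complex, T) = (0, t0)" by metis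
      then show False using T by simp
    qed
    then have "(inv f ^^ n) (P T) \<in> K" using K(3) Tb by blast
    then show "0 < return_height (n + N) (0, T)"
      using posK by (simp add: return_height_def P_def funpow_add)
  qed
qed

text \<open>The derivative of the return height at \<open>(0, t0)\<close> vanishes in the direction of \<open>T\<close>, where it has a
minimum. It does not vanish identically, because the transition is a diffeomorphism. Hence it is a
nonzero linear form in \<open>w\<close>.\<close>

lemma tangential_transit_exists:
  assumes A: "ck_3_manifold k A" and k: "1 \<le> k" and ck: "ck_map k A f" "ck_map k A (inv f)"
    and C: "local_coordinate k A C" and q: "q \<in> D_disk U C c"
    and pa: "positively_associated_at f p U q n" and fq: "(f ^^ N) q = chart_inv C (0, t0)"
    and t0: "0 < t0" "t0 < b" and Nn: "N \<le> n"
  shows "\<exists>\<mu>. tangential_transit ((inv f ^^ n) q) (n + N) t0 \<mu>"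
proof -
  define M where "M = n + N"
  define q0 where "q0 = (inv f ^^ n) q"
  have q0: "q0 \<in> U" "t_coord C q0 = 0" using backward_disk(1)[OF q, of n] by (auto simp: q0_def D_disk_def)
  have fq0: "(f ^^ M) q0 = chart_inv C (0, t0)"
  proof -
    have "(f ^^ M) q0 = (f ^^ N) ((f ^^ n) q0)" by (simp add: M_def funpow_add add.commute[of n N])
    then show ?thesis by (simp add: q0_def fq)
  qed
  have p0: "chart_inv C (0, t0) \<in> U" "snd C (chart_inv C (0, t0)) = (0, t0)" using box_point[of 0 t0] t0 b_pos by auto
  have returns: "(inv f ^^ M) (chart_inv C (0, t0)) = q0" unfolding fq0[symmetric] by simp
  define G where "G = snd C \<circ> (inv f ^^ M) \<circ> chart_inv C"
  define F where "F = snd C \<circ> (f ^^ M) \<circ> chart_inv C"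
  have "strictly_differentiable_at C C (inv f ^^ M) (chart_inv C (0, t0))"
    by (rule iterate_strictly_differentiable[OF A k ck(2) C C]) (use returns p0 q0 U(3) in auto)
  then obtain G' where G': "strict_derivative G G' (0, t0)"
    unfolding strictly_differentiable_at_def G_def p0(2) by blast
  have "strictly_differentiable_at C C (f ^^ M) q0"
    by (rule iterate_strictly_differentiable[OF A k ck(1) C C]) (use fq0 p0 q0 U(3) in auto)
  then obtain F' where F': "strict_derivative F F' (snd C q0)"
    unfolding strictly_differentiable_at_def F_def by blast
  have Fq0: "F (snd C q0) = (0, t0)" using chart_facts(6)[OF chart, of q0] q0(1) U(3) fq0 p0 by (auto simp: F_def)
  have hG: "(G has_derivative G') (at (0, t0))" using G' by (rule strict_derivative_imp_has_derivative)
  have "(G \<circ> F has_derivative G' \<circ> F') (at (snd C q0))"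
    using diff_chain_at[OF strict_derivative_imp_has_derivative[OF F'], of G G'] hG Fq0 by simp
  then have "((\<lambda>v. v) has_derivative G' \<circ> F') (at (snd C q0))"
  proof (rule has_derivative_transform_within_open)
    show "open (snd C ` (fst C \<inter> (f ^^ M) -` fst C))"
      using open_chart_image[OF chart] cont_iterate(1)[of M] chart_facts(1)[OF chart] by (simp add: continuous_on_open_vimage)
    show "snd C q0 \<in> snd C ` (fst C \<inter> (f ^^ M) -` fst C)" using q0(1) U(3) fq0 p0(1) by auto
    fix v assume "v \<in> snd C ` (fst C \<inter> (f ^^ M) -` fst C)"
    then obtain x where "x \<in> fst C" "(f ^^ M) x \<in> fst C" "v = snd C x" by auto
    then show "(G \<circ> F) v = v" using chart_facts(6)[OF chart] by (simp add: G_def F_def)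
  qed
  then have GF: "G' \<circ> F' = (\<lambda>h. h)" by (rule has_derivative_unique) (rule has_derivative_ident)
  have linG: "linear G'" using hG by (rule has_derivative_linear)
  define \<tau> where "\<tau> h = snd (G' h)" for h
  have lin: "linear \<tau>" unfolding \<tau>_def using linear_compose[OF linG linear_snd] by (simp add: o_def)
  obtain d where d: "0 < d" "\<And>T. 0 < \<bar>T - t0\<bar> \<Longrightarrow> \<bar>T - t0\<bar> < d \<Longrightarrow> 0 < return_height M (0, T)"
    using return_height_positive[OF pa fq t0 Nn] unfolding M_def by blast
  have rh: "return_height M v = snd (G v)" for v by (simp add: return_height_def G_def)
  have rh0: "return_height M (0, t0) = 0" by (simp add: return_height_def returns q0(2))
  have vert: "\<tau> (0, 1) = 0"
  proof -
    have "((\<lambda>T. (0::complex, T)) has_derivative (\<lambda>s. (0, s))) (at t0)" by (intro derivative_eq_intros) auto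
    from diff_chain_at[OF this hG]
    have "((\<lambda>T. G (0, T)) has_derivative (\<lambda>s. G' (0, s))) (at t0)" by (simp add: o_def)
    then have "((\<lambda>T. snd (G (0, T))) has_derivative (\<lambda>s. snd (G' (0, s)))) (at t0)" by (rule has_derivative_snd)
    moreover have "(\<lambda>s. snd (G' (0, s))) = (*) (\<tau> (0, 1))"
    proof
      fix s :: real
      have "(0::complex, s) = s *\<^sub>R (0, 1)" by simp
      then have "\<tau> (0, s) = s *\<^sub>R \<tau> (0, 1)" by (metis linear_scale[OF lin])
      then show "snd (G' (0, s)) = \<tau> (0, 1) * s" by (simp add: \<tau>_def)
    qed
    ultimately have "((\<lambda>T. snd (G (0, T))) has_real_derivative \<tau> (0, 1)) (at t0)"
      by (simp add: has_field_derivative_def)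
    then show ?thesis
    proof (rule DERIV_local_min[OF _ d(1)], intro allI impI)
      fix T assume "\<bar>t0 - T\<bar> < d"
      then show "snd (G (0, t0)) \<le> snd (G (0, T))"
        using d(2)[of T] rh0 unfolding rh by (cases "T = t0") (auto simp: abs_minus_commute)
    qed
  qed
  define \<mu> where "\<mu> = - Complex (\<tau> (1, 0)) (\<tau> (\<i>, 0))"
  have hor: "\<tau> (w, 0) = - Re (cnj \<mu> * w)" for w
  proof -
    have "(w, 0::real) = Re w *\<^sub>R (1, 0) + Im w *\<^sub>R (\<i>, 0)" by (simp add: complex_eq_iff)
    then have "\<tau> (w, 0) = Re w *\<^sub>R \<tau> (1, 0) + Im w *\<^sub>R \<tau> (\<i>, 0)"
      by (metis linear_add[OF lin] linear_scale[OF lin])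
    then show ?thesis by (simp add: \<mu>_def)
  qed
  have mu0: "\<mu> \<noteq> 0"
  proof
    assume "\<mu> = 0"
    have "\<tau> (w, s) = 0" for w s
    proof -
      have "(w, s) = (w, 0) + s *\<^sub>R (0, 1)" by simp
      then have "\<tau> (w, s) = \<tau> (w, 0) + s *\<^sub>R \<tau> (0, 1)" by (metis linear_add[OF lin] linear_scale[OF lin])
      then show ?thesis using hor vert \<open>\<mu> = 0\<close> by simp
    qed
    then have "\<tau> (F' (0, 1)) = 0" by (metis surj_pair)
    moreover have "\<tau> (F' (0, 1)) = 1" using fun_cong[OF GF, of "(0, 1)"] by (simp add: \<tau>_def)
    ultimately show False by simp
  qed
  have est: "\<exists>d>0. \<forall>w T. cmod w < d \<and> \<bar>T - t0\<bar> < d \<longrightarrow>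
       \<bar>return_height M (w, T) - return_height M (0, T) + Re (cnj \<mu> * w)\<bar> \<le> \<delta> * cmod w" if \<delta>: "0 < \<delta>" for \<delta>
  proof -
    obtain e where e: "0 < e" "\<And>u v. u \<in> ball (0, t0) e \<Longrightarrow> v \<in> ball (0, t0) e \<Longrightarrow> norm (G u - G v - G' (u - v)) \<le> \<delta> * norm (u - v)"
      using strict_derivativeD[OF G' \<delta>] by blast
    show ?thesis
    proof (intro exI[of _ "e / 2"] conjI allI impI)
      fix w :: complex and T assume wT: "cmod w < e / 2 \<and> \<bar>T - t0\<bar> < e / 2"
      have inb: "(w', T) \<in> ball (0, t0) e" if "cmod w' < e / 2" for w'
        using norm_Pair_le[of "- w'" "t0 - T"] wT that by (simp add: dist_norm abs_minus_commute)
      have "norm (G (w, T) - G (0, T) - G' ((w, T) - (0, T))) \<le> \<delta> * norm ((w, T) - (0, T))"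
        by (intro e(2) inb) (use wT e in auto)
      then have "norm (G (w, T) - G (0, T) - G' (w, 0)) \<le> \<delta> * cmod w" by simp
      moreover have "\<bar>snd (G (w, T) - G (0, T) - G' (w, 0))\<bar> \<le> norm (G (w, T) - G (0, T) - G' (w, 0))"
        using norm_snd_le[of "snd (G (w, T) - G (0, T) - G' (w, 0))" "fst (G (w, T) - G (0, T) - G' (w, 0))"]
        unfolding prod.collapse real_norm_def .
      moreover have "snd (G (w, T) - G (0, T) - G' (w, 0)) = return_height M (w, T) - return_height M (0, T) + Re (cnj \<mu> * w)"
        using hor[of w] by (simp add: rh \<tau>_def)
      ultimately show "\<bar>return_height M (w, T) - return_height M (0, T) + Re (cnj \<mu> * w)\<bar> \<le> \<delta> * cmod w" by linarith
    qed (use e in simp)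
  qed
  have pos: "\<exists>d>0. \<forall>T. 0 < \<bar>T - t0\<bar> \<and> \<bar>T - t0\<bar> < d \<longrightarrow> 0 < return_height M (0, T)"
    using return_height_positive[OF pa fq t0 Nn] unfolding M_def .
  have "tangential_transit q0 M t0 \<mu>"
    unfolding tangential_transit_def
    by (intro conjI allI impI q0 fq0 t0(1) less_imp_le[OF t0(2)] mu0 pos est)
  then show ?thesis unfolding q0_def M_def by blast
qed

end


section \<open>The conjugacy on the local unstable manifold\<close>

lemma inv_conjugate:
  assumes "bij h" "bij f" "f' = h \<circ> f \<circ> inv h" shows "inv f' = h \<circ> inv f \<circ> inv h"
  using assms by (simp add: o_inv_distrib bij_comp bij_imp_bij_inv inv_inv_eq o_assoc)

text \<open>Backward orbits of points of the disk stay in the disk and converge to the fixed point; both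
properties are carried over by \<open>h\<close> and characterize the local unstable manifold.\<close>

lemma disk_conjugate:
  fixes f f' h :: "'m::{t2_space,second_countable_topology} \<Rightarrow> 'm"
  assumes S: "saddle_chart f p U C r \<theta> l b" and S': "saddle_chart f' p' U' C' r' \<theta>' l' b'"
    and h: "bij h" "continuous_on UNIV h" "f' = h \<circ> f \<circ> inv h" "h p = p'"
    and box: "h ` U_box U C c \<subseteq> U_box U' C' c'" and x: "x \<in> D_disk U C c" and c: "0 \<le> c"
  shows "h x \<in> D_disk U' C' c'"
proof -
  interpret S: saddle_chart f p U C r \<theta> l b by (rule S)
  interpret S': saddle_chart f' p' U' C' r' \<theta>' l' b' by (rule S')
  have bwd_iter: "(inv f' ^^ n) (h x) = h ((inv f ^^ n) x)" for n
    by (rule funpow_conjugate[OF h(1) inv_conjugate[OF h(1) S.bij h(3)]])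
  have inbox: "h ((inv f ^^ n) x) \<in> U_box U' C' c'" for n
  proof -
    have "(inv f ^^ n) x \<in> U_box U C c" using S.backward_disk(1)[OF x, of n] c by (auto simp: D_disk_def U_box_def)
    then show ?thesis using box by blast
  qed
  have "x \<in> local_unstable f p U" using x S.unstable by (auto simp: D_disk_def)
  then have "(\<lambda>n. (inv f ^^ n) x) \<longlonglongrightarrow> p" by (simp add: local_unstable_def unstable_manifold_def)
  moreover have "isCont h p" using h(2) by (simp add: continuous_on_eq_continuous_at)
  ultimately have "(\<lambda>n. h ((inv f ^^ n) x)) \<longlonglongrightarrow> p'" using isCont_tendsto_compose h(4) by blast
  then have "h x \<in> local_unstable f' p' U'"
    using inbox unfolding local_unstable_def unstable_manifold_def mem_Collect_eq bwd_iter by (auto simp: U_box_def)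
  moreover have "h x \<in> U_box U' C' c'" using inbox[of 0] by simp
  ultimately show ?thesis using S'.unstable by (auto simp: D_disk_def U_box_def)
qed

text \<open>The inequality for \<open>x\<close> yields excursions of \<open>f\<close>, which \<open>h\<close> maps to excursions of \<open>f'\<close>, and these
force the inequality for \<open>h x\<close>.\<close>

lemma excursion_inequality_transfer:
  fixes f f' h :: "'m::{t2_space,second_countable_topology} \<Rightarrow> 'm"
  assumes S: "saddle_chart f p U C r \<theta> l b" and S': "saddle_chart f' p' U' C' r' \<theta>' l' b'"
    and h: "bij h" "continuous_on UNIV h" "f' = h \<circ> f \<circ> inv h"
    and box: "h ` U_box U C c \<subseteq> U_box U' C' b'"
    and tr: "saddle_chart.tangential_transit f U C b q N t0 \<mu>"
    and tr': "saddle_chart.tangential_transit f' U' C' b' (h q) N t0' \<mu>'"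
    and c: "cmod (z_coord C q) < c" "t0 < c" "c \<le> b"
    and x: "x \<in> D_disk U C c" "h x \<in> D_disk U' C' b'" and \<delta>: "0 < \<delta>"
  shows "\<exists>M. \<forall>n\<ge>M. \<forall>m\<ge>M.
      - Re (cnj \<mu> * (cnj (cis (real n * \<theta>)) * z_coord C x)) \<le> (1 - \<delta>) * (t0 * r ^ n * l ^ m) - \<delta> \<longrightarrow>
      - Re (cnj \<mu>' * (cnj (cis (real n * \<theta>')) * z_coord C' (h x))) \<le> (1 + \<delta>) * (t0' * r' ^ n * l' ^ m) + \<delta>"
proof -
  interpret S: saddle_chart f p U C r \<theta> l b by (rule S)
  interpret S': saddle_chart f' p' U' C' r' \<theta>' l' b' by (rule S')
  obtain O1 O2 O3 where op: "open O1" "open O2" "open O3" and mem: "(f' ^^ N) (h q) \<in> O1" "h q \<in> O2" "h x \<in> O3"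
    and nec: "\<And>n m. excursion f' (U_box U' C' b') N O1 O2 O3 n m \<Longrightarrow>
      - Re (cnj \<mu>' * (cnj (cis (real n * \<theta>')) * z_coord C' (h x))) \<le> (1 + \<delta>) * (t0' * r' ^ n * l' ^ m) + \<delta>"
    using S'.excursion_necessary[OF tr' x(2) \<delta>] by blast
  have op': "open (h -` O1)" "open (h -` O2)" "open (h -` O3)"
    using op h(2) by (simp_all add: continuous_on_open_vimage)
  have "(f ^^ N) q \<in> h -` O1" using mem(1) funpow_conjugate[OF h(1,3)] by simp
  moreover have "q \<in> h -` O2" "x \<in> h -` O3" using mem by simp_all
  ultimately obtain M where M: "\<And>n m. n \<ge> M \<Longrightarrow> m \<ge> M \<Longrightarrow>
      - Re (cnj \<mu> * (cnj (cis (real n * \<theta>)) * z_coord C x)) \<le> (1 - \<delta>) * (t0 * r ^ n * l ^ m) - \<delta> \<Longrightarrow>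
      excursion f (U_box U C c) N (h -` O1) (h -` O2) (h -` O3) n m"
    using S.excursion_sufficient[OF tr c x(1) \<delta> op'(1) _ op'(2) _ op'(3)] by blast
  show ?thesis
    by (rule exI[of _ M]) (use nec excursion_conjugate[OF h(1,3) box M] in blast)
qed

text \<open>The plane map \<open>\<eta>\<close> is \<open>h\<close> read in the coordinates \<open>cnj \<mu> * z\<close> and \<open>cnj \<mu>' * z'\<close>. Its backward
inequalities are the forward ones of the inverse of \<open>h\<close>; there the smaller cylinder of size \<open>a'\<close> is
used, because it is the one that is mapped into the cylinder of \<open>f\<close>.\<close>

lemma conjugacy_linear_near_fixed_point:
  fixes f f' h :: "'m::{t2_space,second_countable_topology} \<Rightarrow> 'm"
  assumes S: "saddle_chart f p U C r \<theta> l a" and S': "saddle_chart f' p' U' C' r' \<theta>' l' b'"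
    and hom: "homeomorphism UNIV UNIV h (inv h)" and conj: "f' = h \<circ> f \<circ> inv h" "h p = p'"
    and a': "0 < a'" "a' < b'"
    and box: "U_box U' C' a' \<subseteq> h ` U_box U C a" "h ` U_box U C a \<subseteq> U_box U' C' b'"
    and tr: "saddle_chart.tangential_transit f U C a q N t0 \<mu>"
    and tr': "saddle_chart.tangential_transit f' U' C' b' (h q) N t0' \<mu>'"
    and small: "cmod (z_coord C q) < a" "t0 < a" "cmod (z_coord C' (h q)) < a'" "t0' < a'"
    and irr: "\<theta> / (2 * pi) \<notin> \<rat>"
  obtains \<kappa> \<epsilon> where "\<kappa> \<noteq> 0" "0 < \<epsilon>"
    "(\<forall>x\<in>D_disk U C \<epsilon>. z_coord C' (h x) = \<kappa> * z_coord C x) \<or>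
     (\<forall>x\<in>D_disk U C \<epsilon>. z_coord C' (h x) = \<kappa> * cnj (z_coord C x))"
proof -
  interpret S: saddle_chart f p U C r \<theta> l a by (rule S)
  interpret S': saddle_chart f' p' U' C' r' \<theta>' l' b' by (rule S')
  have ch: "continuous_on UNIV h" "continuous_on UNIV (inv h)" using hom by (auto simp: homeomorphism_def)
  have ih: "inv h (h x) = x" "h (inv h x) = x" for x using hom by (auto simp: homeomorphism_def)
  have bh: "bij h" by (rule bijI') (metis ih)+
  have bih: "bij (inv h)" using bh by (rule bij_imp_bij_inv)
  have iih: "inv (inv h) = h" using bh by (rule inv_inv_eq)
  have conj': "f = inv h \<circ> f' \<circ> inv (inv h)" unfolding iih conj(1) by (auto simp: ih)
  have box': "inv h ` U_box U' C' a' \<subseteq> U_box U C a" 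
  proof safe
    fix y assume "y \<in> U_box U' C' a'"
    then obtain x where "x \<in> U_box U C a" "y = h x" using box(1) by blast
    then show "inv h y \<in> U_box U C a" by (simp add: ih)
  qed
  have hp': "inv h p' = p" using conj(2) ih by metis
  have a: "0 < a" by (rule S.b_pos)
  have mu: "\<mu> \<noteq> 0" and t0: "0 < t0" using tr unfolding S.tangential_transit_def by simp_all
  have mu': "\<mu>' \<noteq> 0" and t0': "0 < t0'" using tr' unfolding S'.tangential_transit_def by simp_all
  define P where "P x = chart_inv C (x, 0)" for x
  define P' where "P' y = chart_inv C' (y, 0)" for y
  have P: "P x \<in> D_disk U C a" "z_coord C (P x) = x" if "cmod x \<le> a" for x
    using S.box_point(1,2)[of x 0] that a by (auto simp: P_def D_disk_def)
  have P': "P' y \<in> D_disk U' C' a'" "z_coord C' (P' y) = y" if "cmod y \<le> a'" for y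
    using S'.box_point(1,2)[of y 0] that a' by (auto simp: P'_def D_disk_def)
  have Pz: "P (z_coord C x) = x" if "x \<in> D_disk U C e" for x e
  proof -
    have "x \<in> fst C" "(z_coord C x, 0) = snd C x" using that S.U(3) by (auto simp: D_disk_def prod_eq_iff)
    then show ?thesis using chart_facts(6)[OF S.chart] by (simp add: P_def)
  qed
  have P0: "P 0 = p" "P' 0 = p'" using S.chart_inv_origin S'.chart_inv_origin by (simp_all add: P_def P'_def)
  have cP: "continuous_on (ball 0 a) P" unfolding P_def
    by (rule continuous_on_compose2[OF chart_facts(4)[OF S.chart]])
      (use a in \<open>auto intro!: continuous_intros S.box_point(4)\<close>)
  have cP': "continuous_on (ball 0 a') P'" unfolding P'_def
    by (rule continuous_on_compose2[OF chart_facts(4)[OF S'.chart]])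
      (use a' in \<open>auto intro!: continuous_intros S'.box_point(4)\<close>)
  define Z where "Z x = z_coord C' (h (P x))" for x
  define V where "V y = z_coord C (inv h (P' y))" for y
  have fwdD: "h x \<in> D_disk U' C' b'" if "x \<in> D_disk U C a" for x
    by (rule disk_conjugate[OF S S' bh ch(1) conj box(2) that]) (use a in simp)
  have bwdD: "inv h y \<in> D_disk U C a" if "y \<in> D_disk U' C' a'" for y
    by (rule disk_conjugate[OF S' S bih ch(2) conj' hp' box' that]) (use a' in simp)
  have cZ: "continuous_on (ball 0 a) Z"
  proof -
    have 1: "continuous_on (ball 0 a) (\<lambda>x. h (P x))" by (rule continuous_on_compose2[OF ch(1) cP]) auto
    have "continuous_on (ball 0 a) (\<lambda>x. snd C' (h (P x)))"
      by (rule continuous_on_compose2[OF chart_facts(3)[OF S'.chart] 1])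
        (use fwdD P(1) S'.U(3) in \<open>force simp: D_disk_def\<close>)
    then show ?thesis unfolding Z_def by (intro continuous_intros)
  qed
  have cV: "continuous_on (ball 0 a') V"
  proof -
    have 1: "continuous_on (ball 0 a') (\<lambda>x. inv h (P' x))" by (rule continuous_on_compose2[OF ch(2) cP']) auto
    have "continuous_on (ball 0 a') (\<lambda>x. snd C (inv h (P' x)))"
      by (rule continuous_on_compose2[OF chart_facts(3)[OF S.chart] 1])
        (use bwdD P'(1) S.U(3) in \<open>force simp: D_disk_def\<close>)
    then show ?thesis unfolding V_def by (intro continuous_intros)
  qed
  have Z0: "Z 0 = 0" using P0 conj(2) S'.origin by (simp add: Z_def)
  have V0: "V 0 = 0" using P0 hp' S.origin by (simp add: V_def)
  have shrink: "\<exists>e>0. e \<le> R \<and> (\<forall>x. cmod x < e \<longrightarrow> cmod (F x) < d)"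
    if cF: "continuous_on (ball 0 R) F" and F0: "F 0 = 0" and R: "0 < R" and d: "0 < d" for F :: "complex \<Rightarrow> complex" and R d
  proof -
    have "isCont F 0" using cF R by (simp add: continuous_on_eq_continuous_at)
    then obtain e where "0 < e" "\<forall>x. dist x 0 < e \<longrightarrow> dist (F x) (F 0) < d"
      unfolding continuous_at_eps_delta using d by blast
    then show ?thesis using F0 R by (intro exI[of _ "min e R"]) auto
  qed
  obtain e0 where e0: "0 < e0" "e0 \<le> a" "\<And>x. cmod x < e0 \<Longrightarrow> cmod (Z x) < a'"
    using shrink[OF cZ Z0 a a'(1)] by blast
  obtain e1 where e1: "0 < e1" "e1 \<le> a'" "\<And>x. cmod x < e1 \<Longrightarrow> cmod (V x) < e0"
    using shrink[OF cV V0 a'(1) e0(1)] by blast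
  define \<eta> where "\<eta> X = cnj \<mu>' * Z (X / cnj \<mu>)" for X
  have div: "cmod (X / cnj \<mu>) < e0 \<longleftrightarrow> X \<in> ball 0 (cmod \<mu> * e0)" for X :: complex
    using mu by (simp add: norm_divide field_simps)
  interpret plane: plane_conjugacy \<eta> "cmod \<mu> * e0" "cmod \<mu>' * e1" \<theta> \<theta>' r r' l l' t0 t0'
  proof unfold_locales
    show "0 < cmod \<mu> * e0" "0 < cmod \<mu>' * e1" using mu mu' e0 e1 by auto
    show "continuous_on (ball 0 (cmod \<mu> * e0)) \<eta>"
    proof -
      have "continuous_on (ball 0 (cmod \<mu> * e0)) (\<lambda>X. Z (X / cnj \<mu>))"
      proof (rule continuous_on_compose2[OF cZ])
        show "continuous_on (ball 0 (cmod \<mu> * e0)) (\<lambda>X. X / cnj \<mu>)" using mu by (intro continuous_intros) simp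
        show "(\<lambda>X. X / cnj \<mu>) ` ball 0 (cmod \<mu> * e0) \<subseteq> ball 0 a"
        proof safe
          fix X :: complex assume "X \<in> ball 0 (cmod \<mu> * e0)"
          then have "cmod (X / cnj \<mu>) < e0" using div by blast
          then show "X / cnj \<mu> \<in> ball 0 a" using e0 by simp
        qed
      qed
      then show ?thesis unfolding \<eta>_def by (intro continuous_intros)
    qed
    show "\<eta> 0 = 0" by (simp add: \<eta>_def Z0)
    show "\<eta> X \<noteq> 0" if X: "X \<in> ball 0 (cmod \<mu> * e0)" "X \<noteq> 0" for X
    proof
      assume "\<eta> X = 0"
      define x where "x = X / cnj \<mu>"
      have x: "cmod x < e0" "x \<noteq> 0" using X div mu by (auto simp: x_def)
      have Zx: "Z x = 0" using \<open>\<eta> X = 0\<close> mu' by (simp add: \<eta>_def x_def)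
      have D: "P x \<in> D_disk U C a" "z_coord C (P x) = x" using P[of x] x e0 by auto
      have D': "h (P x) \<in> D_disk U' C' b'" by (rule fwdD[OF D(1)])
      then have "snd C' (h (P x)) = snd C' p'" using Zx S'.origin by (simp add: Z_def D_disk_def prod_eq_iff)
      then have "h (P x) = p'" using D' S'.U by (intro S'.coord_inj) (auto simp: D_disk_def)
      then have "P x = p" using ih hp' by metis
      then show False using D(2) x(2) S.origin by simp
    qed
    show "ball 0 (cmod \<mu>' * e1) \<subseteq> \<eta> ` ball 0 (cmod \<mu> * e0)"
    proof
      fix Y :: complex assume Y: "Y \<in> ball 0 (cmod \<mu>' * e1)"
      define y where "y = Y / cnj \<mu>'"
      have y: "cmod y < e1" using Y mu' by (simp add: y_def norm_divide field_simps)
      have D': "P' y \<in> D_disk U' C' a'" "z_coord C' (P' y) = y" using P'[of y] y e1 by auto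
      define x where "x = V y"
      have x: "cmod x < e0" using e1(3)[OF y] by (simp add: x_def)
      have "P x = inv h (P' y)" unfolding x_def V_def by (rule Pz[OF bwdD[OF D'(1)]])
      then have "Z x = y" using D'(2) ih by (simp add: Z_def)
      then have "\<eta> (cnj \<mu> * x) = Y" using mu mu' by (simp add: \<eta>_def y_def)
      moreover have "cnj \<mu> * x \<in> ball 0 (cmod \<mu> * e0)" using x mu by (simp add: norm_mult)
      ultimately show "Y \<in> \<eta> ` ball 0 (cmod \<mu> * e0)" by blast
    qed
    show "\<theta> / (2 * pi) \<notin> \<rat>" by (rule irr)
    show "1 < r" "1 < r'" "0 < l" "l < 1" "0 < l'" "l' < 1" "0 < t0" "0 < t0'"
      using S.params S'.params t0 t0' by auto
    fix X :: complex and \<delta> :: real assume X: "X \<in> ball 0 (cmod \<mu> * e0)" and \<delta>: "0 < \<delta>"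
    define x where "x = X / cnj \<mu>"
    have x: "cmod x < e0" using X div by (simp add: x_def)
    have X_eq: "cnj c * X = cnj \<mu> * (cnj c * x)" for c using mu by (simp add: x_def)
    have \<eta>_eq: "cnj c * \<eta> X = cnj \<mu>' * (cnj c * Z x)" for c by (simp add: \<eta>_def x_def)
    have D: "P x \<in> D_disk U C a" "z_coord C (P x) = x" using P[of x] x e0 by auto
    have D': "h (P x) \<in> D_disk U' C' b'" by (rule fwdD[OF D(1)])
    have D'': "h (P x) \<in> D_disk U' C' a'" using D' e0(3)[OF x] by (simp add: D_disk_def Z_def)
    have Zx: "z_coord C' (h (P x)) = Z x" by (simp add: Z_def)
    show "\<exists>M. \<forall>n\<ge>M. \<forall>m\<ge>M.
      - Re (cnj (cis (real n * \<theta>)) * X) \<le> (1 - \<delta>) * (t0 * r ^ n * l ^ m) - \<delta> \<longrightarrow>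
      - Re (cnj (cis (real n * \<theta>')) * \<eta> X) \<le> (1 + \<delta>) * (t0' * r' ^ n * l' ^ m) + \<delta>"
      using excursion_inequality_transfer[OF S S' bh ch(1) conj(1) box(2) tr tr' small(1,2) order_refl D(1) D' \<delta>]
      unfolding X_eq \<eta>_eq D(2) Zx .
    have "\<exists>M. \<forall>n\<ge>M. \<forall>m\<ge>M.
      - Re (cnj \<mu>' * (cnj (cis (real n * \<theta>')) * z_coord C' (h (P x)))) \<le> (1 - \<delta>) * (t0' * r' ^ n * l' ^ m) - \<delta> \<longrightarrow>
      - Re (cnj \<mu> * (cnj (cis (real n * \<theta>)) * z_coord C (inv h (h (P x))))) \<le> (1 + \<delta>) * (t0 * r ^ n * l ^ m) + \<delta>"
    proof (rule excursion_inequality_transfer[OF S' S bih ch(2) conj' box' tr' _ small(3,4) _ D'' _ \<delta>])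
      show "S.tangential_transit (inv h (h q)) N t0 \<mu>" using tr by (simp add: ih)
      show "a' \<le> b'" using a' by simp
      show "inv h (h (P x)) \<in> D_disk U C a" using D(1) by (simp add: ih)
    qed
    then show "\<exists>M. \<forall>n\<ge>M. \<forall>m\<ge>M.
      - Re (cnj (cis (real n * \<theta>')) * \<eta> X) \<le> (1 - \<delta>) * (t0' * r' ^ n * l' ^ m) - \<delta> \<longrightarrow>
      - Re (cnj (cis (real n * \<theta>)) * X) \<le> (1 + \<delta>) * (t0 * r ^ n * l ^ m) + \<delta>"
      unfolding X_eq \<eta>_eq ih D(2) Zx .
  qed
  obtain \<rho> where \<rho>: "0 < \<rho>" "(\<forall>X\<in>ball 0 (cmod \<mu> * e0). \<eta> X = of_real \<rho> * X) \<or> (\<forall>X\<in>ball 0 (cmod \<mu> * e0). \<eta> X = of_real \<rho> * cnj X)"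
    by (rule plane.linear_conformal)
  have x: "cnj \<mu> * z_coord C x \<in> ball 0 (cmod \<mu> * e0)" "z_coord C' (h x) = \<eta> (cnj \<mu> * z_coord C x) / cnj \<mu>'"
    if "x \<in> D_disk U C (e0 / 2)" for x
  proof -
    have "cmod (z_coord C x) < e0" using that e0 by (simp add: D_disk_def)
    then show "cnj \<mu> * z_coord C x \<in> ball 0 (cmod \<mu> * e0)" using mu by (simp add: norm_mult)
    show "z_coord C' (h x) = \<eta> (cnj \<mu> * z_coord C x) / cnj \<mu>'"
      using mu mu' Pz[OF that] by (simp add: \<eta>_def Z_def)
  qed
  from \<rho>(2) show ?thesis
  proof
    assume "\<forall>X\<in>ball 0 (cmod \<mu> * e0). \<eta> X = of_real \<rho> * X"
    then show ?thesis using x \<rho>(1) mu mu' e0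
      by (intro that[of "of_real \<rho> * cnj \<mu> / cnj \<mu>'" "e0 / 2"]) auto
  next
    assume "\<forall>X\<in>ball 0 (cmod \<mu> * e0). \<eta> X = of_real \<rho> * cnj X"
    then show ?thesis using x \<rho>(1) mu mu' e0
      by (intro that[of "of_real \<rho> * \<mu> / cnj \<mu>'" "e0 / 2"]) auto
  qed
qed

text \<open>The function \<open>\<sigma>\<close> is the identity or complex conjugation. Comparing the formula at a point near \<open>p\<close>
and at its preimage shows that \<open>\<sigma>\<close> maps the multiplier of \<open>f\<close> to that of \<open>f'\<close>. Then iteration
transports the formula along the backward orbit of any point of the local unstable manifold.\<close>

lemma conjugacy_linear_on_unstable:
  fixes f f' h :: "'m::{t2_space,second_countable_topology} \<Rightarrow> 'm"
  assumes S: "saddle_chart f p U C r \<theta> l a" and S': "saddle_chart f' p' U' C' r' \<theta>' l' b'"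
    and h: "bij h" "f' = h \<circ> f \<circ> inv h"
    and \<kappa>: "\<kappa> \<noteq> 0" and \<epsilon>: "0 < \<epsilon>" and \<sigma>: "\<sigma> = (\<lambda>z. z) \<or> \<sigma> = cnj"
    and lin: "\<And>x. x \<in> D_disk U C \<epsilon> \<Longrightarrow> z_coord C' (h x) = \<kappa> * \<sigma> (z_coord C x)"
    and x: "x \<in> local_unstable f p U" "h x \<in> local_unstable f' p' U'"
    and D: "h ` D_disk U C a \<subseteq> local_unstable f' p' U'"
  shows "z_coord C' (h x) = \<kappa> * \<sigma> (z_coord C x)"
proof -
  interpret S: saddle_chart f p U C r \<theta> l a by (rule S)
  interpret S': saddle_chart f' p' U' C' r' \<theta>' l' b' by (rule S')
  have \<sigma>_mult: "\<sigma> (v * w) = \<sigma> v * \<sigma> w" "\<sigma> v = 0 \<longleftrightarrow> v = 0" for v w using \<sigma> by auto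
  have \<sigma>_pow: "\<sigma> (v ^ n) = \<sigma> v ^ n" for v n using \<sigma> by auto
  define lam where "lam = rcis r \<theta>"
  define lam' where "lam' = rcis r' \<theta>'"
  have lam0: "lam \<noteq> 0" using S.params by (simp add: lam_def)
  have bwd_iter: "(inv f' ^^ n) (h y) = h ((inv f ^^ n) y)" for n y
    by (rule funpow_conjugate[OF h(1) inv_conjugate[OF h(1) S.bij h(2)]])
  have zb: "z_coord C y = lam ^ n * z_coord C ((inv f ^^ n) y)" if y: "y \<in> local_unstable f p U" for y n
  proof -
    have "y \<in> U" using y by (auto simp: local_unstable_def dest: spec[of _ 0])
    then have "y \<in> D_disk U C (cmod (z_coord C y))" using S.unstable y by (simp add: D_disk_def)
    then show ?thesis unfolding lam_def by (rule S.backward_disk(2))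
  qed
  have zb': "z_coord C' (h y) = lam' ^ n * z_coord C' (h ((inv f ^^ n) y))" if y: "h y \<in> local_unstable f' p' U'" for y n
  proof -
    have "h y \<in> U'" using y by (auto simp: local_unstable_def dest: spec[of _ 0])
    then have "h y \<in> D_disk U' C' (cmod (z_coord C' (h y)))" using S'.unstable y by (simp add: D_disk_def)
    then show ?thesis unfolding lam'_def bwd_iter[symmetric] by (rule S'.backward_disk(2))
  qed
  define e where "e = min \<epsilon> a"
  have e: "0 < e" "e \<le> \<epsilon>" "e \<le> a" using \<epsilon> S.b_pos by (auto simp: e_def)
  define y where "y = chart_inv C (of_real e, 0)"
  have y: "y \<in> U" "snd C y = (of_real e, 0)" using S.box_point(1,2)[of "of_real e" 0] e by (auto simp: y_def)
  then have yD: "y \<in> D_disk U C \<epsilon>" "y \<in> D_disk U C a" using e by (auto simp: D_disk_def)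
  have yW: "y \<in> local_unstable f p U" using S.unstable[OF y(1)] y(2) by simp
  have mult: "lam' = \<sigma> lam"
  proof -
    let ?w = "(inv f ^^ 1) y"
    have wD: "?w \<in> D_disk U C \<epsilon>" by (rule S.backward_disk(1)[OF yD(1)])
    have zw: "z_coord C y = lam * z_coord C ?w" using zb[OF yW, of 1] by simp
    have "\<kappa> * \<sigma> (z_coord C y) = z_coord C' (h y)" using lin[OF yD(1)] by simp
    also have "\<dots> = lam' * z_coord C' (h ?w)" using zb'[of y 1] D yD(2) by auto
    also have "\<dots> = lam' * (\<kappa> * \<sigma> (z_coord C ?w))" using lin[OF wD] by simp
    finally have "\<kappa> * (\<sigma> lam * \<sigma> (z_coord C ?w)) = lam' * (\<kappa> * \<sigma> (z_coord C ?w))" unfolding zw \<sigma>_mult(1) .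
    moreover have "z_coord C ?w \<noteq> 0" using zw y(2) e(1) by auto
    then have "\<sigma> (z_coord C ?w) \<noteq> 0" using \<sigma>_mult(2) by simp
    ultimately show ?thesis using \<kappa> by simp
  qed
  have "x \<in> U" using x by (auto simp: local_unstable_def dest: spec[of _ 0])
  have "(\<lambda>n. (inv f ^^ n) x) \<longlonglongrightarrow> p" using x(1) by (simp add: local_unstable_def unstable_manifold_def)
  moreover have "isCont (snd C) p"
    using chart_facts(3)[OF S.chart] chart_facts(1)[OF S.chart] S.U by (auto simp: continuous_on_eq_continuous_at)
  ultimately have "(\<lambda>n. snd C ((inv f ^^ n) x)) \<longlonglongrightarrow> snd C p" by (rule isCont_tendsto_compose[rotated])
  then have "(\<lambda>n. cmod (z_coord C ((inv f ^^ n) x))) \<longlonglongrightarrow> cmod (fst (snd C p))" by (intro tendsto_intros)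
  then have "(\<lambda>n. cmod (z_coord C ((inv f ^^ n) x))) \<longlonglongrightarrow> 0" by (simp add: S.origin)
  from order_tendstoD(2)[OF this \<epsilon>] obtain n where n: "cmod (z_coord C ((inv f ^^ n) x)) < \<epsilon>"
    using eventually_happens'[OF sequentially_bot] by blast
  have "(inv f ^^ n) x \<in> D_disk U C (cmod (z_coord C x))"
    using S.unstable[OF \<open>x \<in> U\<close>] x(1) \<open>x \<in> U\<close> by (intro S.backward_disk(1)) (simp add: D_disk_def)
  then have nD: "(inv f ^^ n) x \<in> D_disk U C \<epsilon>" using n by (simp add: D_disk_def)
  have "z_coord C' (h x) = \<sigma> lam ^ n * (\<kappa> * \<sigma> (z_coord C ((inv f ^^ n) x)))"
    using zb'[OF x(2), of n] lin[OF nD] mult by simp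
  also have "\<dots> = \<kappa> * \<sigma> (lam ^ n * z_coord C ((inv f ^^ n) x))" by (simp add: \<sigma>_mult \<sigma>_pow)
  also have "\<dots> = \<kappa> * \<sigma> (z_coord C x)" using zb[OF x(1), of n] by simp
  finally show ?thesis .
qed


section \<open>Orientation and the ratio of coordinates\<close>

text \<open>The path is the exponential of a straight path, and the winding number is read off its endpoints.\<close>

lemma winding_number_rotating:
  fixes s :: real
  assumes "c \<noteq> 0"
  shows "winding_number (\<lambda>u. c * exp (of_real s * (2 * of_real pi * \<i> * of_real u))) 0 = of_real s"
proof -
  define p where "p u = Ln c + of_real s * (2 * of_real pi * \<i> * of_real u)" for u :: real
  have "(\<lambda>u. c * exp (of_real s * (2 * of_real pi * \<i> * of_real u))) = exp \<circ> p"
    using assms by (auto simp: p_def exp_add)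
  moreover have "path p" unfolding path_def p_def by (intro continuous_intros)
  then have "winding_number (exp \<circ> p) 0 = (pathfinish p - pathstart p) / (2 * of_real pi * \<i>)"
    by (rule winding_number_compose_exp)
  moreover have "pathfinish p - pathstart p = of_real s * (2 * of_real pi * \<i>)"
    by (simp add: pathfinish_def pathstart_def p_def)
  ultimately show ?thesis by simp
qed

lemma winding_number_linear_circle:
  assumes "\<kappa> \<noteq> 0" "0 < \<rho>" and g: "\<And>z. z \<in> cball w \<rho> \<Longrightarrow> g z = \<kappa> * z"
  shows "winding_number (g \<circ> circlepath w \<rho>) (g w) = 1"
proof -
  have "(\<lambda>u. (g \<circ> circlepath w \<rho>) u - g w) = (\<lambda>u. (\<kappa> * of_real \<rho>) * exp (of_real 1 * (2 * of_real pi * \<i> * of_real u)))"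
  proof
    fix u
    have "circlepath w \<rho> u = w + of_real \<rho> * exp (2 * of_real pi * \<i> * of_real u)" by (simp add: circlepath)
    moreover from this have "circlepath w \<rho> u \<in> cball w \<rho>" using assms(2) by (simp add: dist_norm norm_mult norm_exp_eq_Re)
    moreover have "w \<in> cball w \<rho>" using assms(2) by simp
    ultimately show "(g \<circ> circlepath w \<rho>) u - g w = (\<kappa> * of_real \<rho>) * exp (of_real 1 * (2 * of_real pi * \<i> * of_real u))"
      using g by (simp add: algebra_simps)
  qed
  then show ?thesis using winding_number_rotating[of "\<kappa> * of_real \<rho>" 1] assms(1,2)
    by (subst winding_number_offset) simp
qed

lemma winding_number_antilinear_circle:
  assumes "\<kappa> \<noteq> 0" "0 < \<rho>" and g: "\<And>z. z \<in> cball w \<rho> \<Longrightarrow> g z = \<kappa> * cnj z"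
  shows "winding_number (g \<circ> circlepath w \<rho>) (g w) = - 1"
proof -
  have "(\<lambda>u. (g \<circ> circlepath w \<rho>) u - g w) = (\<lambda>u. (\<kappa> * of_real \<rho>) * exp (of_real (- 1) * (2 * of_real pi * \<i> * of_real u)))"
  proof
    fix u
    have "circlepath w \<rho> u = w + of_real \<rho> * exp (2 * of_real pi * \<i> * of_real u)" by (simp add: circlepath)
    moreover from this have "circlepath w \<rho> u \<in> cball w \<rho>" using assms(2) by (simp add: dist_norm norm_mult norm_exp_eq_Re)
    moreover have "w \<in> cball w \<rho>" using assms(2) by simp
    moreover have "cnj (exp (2 * of_real pi * \<i> * of_real u)) = exp (- (2 * of_real pi * \<i> * of_real u))"
      by (simp add: exp_cnj)
    ultimately show "(g \<circ> circlepath w \<rho>) u - g w = (\<kappa> * of_real \<rho>) * exp (of_real (- 1) * (2 * of_real pi * \<i> * of_real u))"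
      using g by (simp add: algebra_simps)
  qed
  then show ?thesis using winding_number_rotating[of "\<kappa> * of_real \<rho>" "- 1"] assms(1,2)
    by (subst winding_number_offset) simp
qed

text \<open>The base point of the excursions cannot be the tangency \<open>q\<close> itself, because the image of \<open>q\<close> may lie
outside the cylinder of size \<open>a'\<close>. It is a preimage of \<open>q\<close> under \<open>f ^^ n\<close> with \<open>n\<close> so large that the
preimages for \<open>f\<close> and \<open>f'\<close> are close to the fixed points and positive association holds at \<open>n\<close> for
both. Likewise the endpoint of the transition is moved forward until its heights are small.\<close>

lemma conjugacy_respects_ratios:
  fixes f f' h :: "'m::{t2_space,second_countable_topology} \<Rightarrow> 'm"
  assumes k: "3 \<le> k" and A: "ck_3_manifold k A"
    and sf: "saddle_focus_with_tangency k A f p q r \<theta> l U C"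
    and sf': "saddle_focus_with_tangency k A f' p' q' r' \<theta>' l' U' C'"
    and irr: "\<theta> / (2 * pi) \<notin> \<rat>" and box_a: "box_in_chart U C a"
    and q: "q \<in> D_disk U C a" "cmod (z_coord C q) < a"
    and fq: "snd C ((f ^^ N) q) = (0, t0)" "(f ^^ N) q \<in> U" and t0: "0 < t0" "t0 < a"
    and s: "s \<in> D_disk U C a"
    and hom: "homeomorphism UNIV UNIV h (inv h)" and conj: "f' = h \<circ> f \<circ> inv h" "h p = p'" "h q = q'"
    and a': "0 < a'" "a' < b'" and box_b': "box_in_chart U' C' b'"
    and box: "U_box U' C' a' \<subseteq> h ` U_box U C a" "h ` U_box U C a \<subseteq> U_box U' C' b'"
  shows "if preserves_unstable_orientation (local_unstable f p U) C (local_unstable f' p' U') C' h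
           then z_coord C s / z_coord C q = z_coord C' (h s) / z_coord C' q'
           else z_coord C s / z_coord C q = cnj (z_coord C' (h s) / z_coord C' q')"
proof -
  have S: "saddle_chart f p U C r \<theta> l a" by (rule saddle_chart_of_tangency[OF k A sf box_a])
  have S': "saddle_chart f' p' U' C' r' \<theta>' l' b'" by (rule saddle_chart_of_tangency[OF k A sf' box_b'])
  interpret S: saddle_chart f p U C r \<theta> l a by (rule S)
  interpret S': saddle_chart f' p' U' C' r' \<theta>' l' b' by (rule S')
  have k1: "1 \<le> k" using k by (rule order_trans[rotated]) (simp add: one_enat_def numeral_eq_enat)
  have ck: "ck_map k A f" "ck_map k A (inv f)" "ck_map k A f'" "ck_map k A (inv f')"
    using sf sf' by (auto simp: saddle_focus_with_tangency_def Diff_def)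
  have lc: "local_coordinate k A C" "local_coordinate k A C'"
    using sf sf' by (auto simp: saddle_focus_with_tangency_def linearizing_coordinate_def linear_on_nbhd_def)
  have pa: "\<forall>\<^sub>F n in sequentially. positively_associated_at f p U q n"
    and pa': "\<forall>\<^sub>F n in sequentially. positively_associated_at f' p' U' q' n"
    using sf sf' by (auto simp: saddle_focus_with_tangency_def positively_associated_def positively_associated_at_def)
  have qp: "q \<noteq> p" using sf by (auto simp: saddle_focus_with_tangency_def homoclinic_quadratic_tangency_def)
  have ch: "continuous_on UNIV h" using hom by (auto simp: homeomorphism_def)
  have ih: "inv h (h x) = x" "h (inv h x) = x" for x :: 'm using hom by (auto simp: homeomorphism_def)
  have bh: "bij h" by (rule bijI') (metis ih)+
  have a: "0 < a" by (rule S.b_pos)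
  have iter: "(f' ^^ n) (h x) = h ((f ^^ n) x)" for n x by (rule funpow_conjugate[OF bh conj(1)])
  have biter: "(inv f' ^^ n) (h x) = h ((inv f ^^ n) x)" for n x
    by (rule funpow_conjugate[OF bh inv_conjugate[OF bh S.bij conj(1)]])
  have diskh: "h x \<in> D_disk U' C' b'" if "x \<in> D_disk U C a" for x
    by (rule disk_conjugate[OF S S' bh ch conj(1,2) box(2) that]) (use a in simp)
  \<comment> \<open>Both \<open>q\<close> and \<open>q'\<close> enter the axis at the same time \<open>N\<close>; a common later time \<open>N + i\<close> brings the height
    \<open>l' ^ i * t0'\<close> below \<open>a'\<close>.\<close>
  have q0: "(f ^^ N) q = chart_inv C (0, t0)"
    using chart_facts(6)[OF S.chart, of "(f ^^ N) q"] fq S.U(3) by auto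
  have fwd: "(f ^^ (N + i)) q = chart_inv C (0, l ^ i * t0)" "(f ^^ (N + i)) q \<in> U_box U C a" for i
  proof -
    have "(f ^^ (N + i)) q = (f ^^ i) ((f ^^ N) q)" by (simp add: funpow_add add.commute[of N i])
    then show "(f ^^ (N + i)) q = chart_inv C (0, l ^ i * t0)" "(f ^^ (N + i)) q \<in> U_box U C a"
      using S.iterate_box[of i 0 a t0 i] t0 a q0 by auto
  qed
  define t0' where "t0' = t_coord C' (h ((f ^^ N) q))"
  have hq: "h ((f ^^ N) q) \<in> local_stable f' p' U'"
  proof -
    have "(f ^^ N) q \<in> local_stable f p U" unfolding q0 by (rule S.axis_in_local_stable) (use t0 in auto)
    then have "(\<lambda>n. (f ^^ n) ((f ^^ N) q)) \<longlonglongrightarrow> p" by (simp add: local_stable_def stable_manifold_def)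
    moreover have "isCont h p" using ch by (simp add: continuous_on_eq_continuous_at)
    ultimately have "(\<lambda>n. h ((f ^^ n) ((f ^^ N) q))) \<longlonglongrightarrow> p'" using isCont_tendsto_compose conj(2) by blast
    moreover have "h ((f ^^ n) ((f ^^ N) q)) \<in> U'" for n
      using fwd(2)[of n] box(2) by (auto simp: funpow_add add.commute[of N n] U_box_def)
    ultimately show ?thesis by (simp add: local_stable_def stable_manifold_def iter)
  qed
  have hq_box: "h ((f ^^ N) q) \<in> U_box U' C' b'" using fwd(2)[of 0] box(2) by auto
  have hq_coord: "snd C' (h ((f ^^ N) q)) = (0, t0')" using S'.stable[OF hq] by (simp add: t0'_def prod_eq_iff)
  have fqp: "(f ^^ N) q \<noteq> p"
  proof
    assume "(f ^^ N) q = p"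
    then have "snd C p = (0, t0)" using fq by simp
    then show False using S.origin t0 by (simp add: zero_prod_def)
  qed
  have t0': "0 < t0'" "t0' \<le> b'"
  proof -
    have "0 \<le> t0'" "t0' \<le> b'" using hq_box by (auto simp: U_box_def t0'_def)
    moreover have "t0' \<noteq> 0"
    proof
      assume "t0' = 0"
      then have "snd C' (h ((f ^^ N) q)) = snd C' p'" using hq_coord S'.origin by (simp add: zero_prod_def)
      then have "h ((f ^^ N) q) = p'" using hq_box S'.U by (intro S'.coord_inj) (auto simp: U_box_def)
      then show False using fqp conj(2) ih by metis
    qed
    ultimately show "0 < t0'" "t0' \<le> b'" by auto
  qed
  have q0': "(f' ^^ N) q' = chart_inv C' (0, t0')"
    using chart_facts(6)[OF S'.chart, of "h ((f ^^ N) q)"] hq_coord hq_box S'.U(3) conj(3) iter[of N q]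
    by (auto simp: U_box_def)
  have "(\<lambda>i. l' ^ i * t0') \<longlonglongrightarrow> 0 * t0'" by (intro tendsto_intros LIMSEQ_power_zero) (use S'.params in auto)
  then have "\<forall>\<^sub>F i in sequentially. l' ^ i * t0' < a'" by (rule order_tendstoD) (use a' in simp)
  then obtain i where i: "l' ^ i * t0' < a'" using eventually_happens'[OF sequentially_bot] by blast
  define N1 where "N1 = N + i"
  define t1 where "t1 = l ^ i * t0"
  define t1' where "t1' = l' ^ i * t0'"
  have t1: "0 < t1" "t1 < a"
  proof -
    have "l ^ i * t0 \<le> t0" by (rule S.l_power_le) (use t0 in simp)
    then show "t1 < a" using t0(2) unfolding t1_def by (rule le_less_trans)
  qed (use t0 S.params in \<open>simp add: t1_def\<close>)
  have t1': "0 < t1'" "t1' < a'" "t1' < b'" using t0' S'.params i a' by (auto simp: t1'_def)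
  have f1: "(f ^^ N1) q = chart_inv C (0, t1)" by (simp add: N1_def t1_def fwd(1))
  have f1': "(f' ^^ N1) q' = chart_inv C' (0, t1')"
  proof -
    have "(f' ^^ N1) q' = (f' ^^ i) ((f' ^^ N) q')" by (simp add: N1_def funpow_add add.commute[of N i])
    then show ?thesis using S'.iterate_box(1)[of i 0 b' t0' i] t0' a' q0' by (simp add: t1'_def)
  qed
  \<comment> \<open>The preimage of \<open>q'\<close> under \<open>f' ^^ n\<close> is needed in the smaller disk of radius \<open>a'\<close>.\<close>
  have q': "q' \<in> D_disk U' C' b'" using diskh[OF q(1)] conj(3) by simp
  have "(\<lambda>n. cmod (z_coord C' q') * inverse r' ^ n) \<longlonglongrightarrow> cmod (z_coord C' q') * 0"
    by (intro tendsto_intros LIMSEQ_power_zero) (use S'.params in \<open>auto simp: field_simps\<close>)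
  then have "\<forall>\<^sub>F n in sequentially. cmod (z_coord C' q') * inverse r' ^ n < a'"
    by (rule order_tendstoD) (use a' in simp)
  from eventually_conj[OF this eventually_conj[OF pa eventually_conj[OF pa' eventually_ge_at_top[of N1]]]]
  obtain n where n: "cmod (z_coord C' q') * inverse r' ^ n < a'" "positively_associated_at f p U q n"
     "positively_associated_at f' p' U' q' n" "N1 \<le> n"
    using eventually_happens'[OF sequentially_bot] by blast
  define qn where "qn = (inv f ^^ n) q"
  have hqn: "h qn = (inv f' ^^ n) q'" by (simp add: qn_def biter[symmetric] conj(3))
  have "qn \<in> D_disk U C (cmod (z_coord C q))"
    unfolding qn_def by (rule S.backward_disk(1)) (use q in \<open>simp add: D_disk_def\<close>)
  then have zq: "cmod (z_coord C qn) < a" using q(2) by (simp add: D_disk_def)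
  have zq': "cmod (z_coord C' (h qn)) < a'"
  proof -
    have "cmod (z_coord C' q') = r' ^ n * cmod (z_coord C' (h qn))"
      using S'.backward_disk(2)[OF q', of n] S'.params by (simp add: hqn norm_mult norm_power)
    then have "cmod (z_coord C' q') * inverse r' ^ n = cmod (z_coord C' (h qn))"
      using S'.params by (simp add: field_simps power_inverse)
    then show ?thesis using n(1) by simp
  qed
  obtain \<mu> where \<mu>: "S.tangential_transit qn (n + N1) t1 \<mu>"
    using S.tangential_transit_exists[OF A k1 ck(1,2) lc(1) q(1) n(2) f1 t1 n(4)] unfolding qn_def by blast
  obtain \<mu>' where \<mu>': "S'.tangential_transit (h qn) (n + N1) t1' \<mu>'"
    using S'.tangential_transit_exists[OF A k1 ck(3,4) lc(2) q' n(3) f1' t1'(1,3) n(4)] unfolding hqn by blast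
  obtain \<kappa> \<epsilon> where \<kappa>: "\<kappa> \<noteq> 0" "0 < \<epsilon>" and
    lin: "(\<forall>x\<in>D_disk U C \<epsilon>. z_coord C' (h x) = \<kappa> * z_coord C x) \<or>
     (\<forall>x\<in>D_disk U C \<epsilon>. z_coord C' (h x) = \<kappa> * cnj (z_coord C x))"
    using conjugacy_linear_near_fixed_point[OF S S' hom conj(1,2) a' box \<mu> \<mu>' zq t1(2) zq' t1'(2) irr] by metis
  define W where "W = local_unstable f p U"
  define W' where "W' = local_unstable f' p' U'"
  have disk_W: "x \<in> W" "h x \<in> W'" if "x \<in> D_disk U C a" for x
    using that diskh[OF that] S.unstable S'.unstable by (auto simp: D_disk_def W_def W'_def)
  have ext: "z_coord C' (h x) = \<kappa> * \<sigma> (z_coord C x)"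
    if "\<sigma> = (\<lambda>z. z) \<or> \<sigma> = cnj" "\<And>x. x \<in> D_disk U C \<epsilon> \<Longrightarrow> z_coord C' (h x) = \<kappa> * \<sigma> (z_coord C x)"
      "x \<in> W" "h x \<in> W'" for \<sigma> x
    by (rule conjugacy_linear_on_unstable[OF S S' bh conj(1) \<kappa> that(1,2)]) (use that disk_W in \<open>auto simp: W_def W'_def\<close>)
  have injW: "inj_on (z_coord C) W"
  proof (rule inj_onI)
    fix x y assume xy: "x \<in> W" "y \<in> W" "z_coord C x = z_coord C y"
    have "x \<in> U" "y \<in> U" using xy by (auto simp: W_def local_unstable_def dest: spec[of _ 0])
    moreover from this have "t_coord C x = 0" "t_coord C y = 0" using xy(1,2) S.unstable unfolding W_def by blast+
    then have "snd C x = snd C y" using xy(3) by (simp add: prod_eq_iff)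
    ultimately show "x = y" using S.U(3) by (intro S.coord_inj) auto
  qed
  define g where "g w = z_coord C' (h (inv_into W (z_coord C) w))" for w
  define D where "D = z_coord C ` (W \<inter> h -` W')"
  have pres: "preserves_unstable_orientation W C W' C' h \<longleftrightarrow> orientation_preserving_on D g"
    by (simp add: preserves_unstable_orientation_def D_def g_def[abs_def])
  have gD: "g w = \<kappa> * \<sigma> w"
    if lin: "\<And>x. x \<in> W \<Longrightarrow> h x \<in> W' \<Longrightarrow> z_coord C' (h x) = \<kappa> * \<sigma> (z_coord C x)" and w: "w \<in> D" for \<sigma> w
  proof -
    obtain x where x: "x \<in> W" "h x \<in> W'" "w = z_coord C x" using w by (auto simp: D_def)
    have "inv_into W (z_coord C) w = x" by (rule inv_into_f_eq[OF injW x(1)]) (simp add: x(3))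
    then show ?thesis using lin[OF x(1,2)] x(3) by (simp add: g_def)
  qed
  have zq0: "z_coord C q \<noteq> 0"
  proof
    assume "z_coord C q = 0"
    then have "snd C q = snd C p" using q S.origin by (simp add: D_disk_def prod_eq_iff)
    then have "q = p" using q S.U by (intro S.coord_inj) (auto simp: D_disk_def)
    then show False using qp by simp
  qed
  from lin show ?thesis
  proof
    assume "\<forall>x\<in>D_disk U C \<epsilon>. z_coord C' (h x) = \<kappa> * z_coord C x"
    then have lin: "\<And>x. x \<in> W \<Longrightarrow> h x \<in> W' \<Longrightarrow> z_coord C' (h x) = \<kappa> * z_coord C x"
      using ext[of "\<lambda>z. z"] by blast
    have "orientation_preserving_on D g" unfolding orientation_preserving_on_def
    proof (intro allI impI, elim conjE)
      fix w \<rho> assume "0 < \<rho>" "cball w \<rho> \<subseteq> D"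
      then show "winding_number (g \<circ> circlepath w \<rho>) (g w) = 1"
        using gD[of "\<lambda>z. z", OF lin] by (intro winding_number_linear_circle[OF \<kappa>(1)]) auto
    qed
    then have "preserves_unstable_orientation W C W' C' h" by (simp add: pres)
    moreover have "z_coord C s / z_coord C q = z_coord C' (h s) / z_coord C' q'"
      unfolding conj(3)[symmetric] lin[OF disk_W[OF s]] lin[OF disk_W[OF q(1)]] using \<kappa>(1) by simp
    ultimately show ?thesis by (simp add: W_def W'_def)
  next
    assume "\<forall>x\<in>D_disk U C \<epsilon>. z_coord C' (h x) = \<kappa> * cnj (z_coord C x)"
    then have lin: "\<And>x. x \<in> W \<Longrightarrow> h x \<in> W' \<Longrightarrow> z_coord C' (h x) = \<kappa> * cnj (z_coord C x)"
      using ext[of cnj] by blast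
    have "cball 0 a \<subseteq> D"
    proof
      fix w :: complex assume "w \<in> cball 0 a"
      then have "chart_inv C (w, 0) \<in> D_disk U C a" "z_coord C (chart_inv C (w, 0)) = w"
        using S.box_point(1,2)[of w 0] a by (auto simp: D_disk_def)
      then show "w \<in> D" using disk_W unfolding D_def by (intro image_eqI[of _ _ "chart_inv C (w, 0)"]) auto
    qed
    moreover from this have "winding_number (g \<circ> circlepath 0 a) (g 0) = - 1"
      using gD[of cnj, OF lin] a by (intro winding_number_antilinear_circle[OF \<kappa>(1)]) auto
    ultimately have "\<not> orientation_preserving_on D g" using a unfolding orientation_preserving_on_def by force
    then have "\<not> preserves_unstable_orientation W C W' C' h" by (simp add: pres)
    moreover have "z_coord C s / z_coord C q = cnj (z_coord C' (h s) / z_coord C' q')"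
      unfolding conj(3)[symmetric] lin[OF disk_W[OF s]] lin[OF disk_W[OF q(1)]] using \<kappa>(1) by simp
    ultimately show ?thesis by (simp add: W_def W'_def)
  qed
qed

theorem corollary3:
  fixes k :: enat
    and A :: "'m::{t2_space,second_countable_topology} chart set"
    and f :: "'m \<Rightarrow> 'm" and p q qh :: 'm
    and r \<theta> l a t0 :: real and N :: nat
    and U V H :: "'m set" and C :: "'m chart"
    and E :: "(real \<times> real) set" and g :: "real \<times> real \<Rightarrow> real"
    and J :: "real set" and \<eta> :: "real \<Rightarrow> real"
  assumes "3 \<le> k" and "ck_3_manifold k A"
    and "saddle_focus_with_tangency k A f p q r \<theta> l U C"
    and "\<theta> / (2 * pi) \<notin> \<rat>"
    and "box_in_chart U C a"
    and "q \<in> D_disk U C a" and "cmod (z_coord C q) < a"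
    and "qh = (f ^^ N) q" and "qh \<in> U_box U C a"
    and "snd C qh = (0, t0)" and "0 < t0" and "t0 < a"
    and "open V" and "qh \<in> V" and "V \<subseteq> U_box U C a"
    and "H = connected_component_of_set (subtopology (unstable_topology f p U) V) qh"
    and "quadratic_fold_graph k C t0 H E g J \<eta>"
  shows "\<forall>\<^sub>F n0 in sequentially.
    spanning_disk U C a (fold_disk f (U_box U C a) H qh n0) \<longrightarrow>
    (\<forall>\<^sub>F (u, zh) in sequentially \<times>\<^sub>F nhds q.
      zh \<in> fold_half_disk_iterate f (U_box U C a) C H \<eta> qh n0 u \<and>
      transverse_homoclinic_point k A f p U zh \<longrightarrow>
      (\<forall>n s. s = (inv f ^^ n) zh \<and> s \<in> D_disk U C a \<longrightarrow>
        (\<forall>f' p' q' r' \<theta>' l' U' C' a' b' h s'.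
          saddle_focus_with_tangency k A f' p' q' r' \<theta>' l' U' C' \<and>
          homeomorphism UNIV UNIV h (inv h) \<and> f' = h \<circ> f \<circ> inv h \<and> h p = p' \<and> h q = q' \<and>
          0 < a' \<and> a' < b' \<and> box_in_chart U' C' b' \<and>
          U_box U' C' a' \<subseteq> h ` U_box U C a \<and> h ` U_box U C a \<subseteq> U_box U' C' b' \<and>
          s' = h s \<longrightarrow>
          (if preserves_unstable_orientation (local_unstable f p U) C (local_unstable f' p' U') C' h
           then z_coord C s / z_coord C q = z_coord C' s' / z_coord C' q'
           else z_coord C s / z_coord C q = cnj (z_coord C' s' / z_coord C' q')))))"
proof (rule always_eventually, intro allI impI, rule always_eventually, unfold split_paired_All prod.case,
    intro allI impI, elim conjE)
  fix n s f' p' q' r' \<theta>' l' U' C' a' b' h s'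
  assume s: "s \<in> D_disk U C a" and sf': "saddle_focus_with_tangency k A f' p' q' r' \<theta>' l' U' C'"
    and hom: "homeomorphism UNIV UNIV h (inv h)" and conj: "f' = h \<circ> f \<circ> inv h" "h p = p'" "h q = q'"
    and a': "0 < a'" "a' < b'" and b': "box_in_chart U' C' b'"
    and box: "U_box U' C' a' \<subseteq> h ` U_box U C a" "h ` U_box U C a \<subseteq> U_box U' C' b'" and s': "s' = h s"
  have "snd C ((f ^^ N) q) = (0, t0)" "(f ^^ N) q \<in> U" using assms(8-10) by (simp_all add: U_box_def)
  then show "if preserves_unstable_orientation (local_unstable f p U) C (local_unstable f' p' U') C' h
           then z_coord C s / z_coord C q = z_coord C' s' / z_coord C' q'
           else z_coord C s / z_coord C q = cnj (z_coord C' s' / z_coord C' q')"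
    unfolding s'
    by (rule conjugacy_respects_ratios[OF assms(1-3) sf' assms(4-7) _ _ assms(11,12) s hom conj a' b' box])
qed

end
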